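(* Let $\kappa>0$, $\lambda\in\mathbb C$, and let $\gamma:=\min_{m\in\{6,7\}}\operatorname{gap}(H_{[1,m]})$, $\Gamma:=\max_{m\in\{6,7\}}\|H_{[1,m]}\|$. Let $n\ge2$ be an integer such that $$g_n:=\inf_{0\le r\le5}\operatorname{gap}\big(H_{[1,3(n+1)+r]}\big)>\frac{\Gamma}{n}.$$ Then for all integers $N>n$ and $r\in\{0,1,\dots,5\}$, $$\operatorname{gap}\big(H^{\mathrm{per}}_{[1,6N+r]}\big)\ge\frac{\gamma\, n}{2\Gamma(n-1)}\Big[g_n-\frac{\Gamma}{n}\Big].$$ In particular, for any $\lambda$ with $f(|\lambda|^2)<1/3$, $$\liminf_{L\to\infty}\operatorname{gap}\big(H^{\mathrm{per}}_{[1,L]}\big)\ge\frac{\gamma}{6\Gamma}\Big(\min_{L\in\{8,9,10\}}\operatorname{gap}H_{[1,L]}\Big)\big(1-\sqrt{3f(|\lambda|^2)}\big)^2.$$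
   Context: For a finite interval $\Lambda=[a,b]\subset\mathbb Z$ let $\mathcal F_\Lambda$ be the fermionic Fock space over $\ell^2(\Lambda)$ with CAR operators $c_x,c_x^*$, $n_x=c_x^*c_x$. For $\kappa>0$, $\lambda\in\mathbb C$, $q_x=c_{x+1}c_{x+2}-\lambda c_xc_{x+3}$ and the open-boundary Hamiltonian is $H_\Lambda=\sum_{x=a}^{b-2}n_xn_{x+2}+\kappa\sum_{x=a}^{b-3}q_x^*q_x$. The periodic Hamiltonian is $H^{\mathrm{per}}_{[a,b]}=\sum_{x=a}^{b}(n_xn_{x+2}+\kappa q_x^*q_x)$ where site indices are identified cyclically, $b+k\equiv a+k-1$ for $k\in\mathbb N$. For a nonnegative self-adjoint $H$ with nontrivial kernel, $\operatorname{gap}H=\inf\{\langle\psi,H\psi\rangle:\psi\perp\ker H,\|\psi\|=1\}$. For $r\ge0$ let $\mu_\pm=(1\pm\sqrt{1+4r})/2$, $\mu=\mu_-/\mu_+$, $\alpha_k=\frac{1}{\mu_+}\frac{1-\mu^k}{1-\mu^{k+1}}$ ($k\ge1$), and for $n\ge4$, $f_n(r)=r\alpha_n\alpha_{n-2}\big(\frac{[1-\alpha_{n-1}(1+r)]^2}{1+2r}+\alpha_{n-3}\frac{r(1-\alpha_{n-1})^2}{1+r}\big)$, $f(r)=\sup_{n\ge4}f_n(r)$. *)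

theory Defs
  imports "HOL-Analysis.Analysis" "HOL-Library.Extended_Real"
begin

text \<open>Fermionic Fock space over l2(Lambda), Lambda a finite set of integer sites, realised
  in the occupation-number basis: a vector is a function from configurations (subsets of
  Lambda) to complex amplitudes; amplitudes on non-subsets of Lambda are zero.
  The CAR operators are given by the Jordan--Wigner construction with respect to the
  natural order of the integer sites.\<close>

type_synonym fstate = "int set \<Rightarrow> complex"
type_synonym fop = "fstate \<Rightarrow> fstate"

definition fock :: "int set \<Rightarrow> fstate set" where
  "fock Lam = {psi. \<forall>S. \<not> S \<subseteq> Lam \<longrightarrow> psi S = 0}"

definition finner :: "int set \<Rightarrow> fstate \<Rightarrow> fstate \<Rightarrow> complex" where
  "finner Lam phi psi = (\<Sum>S\<in>Pow Lam. cnj (phi S) * psi S)"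

definition fnorm :: "int set \<Rightarrow> fstate \<Rightarrow> real" where
  "fnorm Lam psi = sqrt (Re (finner Lam psi psi))"

definition jw_sign :: "int set \<Rightarrow> int \<Rightarrow> complex" where
  "jw_sign S x = (-1) ^ card {y\<in>S. y < x}"

definition ann :: "int \<Rightarrow> fop" where
  "ann x psi = (\<lambda>S. if x \<notin> S then jw_sign S x * psi (insert x S) else 0)"

definition cre :: "int \<Rightarrow> fop" where
  "cre x psi = (\<lambda>S. if x \<in> S then jw_sign S x * psi (S - {x}) else 0)"

text \<open>Terms of the Hamiltonian; w maps formal site labels to actual sites
  (identity for open boundary, cyclic identification for periodic boundary).\<close>

definition nn_term :: "(int \<Rightarrow> int) \<Rightarrow> int \<Rightarrow> fop" where
  "nn_term w x psi = cre (w x) (ann (w x) (cre (w (x+2)) (ann (w (x+2)) psi)))"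

definition qop :: "complex \<Rightarrow> (int \<Rightarrow> int) \<Rightarrow> int \<Rightarrow> fop" where
  "qop lam w x psi = (\<lambda>S. ann (w (x+1)) (ann (w (x+2)) psi) S
                          - lam * ann (w x) (ann (w (x+3)) psi) S)"

definition qadj :: "complex \<Rightarrow> (int \<Rightarrow> int) \<Rightarrow> int \<Rightarrow> fop" where
  "qadj lam w x psi = (\<lambda>S. cre (w (x+2)) (cre (w (x+1)) psi) S
                           - cnj lam * cre (w (x+3)) (cre (w x) psi) S)"

definition H_open :: "real \<Rightarrow> complex \<Rightarrow> int \<Rightarrow> int \<Rightarrow> fop" where
  "H_open kap lam a b psi = (\<lambda>S. (\<Sum>x\<in>{a..b-2}. nn_term id x psi S)
      + complex_of_real kap * (\<Sum>x\<in>{a..b-3}. qadj lam id x (qop lam id x psi) S))"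

definition wrap :: "int \<Rightarrow> int \<Rightarrow> int \<Rightarrow> int" where
  "wrap a b y = a + (y - a) mod (b - a + 1)"

definition H_per :: "real \<Rightarrow> complex \<Rightarrow> int \<Rightarrow> int \<Rightarrow> fop" where
  "H_per kap lam a b psi = (\<lambda>S. (\<Sum>x\<in>{a..b}. nn_term (wrap a b) x psi S
      + complex_of_real kap * qadj lam (wrap a b) x (qop lam (wrap a b) x psi) S))"

definition ker_op :: "int set \<Rightarrow> fop \<Rightarrow> fstate set" where
  "ker_op Lam H = {psi \<in> fock Lam. H psi = (\<lambda>_. 0)}"

definition op_gap :: "int set \<Rightarrow> fop \<Rightarrow> real" where
  "op_gap Lam H = Inf {Re (finner Lam psi (H psi)) | psi.
      psi \<in> fock Lam \<and> (\<forall>phi\<in>ker_op Lam H. finner Lam phi psi = 0) \<and> fnorm Lam psi = 1}"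

definition op_norm :: "int set \<Rightarrow> fop \<Rightarrow> real" where
  "op_norm Lam H = Sup {fnorm Lam (H psi) | psi. psi \<in> fock Lam \<and> fnorm Lam psi = 1}"

definition gap_open :: "real \<Rightarrow> complex \<Rightarrow> int \<Rightarrow> real" where
  "gap_open kap lam m = op_gap {1..m} (H_open kap lam 1 m)"

definition norm_open :: "real \<Rightarrow> complex \<Rightarrow> int \<Rightarrow> real" where
  "norm_open kap lam m = op_norm {1..m} (H_open kap lam 1 m)"

definition gap_per :: "real \<Rightarrow> complex \<Rightarrow> int \<Rightarrow> real" where
  "gap_per kap lam L = op_gap {1..L} (H_per kap lam 1 L)"

definition mu_p :: "real \<Rightarrow> real" where "mu_p r = (1 + sqrt (1 + 4*r)) / 2"
definition mu_m :: "real \<Rightarrow> real" where "mu_m r = (1 - sqrt (1 + 4*r)) / 2"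
definition alpha :: "real \<Rightarrow> nat \<Rightarrow> real" where
  "alpha r k = (1 / mu_p r) * ((1 - (mu_m r / mu_p r)^k) / (1 - (mu_m r / mu_p r)^(k+1)))"
definition f_n :: "nat \<Rightarrow> real \<Rightarrow> real" where
  "f_n n r = r * alpha r n * alpha r (n-2) *
     ((1 - alpha r (n-1) * (1+r))^2 / (1 + 2*r) + alpha r (n-3) * (r * (1 - alpha r (n-1))^2 / (1+r)))"
definition f_sup :: "real \<Rightarrow> ereal" where
  "f_sup r = (SUP n\<in>{4..}. ereal (f_n n r))"

end

theory Submission
  imports Defs
begin

text \<open>
  For the ring, Knabe's argument is run on overlapping windows of six or seven sites: the kernel
  projections of distant windows commute, which bounds the square of the sum of all window
  projections from below by the gaps of open chains of windows.

  For the open chain, the martingale method reduces the uniform gap to bounding the overlap between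
  the ground states of the last nine sites and the ground states of a chain that are orthogonal to
  those of the chain enlarged by three sites. Ground states are superpositions of monomer-dimer
  tilings: a run of \<open>k\<close> monomers at distance three may be tiled by dimers, each weighted by \<open>lam\<close>,
  so its squared norm obeys the recursion \<open>b (k + 2) = b (k + 1) + (cmod lam)\<^sup>2 * b k\<close> and
  \<open>alpha k\<close> is the ratio \<open>b (k - 1) / b k\<close>. The overlap decomposes into such runs, and a run
  of length \<open>n\<close> contributes exactly \<open>f_n\<close>.
\<close>

section \<open>Orthogonal projections onto finite-dimensional subspaces\<close>

text \<open>On a window the Hamiltonian lies between its gap and its norm times \<open>Q\<close>,
  the complement of its kernel projection. Trading Hamiltonians for projections costs the ratio
  gamma / Gamma. The interaction reaches three sites, so blocks have at least three sites:
  neighbouring two-block windows, of six or seven sites, then miss no term, and windows two blocks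
  apart are disjoint. Each block lies in two windows, whence the 2 in the bound. The obstacle is
  locality: Jordan-Wigner operators are nonlocal and a window may cross the seam of the ring, so
  restriction to a window rests on a change of site order that corrects the signs. Nine sites hold
  three cells of three sites. A run of at most three cells is seen entirely by the last window and
  contributes nothing, so only \<open>f_n\<close> with n \<ge> 4 enters. Windows advance by three
  sites; each meets three martingale increments and each term lies in at most three windows: hence
  the 3 under the root and the factor 1/3. For \<open>lam = 0\<close> one cannot divide by
  \<open>lam\<close> to exclude configurations; ground spaces are then spanned by single
  configurations and the overlap vanishes.\<close>

definition fdim_subspace :: "'a::real_vector set \<Rightarrow> bool" where
  "fdim_subspace V \<longleftrightarrow> subspace V \<and> (\<exists>B. finite B \<and> V \<subseteq> span B)"

text \<open>The ambient spaces below need not be complete; finite dimension of \<open>V\<close>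
  takes the place of completeness in making the foot of the perpendicular exist.\<close>

definition oproj :: "'a::real_inner set \<Rightarrow> 'a \<Rightarrow> 'a" where
  "oproj V x = (THE y. y \<in> V \<and> (\<forall>v\<in>V. inner (x - y) v = 0))"

lemma fdim_subspace_imp_subspace: "fdim_subspace V \<Longrightarrow> subspace V"
  by (simp add: fdim_subspace_def)

lemma fdim_subspace_mono: "fdim_subspace V \<Longrightarrow> subspace U \<Longrightarrow> U \<subseteq> V \<Longrightarrow> fdim_subspace U"
  unfolding fdim_subspace_def by (meson subset_trans)

lemma oproj_exists_span:
  fixes B :: "'a::real_inner set"
  assumes "finite B"
  shows "\<exists>y\<in>span B. \<forall>v\<in>span B. inner (x - y) v = 0"
  using assms
proof (induction B arbitrary: x rule: finite_induct)
  case empty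
  show ?case by simp
next
  case (insert b B)
  obtain b1 where b1: "b1 \<in> span B" "\<forall>v\<in>span B. inner (b - b1) v = 0"
    using insert.IH by blast
  obtain y where y: "y \<in> span B" "\<forall>v\<in>span B. inner (x - y) v = 0"
    using insert.IH by blast
  define e where "e = b - b1"
  have e_span: "e \<in> span (insert b B)"
    unfolding e_def by (meson b1(1) insertI1 span_base span_diff span_mono subsetD subset_insertI)
  \<comment> \<open>A Gram-Schmidt step. If \<open>b\<close> already lies in the span, then
    \<open>e = 0\<close> and the division yields \<open>c = 0\<close>, for which \<open>ce\<close>
    below still holds.\<close>
  define c where "c = inner x e / inner e e"
  define z where "z = y + c *\<^sub>R e"
  have ye: "inner y e = 0" using b1 y(1) by (simp add: e_def inner_commute)
  have ce: "c * inner e e = inner x e" by (cases "e = 0") (auto simp: c_def)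
  have z1: "z \<in> span (insert b B)"
    unfolding z_def using e_span y(1) by (meson span_add span_mono span_scale subsetD subset_insertI)
  have "inner (x - z) v = 0" if v: "v \<in> span (insert b B)" for v
  proof -
    obtain k where k: "v - k *\<^sub>R b \<in> span B" using v span_breakdown_eq[of v b B] by blast
    define u where "u = v - k *\<^sub>R e"
    have "u = (v - k *\<^sub>R b) + k *\<^sub>R b1" by (simp add: u_def e_def algebra_simps)
    then have u: "u \<in> span B" using k b1(1) by (simp add: span_add span_scale)
    have "inner (x - z) u = 0"
      using y(2) b1(2) u by (simp add: z_def e_def inner_diff_left inner_add_left)
    moreover have "inner (x - z) e = 0"
      using ye ce by (simp add: z_def inner_diff_left inner_add_left)
    ultimately have "inner (x - z) (u + k *\<^sub>R e) = 0" by (simp add: inner_add_right)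
    then show ?thesis by (simp add: u_def)
  qed
  with z1 show ?case by blast
qed

lemma oproj_exists:
  fixes V :: "'a::real_inner set"
  assumes "fdim_subspace V"
  shows "\<exists>y\<in>V. \<forall>v\<in>V. inner (x - y) v = 0"
proof -
  obtain B where B: "B \<subseteq> V" "independent B" "V \<subseteq> span B"
    using maximal_independent_subset[of V] by blast
  obtain C where C: "finite C" "V \<subseteq> span C" using assms by (auto simp: fdim_subspace_def)
  have "finite B" using independent_span_bound[OF C(1) B(2)] B(1) C(2) by blast
  moreover have "span B = V"
    using B assms by (simp add: fdim_subspace_def span_subspace)
  ultimately show ?thesis using oproj_exists_span[of B x] by simp
qed

lemma oproj_unique:
  assumes "subspace V" "y \<in> V" "\<And>v. v \<in> V \<Longrightarrow> inner (x - y) v = 0"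
  shows "oproj V x = y"
  unfolding oproj_def
proof (rule the_equality)
  fix z assume z: "z \<in> V \<and> (\<forall>v\<in>V. inner (x - z) v = 0)"
  have d: "z - y \<in> V" using z assms subspace_diff by blast
  have "inner (z - y) (z - y) = inner (x - y) (z - y) - inner (x - z) (z - y)"
    by (simp add: inner_diff_left)
  also have "\<dots> = 0" using z d assms(3) by simp
  finally show "z = y" by simp
qed (use assms in auto)

context
  fixes V :: "'a::real_inner set"
  assumes V: "fdim_subspace V"
begin

lemma oproj_in: "oproj V x \<in> V"
  and oproj_orth: "v \<in> V \<Longrightarrow> inner (x - oproj V x) v = 0"
proof -
  obtain y where y: "y \<in> V" "\<forall>v\<in>V. inner (x - y) v = 0" using oproj_exists[OF V] by blast
  then have "oproj V x = y" using oproj_unique V by (metis fdim_subspace_def)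
  then show "oproj V x \<in> V" "v \<in> V \<Longrightarrow> inner (x - oproj V x) v = 0" using y by auto
qed

lemma oproj_ident: "x \<in> V \<Longrightarrow> oproj V x = x"
  using V by (intro oproj_unique) (auto simp: fdim_subspace_def)

lemma oproj_eq_0: "(\<And>v. v \<in> V \<Longrightarrow> inner x v = 0) \<Longrightarrow> oproj V x = 0"
  using V by (intro oproj_unique) (auto simp: fdim_subspace_def subspace_0)

lemma oproj_add: "oproj V (x + y) = oproj V x + oproj V y"
proof (rule oproj_unique)
  fix v assume "v \<in> V"
  then have "inner (x - oproj V x) v + inner (y - oproj V y) v = 0" by (simp add: oproj_orth)
  then show "inner (x + y - (oproj V x + oproj V y)) v = 0"
    by (simp add: inner_diff_left inner_add_left)
qed (use V oproj_in in \<open>auto simp: fdim_subspace_def subspace_add\<close>)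

lemma oproj_diff: "oproj V (x - y) = oproj V x - oproj V y"
proof (rule oproj_unique)
  fix v assume "v \<in> V"
  then have "inner (x - oproj V x) v - inner (y - oproj V y) v = 0" by (simp add: oproj_orth)
  then show "inner (x - y - (oproj V x - oproj V y)) v = 0"
    by (simp add: inner_diff_left)
qed (use V oproj_in in \<open>auto simp: fdim_subspace_def subspace_diff\<close>)

lemma oproj_scaleR: "oproj V (c *\<^sub>R x) = c *\<^sub>R oproj V x"
proof (rule oproj_unique)
  fix v assume "v \<in> V"
  then have "c * inner (x - oproj V x) v = 0" by (simp add: oproj_orth)
  then show "inner (c *\<^sub>R x - c *\<^sub>R oproj V x) v = 0"
    by (simp add: inner_diff_left right_diff_distrib)
qed (use V oproj_in in \<open>auto simp: fdim_subspace_def subspace_scale\<close>)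

lemma inner_oproj_right: "v \<in> V \<Longrightarrow> inner (oproj V x) v = inner x v"
  using oproj_orth[of v x] by (simp add: inner_diff_left)

lemma oproj_symmetric: "inner (oproj V x) y = inner x (oproj V y)"
  by (metis inner_commute inner_oproj_right oproj_in)

lemma inner_self_oproj: "inner x (oproj V x) = inner (oproj V x) (oproj V x)"
  by (simp add: inner_oproj_right oproj_in)

lemma inner_self_minus_oproj:
  "inner x (x - oproj V x) = inner (x - oproj V x) (x - oproj V x)"
  using inner_self_oproj[of x] by (simp add: inner_diff_left inner_diff_right inner_commute)

lemma minus_oproj_symmetric: "inner (x - oproj V x) y = inner x (y - oproj V y)"
  using oproj_symmetric[of x y] by (simp add: inner_diff_left inner_diff_right)

lemma norm_oproj_le: "norm (oproj V x) \<le> norm x"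
proof -
  have "(norm (oproj V x))\<^sup>2 \<le> norm x * norm (oproj V x)"
    using norm_cauchy_schwarz[of x "oproj V x"] inner_self_oproj[of x] by (simp add: power2_norm_eq_inner)
  then show ?thesis by (cases "norm (oproj V x) = 0") (auto simp: power2_eq_square)
qed

end

text \<open>\<open>B\<close> preserves the kernel of \<open>A\<close> and, being symmetric, also the
  orthogonal complement of that kernel, so it commutes with the projection onto it. That projection
  therefore preserves the kernel of \<open>B\<close>, and the same argument applied to it gives the
  claim.\<close>

lemma kernel_projections_commute:
  fixes F :: "'a::real_inner set"
  assumes F: "fdim_subspace F"
    and A: "linear A" "\<And>x. x \<in> F \<Longrightarrow> A x \<in> F" "\<And>x y. x \<in> F \<Longrightarrow> y \<in> F \<Longrightarrow> inner (A x) y = inner x (A y)"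
    and B: "linear B" "\<And>x. x \<in> F \<Longrightarrow> B x \<in> F" "\<And>x y. x \<in> F \<Longrightarrow> y \<in> F \<Longrightarrow> inner (B x) y = inner x (B y)"
    and comm: "\<And>x. x \<in> F \<Longrightarrow> A (B x) = B (A x)"
    and x: "x \<in> F"
  shows "oproj {x\<in>F. A x = 0} (oproj {x\<in>F. B x = 0} x) = oproj {x\<in>F. B x = 0} (oproj {x\<in>F. A x = 0} x)"
proof -
  let ?KA = "{x\<in>F. A x = 0}" and ?KB = "{x\<in>F. B x = 0}"
  have sF: "subspace F" using F by (simp add: fdim_subspace_def)
  have KA: "fdim_subspace ?KA"
    by (rule fdim_subspace_mono[OF F])
       (use sF A(1) in \<open>auto simp: subspace_def linear_add linear_scale linear_0\<close>)
  have KB: "fdim_subspace ?KB"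
    by (rule fdim_subspace_mono[OF F])
       (use sF B(1) in \<open>auto simp: subspace_def linear_add linear_scale linear_0\<close>)
  have inF: "oproj ?KA y \<in> F" "oproj ?KB y \<in> F" for y
    using oproj_in[OF KA] oproj_in[OF KB] by auto
  have step: "oproj ?KA (B y) = B (oproj ?KA y)" if y: "y \<in> F" for y
  proof (rule oproj_unique)
    show "subspace ?KA" using KA by (simp add: fdim_subspace_def)
    show "B (oproj ?KA y) \<in> ?KA"
      using comm[OF inF(1), of y] oproj_in[OF KA, of y] B(2) linear_0[OF B(1)] by auto
    fix v assume v: "v \<in> ?KA"
    have Bv: "B v \<in> ?KA" using v comm[of v] B(2) linear_0[OF B(1)] by auto
    have "y - oproj ?KA y \<in> F" using y inF sF subspace_diff by blast
    then have "inner (B (y - oproj ?KA y)) v = inner (y - oproj ?KA y) (B v)"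
      using B(3) v by blast
    also have "\<dots> = 0" using oproj_orth[OF KA Bv] .
    finally show "inner (B y - B (oproj ?KA y)) v = 0" by (simp add: linear_diff[OF B(1)])
  qed
  have KBinv: "oproj ?KA y \<in> ?KB" if "y \<in> ?KB" for y
  proof -
    have "B (oproj ?KA y) = oproj ?KA 0" using step[of y] that by simp
    also have "\<dots> = 0" by (rule oproj_eq_0[OF KA]) simp
    finally show ?thesis using inF by simp
  qed
  show ?thesis
  proof (rule oproj_unique[symmetric])
    show "subspace ?KB" using KB by (simp add: fdim_subspace_def)
    show "oproj ?KA (oproj ?KB x) \<in> ?KB" using KBinv oproj_in[OF KB] by blast
    fix v assume v: "v \<in> ?KB"
    have "inner (oproj ?KA (x - oproj ?KB x)) v = inner (x - oproj ?KB x) (oproj ?KA v)"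
      by (rule oproj_symmetric[OF KA])
    also have "\<dots> = 0" using oproj_orth[OF KB KBinv[OF v]] .
    finally show "inner (oproj ?KA x - oproj ?KA (oproj ?KB x)) v = 0"
      by (simp add: oproj_diff[OF KA])
  qed
qed

section \<open>Spectral gaps of nonnegative symmetric operators\<close>

context
  fixes F :: "'a::real_inner set" and A :: "'a \<Rightarrow> 'a"
  assumes F: "fdim_subspace F" and lin: "linear A"
    and maps: "\<And>x. x \<in> F \<Longrightarrow> A x \<in> F"
    and symm: "\<And>x y. x \<in> F \<Longrightarrow> y \<in> F \<Longrightarrow> inner (A x) y = inner x (A y)"
    and psd: "\<And>x. x \<in> F \<Longrightarrow> inner x (A x) \<ge> 0"
begin

lemma kernel_fdim: "fdim_subspace {x\<in>F. A x = 0}"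
  by (rule fdim_subspace_mono[OF F])
     (use F lin in \<open>auto simp: fdim_subspace_def subspace_def linear_add linear_scale linear_0\<close>)

lemma psd_cauchy_schwarz:
  assumes x: "x \<in> F" and y: "y \<in> F"
  shows "(inner x (A y))\<^sup>2 \<le> inner x (A x) * inner y (A y)"
proof -
  have sF: "subspace F" using F by (simp add: fdim_subspace_def)
  let ?a = "inner x (A x)" and ?b = "inner x (A y)" and ?c = "inner y (A y)"
  have yx: "inner y (A x) = ?b" using symm[OF y x] symm[OF x y] by (metis inner_commute)
  have q: "0 \<le> s * s * ?a + 2 * s * t * ?b + t * t * ?c" for s t
  proof -
    have "s *\<^sub>R x + t *\<^sub>R y \<in> F" using sF x y by (simp add: subspace_add subspace_scale)
    from psd[OF this] show ?thesis
      by (simp add: linear_add[OF lin] linear_scale[OF lin] inner_add_left inner_add_right yx algebra_simps)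
  qed
  show ?thesis
  proof (cases "?c = 0")
    case True
    \<comment> \<open>A vector of zero energy is orthogonal to all others in the form of
      \<open>A\<close>: otherwise a nonconstant affine function of \<open>t\<close> would be
      nonnegative on the whole line.\<close>
    have "?b = 0"
    proof (rule ccontr)
      assume b: "?b \<noteq> 0"
      have "0 \<le> ?a + 2 * t * ?b" for t using q[of 1 t] True by simp
      from this[of "- (?a + 1) / (2 * ?b)"] show False using b by (simp add: field_simps)
    qed
    then show ?thesis using True by simp
  next
    case False
    then have c: "?c > 0" using psd[OF y] by linarith
    have "0 \<le> ?c * (?c * ?a - ?b\<^sup>2)" using q[of ?c "- ?b"] by (simp add: algebra_simps power2_eq_square)
    then show ?thesis using c by (simp add: zero_le_mult_iff mult.commute)
  qed
qed

text \<open>A vector orthogonal to the kernel lies in the range, \<open>z = A y\<close>.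
  Cauchy-Schwarz for the form of \<open>A\<close>, applied to \<open>inner z (A y)\<close>, brings
  in \<open>inner y (A y)\<close>, which the square bound limits by \<open>inner z z / c\<close>.
  This takes the place of a diagonalisation of \<open>A\<close>.\<close>

lemma gap_from_square_bound:
  assumes c: "c > 0" and sq: "\<And>x. x \<in> F \<Longrightarrow> c * inner x (A x) \<le> inner (A x) (A x)"
    and z: "z \<in> F" and orth: "\<And>v. v \<in> F \<Longrightarrow> A v = 0 \<Longrightarrow> inner z v = 0"
  shows "c * inner z z \<le> inner z (A z)"
proof -
  have sF: "subspace F" using F by (simp add: fdim_subspace_def)
  have R: "fdim_subspace (A ` F)"
    by (rule fdim_subspace_mono[OF F]) (use lin sF maps linear_subspace_image in auto)
  obtain y where y: "y \<in> F" "oproj (A ` F) z = A y" using oproj_in[OF R, of z] by auto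
  define u where "u = z - A y"
  have uF: "u \<in> F" unfolding u_def using z y maps sF subspace_diff by blast
  have u0: "inner u (A v) = 0" if "v \<in> F" for v
    unfolding u_def using oproj_orth[OF R, of "A v" z] that y by simp
  have "inner (A u) (A u) = inner u (A (A u))" using symm uF maps by blast
  then have Au: "A u = 0" using u0[of "A u"] uF maps by simp
  have "inner u u = inner z u - inner (A y) u" by (simp add: u_def inner_diff_left)
  also have "inner z u = 0" using orth uF Au by blast
  also have "inner (A y) u = 0" using u0[OF y(1)] by (simp add: inner_commute)
  finally have zy: "z = A y" by (simp add: u_def)
  have "(inner z z)\<^sup>2 \<le> inner z (A z) * inner y (A y)"
    using psd_cauchy_schwarz[OF z y(1)] zy by simp
  also have "\<dots> \<le> inner z (A z) * (inner z z / c)"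
    using sq[OF y(1)] c psd[OF z] zy by (intro mult_left_mono) (auto simp: field_simps)
  finally have *: "inner z z * (c * inner z z) \<le> inner z z * inner z (A z)"
    using c by (simp add: field_simps power2_eq_square)
  show ?thesis
    using * psd[OF z] by (cases "z = 0") (auto simp: mult_le_cancel_left)
qed

text \<open>The converse. Removing the kernel component changes neither side; on the complement,
  Cauchy-Schwarz for \<open>u\<close> and \<open>A u\<close> turns the lower bound on the form into
  one on the square.\<close>

lemma square_bound_from_gap:
  assumes c: "c \<ge> 0"
    and gap: "\<And>z. z \<in> F \<Longrightarrow> (\<And>v. v \<in> F \<Longrightarrow> A v = 0 \<Longrightarrow> inner z v = 0) \<Longrightarrow> c * inner z z \<le> inner z (A z)"
    and x: "x \<in> F"
  shows "c * inner x (A x) \<le> inner (A x) (A x)"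
proof -
  have sF: "subspace F" using F by (simp add: fdim_subspace_def)
  let ?K = "{x\<in>F. A x = 0}"
  define v u where "v = oproj ?K x" and "u = x - v"
  have v: "v \<in> F" "A v = 0" using oproj_in[OF kernel_fdim, of x] by (auto simp: v_def)
  have uF: "u \<in> F" using x v sF subspace_diff by (auto simp: u_def)
  have Au: "A u = A x" using v by (simp add: u_def linear_diff[OF lin])
  have g: "c * inner u u \<le> inner u (A u)"
    by (rule gap[OF uF]) (use oproj_orth[OF kernel_fdim] in \<open>auto simp: u_def v_def\<close>)
  have "inner x (A x) = inner u (A u)"
    using symm[OF v(1) x] v Au by (simp only: Au) (simp add: u_def inner_diff_left)
  moreover have "c * inner u (A u) \<le> inner (A u) (A u)"
  proof (cases "inner u (A u) \<le> 0 \<or> c = 0")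
    case True
    then have "c * inner u (A u) \<le> 0" using c by (auto simp: mult_nonneg_nonpos)
    then show ?thesis using inner_ge_zero[of "A u"] by linarith
  next
    case False
    let ?q = "inner u (A u)"
    have q: "?q > 0" "c > 0" using False c by auto
    have "?q * ?q \<le> inner u u * inner (A u) (A u)"
      using Cauchy_Schwarz_ineq[of u "A u"] by (simp add: power2_eq_square)
    then have "c * ?q * ?q \<le> (c * inner u u) * inner (A u) (A u)" using q by (simp add: mult.assoc)
    also have "\<dots> \<le> ?q * inner (A u) (A u)" using g by (intro mult_right_mono) auto
    finally show ?thesis using q by (simp add: mult.commute mult_le_cancel_left)
  qed
  ultimately show ?thesis by (simp add: Au)
qed

end

section \<open>Knabe's finite-size criterion\<close>

lemma sum_periodic_int:
  fixes f :: "int \<Rightarrow> 'a::ab_group_add"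
  assumes "\<And>k. f (k + M) = f k"
  shows "(\<Sum>k\<in>{d..<d+M}. f k) = (\<Sum>k\<in>{0..<M}. f k)"
proof (cases "M > 0")
  case M: True
  have step: "(\<Sum>k\<in>{d+1..<d+1+M}. f k) = (\<Sum>k\<in>{d..<d+M}. f k)" for d
  proof -
    have "{d..<d+M} = insert d {d+1..<d+M}" "{d+1..<d+1+M} = insert (d+M) {d+1..<d+M}" using M by auto
    then show ?thesis using assms[of d] by simp
  qed
  show ?thesis
  proof (induction d rule: int_induct[where k=0])
    case (step1 i) then show ?case using step[of i] by simp
  next
    case (step2 i) then show ?case using step[of "i-1"] by simp
  qed simp
qed simp

lemma sum_shift_periodic_int:
  fixes f :: "int \<Rightarrow> 'a::ab_group_add"
  assumes "\<And>k. f (k + M) = f k"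
  shows "(\<Sum>k\<in>{0..<M}. f (k + d)) = (\<Sum>k\<in>{0..<M}. f k)"
proof -
  have "(\<Sum>k\<in>{0..<M}. f (k + d)) = (\<Sum>k\<in>{d..<d+M}. f k)"
    by (rule sum.reindex_bij_witness[of _ "\<lambda>k. k - d" "\<lambda>k. k + d"]) auto
  then show ?thesis using sum_periodic_int[of f M d] assms by simp
qed

text \<open>Only pairs at ring distance two or more are known to be nonnegative, so a partial sum
  may be enlarged to the full one only if it already contains the distances -1, 0 and 1. The inner
  rows of the n by n square do. The first and the last row do not, but together they cover -(n-1),
  ..., n-1 with 0 counted twice. This makes n - 1 full sums and one extra diagonal.\<close>

lemma knabe_counting:
  fixes p :: "int \<Rightarrow> int \<Rightarrow> real" and n M :: int
  assumes n: "n \<ge> 2" and M: "M \<ge> 2 * n"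
    and per: "\<And>i j. p (i + M) j = p i j" "\<And>i j. p i (j + M) = p i j"
    and sym: "\<And>i j. p i j = p j i"
    and pos: "\<And>i d. 2 \<le> d \<Longrightarrow> d \<le> M - 2 \<Longrightarrow> p i (i + d) \<ge> 0"
  shows "(\<Sum>k\<in>{0..<M}. \<Sum>s\<in>{0..<n}. \<Sum>t\<in>{0..<n}. p (k + s) (k + t))
    \<le> (n - 1) * (\<Sum>i\<in>{0..<M}. \<Sum>j\<in>{0..<M}. p i j) + (\<Sum>i\<in>{0..<M}. p i i)"
proof -
  define c where "c d = (\<Sum>k\<in>{0..<M}. p k (k + d))" for d
  define H where "H = (\<Sum>d\<in>{0..<M}. c d)"
  have perk: "p (i + M) (j + M) = p i j" for i j using per by simp
  have cper: "c (d + M) = c d" for d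
    unfolding c_def using per(2) by (intro sum.cong refl) (metis add.assoc)
  have csym: "c (- d) = c d" for d
  proof -
    have "c (- d) = (\<Sum>k\<in>{0..<M}. p (k + d) (k + d - d))"
      unfolding c_def
      by (subst sum_shift_periodic_int[of "\<lambda>k. p k (k - d)" M d])
         (use perk in \<open>simp_all add: diff_add_eq[symmetric]\<close>)
    then show ?thesis by (simp add: c_def sym)
  qed
  have cpos: "c d \<ge> 0" if "2 \<le> d" "d \<le> M - 2" for d
    unfolding c_def using pos that by (intro sum_nonneg) auto
  have Hd: "H = (\<Sum>d\<in>{a..<a+M}. c d)" for a
    unfolding H_def using sum_periodic_int[of c M a] cper by simp
  have HH: "(\<Sum>i\<in>{0..<M}. \<Sum>j\<in>{0..<M}. p i j) = H"
  proof -
    have "(\<Sum>j\<in>{0..<M}. p i j) = (\<Sum>d\<in>{0..<M}. p i (i + d))" for i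
      using sum_shift_periodic_int[of "p i" M i] per(2) by (simp add: add.commute)
    then have "(\<Sum>i\<in>{0..<M}. \<Sum>j\<in>{0..<M}. p i j) = (\<Sum>i\<in>{0..<M}. \<Sum>d\<in>{0..<M}. p i (i + d))" by simp
    also have "\<dots> = H" unfolding H_def c_def by (rule sum.swap)
    finally show ?thesis .
  qed
  have "(\<Sum>k\<in>{0..<M}. \<Sum>s\<in>{0..<n}. \<Sum>t\<in>{0..<n}. p (k + s) (k + t))
      = (\<Sum>s\<in>{0..<n}. \<Sum>t\<in>{0..<n}. \<Sum>k\<in>{0..<M}. p (k + s) (k + t))"
    by (subst sum.swap) (intro sum.cong refl sum.swap)
  also have "\<dots> = (\<Sum>s\<in>{0..<n}. \<Sum>t\<in>{0..<n}. c (t - s))"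
  proof (intro sum.cong refl)
    fix s t
    have "(\<Sum>k\<in>{0..<M}. p (k + s) (k + s + (t - s))) = (\<Sum>k\<in>{0..<M}. p k (k + (t - s)))"
      by (rule sum_shift_periodic_int[of "\<lambda>k. p k (k + (t - s))" M s])
         (metis add.assoc add.commute perk)
    then show "(\<Sum>k\<in>{0..<M}. p (k + s) (k + t)) = c (t - s)" by (simp add: c_def)
  qed
  also have "\<dots> \<le> (n - 1) * H + c 0"
  proof -
    define g where "g s = (\<Sum>t\<in>{0..<n}. c (t - s))" for s
    have gs: "g s = (\<Sum>d\<in>{-s..<n-s}. c d)" for s
      unfolding g_def by (rule sum.reindex_bij_witness[of _ "\<lambda>k. k + s" "\<lambda>k. k - s"]) auto
    have mid: "g s \<le> H" if "1 \<le> s" "s \<le> n - 2" for s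
      unfolding gs Hd[of "-s"] using that M n by (intro sum_mono2 cpos) auto
    have ends: "g 0 + g (n - 1) \<le> H + c 0"
    proof -
      have "g (n - 1) = (\<Sum>d\<in>{-(n-1)..<1}. c d)" by (simp add: gs)
      also have "{-(n-1)..<1::int} = insert 0 {-(n-1)..<0}" using n by auto
      finally have "g (n - 1) = c 0 + (\<Sum>d\<in>{-(n-1)..<0}. c d)" by simp
      moreover have "(\<Sum>d\<in>{-(n-1)..<0}. c d) + g 0 = (\<Sum>d\<in>{-(n-1)..<n}. c d)"
        unfolding gs using n by (subst sum.union_disjoint[symmetric]) (auto intro!: sum.cong)
      \<comment> \<open>\<open>M \<ge> 2 * n\<close> keeps these 2 n - 1 distances within one
        period, and the distances added all lie between 2 and M - 2.\<close>
      moreover have "(\<Sum>d\<in>{-(n-1)..<n}. c d) \<le> H"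
        unfolding Hd[of "-(n-1)"] using M n by (intro sum_mono2 cpos) auto
      ultimately show ?thesis by linarith
    qed
    have "{0..<n} = insert 0 (insert (n-1) {1..<n-1})" using n by auto
    then have "(\<Sum>s\<in>{0..<n}. g s) = g 0 + g (n - 1) + (\<Sum>s\<in>{1..<n-1}. g s)" using n by simp
    also have "\<dots> \<le> H + c 0 + (\<Sum>s\<in>{1..<n-1}. H)"
      by (rule add_mono[OF ends sum_mono]) (use mid in auto)
    also have "\<dots> = (n - 1) * H + c 0" using n by (simp add: algebra_simps)
    finally show ?thesis by (simp add: g_def)
  qed
  finally show ?thesis unfolding HH by (simp add: c_def)
qed

text \<open>For the sum A of all complements this says that A squared dominates (n e - 1) / (n - 1)
  times A, which is a gap of A. The constant \<open>e\<close> is the same quantity for n consecutive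
  complements.\<close>

lemma knabe_square_bound:
  fixes K :: "int \<Rightarrow> 'a::real_inner set" and n M :: int and e :: real
  assumes n: "n \<ge> 2" and M: "M \<ge> 2 * n"
    and K: "\<And>i. fdim_subspace (K i)" and per: "\<And>i. K (i + M) = K i"
    and Q: "\<And>i. Q i = x - oproj (K i) x"
    and comm: "\<And>i d. 2 \<le> d \<Longrightarrow> d \<le> M - 2 \<Longrightarrow>
          oproj (K i) (oproj (K (i + d)) x) = oproj (K (i + d)) (oproj (K i) x)"
    and win: "\<And>k. e * (\<Sum>t\<in>{0..<n}. inner (Q (k + t)) (Q (k + t)))
          \<le> inner (\<Sum>t\<in>{0..<n}. Q (k + t)) (\<Sum>t\<in>{0..<n}. Q (k + t))"
  shows "(n * e - 1) * (\<Sum>i\<in>{0..<M}. inner (Q i) (Q i))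
    \<le> (n - 1) * inner (\<Sum>i\<in>{0..<M}. Q i) (\<Sum>i\<in>{0..<M}. Q i)"
proof -
  define p where "p i j = inner (Q i) (Q j)" for i j
  have Qper: "Q (i + M) = Q i" for i by (simp add: Q per)
  have pos: "p i (i + d) \<ge> 0" if d: "2 \<le> d" "d \<le> M - 2" for i d
  proof -
    let ?P = "oproj (K i)" and ?R = "oproj (K (i + d))"
    \<comment> \<open>\<open>?z\<close> is the image of \<open>x\<close> under both complements. As
      their order does not matter at \<open>x\<close>, the inner product can be rewritten as a
      squared norm.\<close>
    let ?z = "Q (i + d) - ?P (Q (i + d))"
    have z: "?z = Q i - ?R (Q i)"
      using comm[OF d] by (simp add: Q oproj_diff[OF K])
    have "inner (Q i) (Q (i + d)) = inner x (Q (i + d) - ?P (Q (i + d)))"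
      unfolding Q[of i] by (rule minus_oproj_symmetric[OF K])
    also have "\<dots> = inner x (?z - ?P ?z)"
      using oproj_ident[OF K oproj_in[OF K], of i "Q (i+d)"] by (simp add: oproj_diff[OF K])
    also have "\<dots> = inner (Q i) ?z" using minus_oproj_symmetric[OF K, of x i ?z] by (simp add: Q)
    also have "\<dots> = inner (Q i) (Q i - ?R (Q i))" by (simp only: z)
    also have "\<dots> \<ge> 0" by (simp add: inner_self_minus_oproj[OF K])
    finally show ?thesis by (simp add: p_def)
  qed
  have "n * e * (\<Sum>i\<in>{0..<M}. p i i) = e * (\<Sum>t\<in>{0..<n}. \<Sum>k\<in>{0..<M}. p (k + t) (k + t))"
  proof -
    have "(\<Sum>k\<in>{0..<M}. p (k + t) (k + t)) = (\<Sum>i\<in>{0..<M}. p i i)" for t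
      by (rule sum_shift_periodic_int[of "\<lambda>k. p k k"]) (simp add: p_def Qper)
    then show ?thesis using n by simp
  qed
  also have "\<dots> = (\<Sum>k\<in>{0..<M}. e * (\<Sum>t\<in>{0..<n}. p (k + t) (k + t)))"
    by (subst sum.swap) (simp add: sum_distrib_left)
  also have "\<dots> \<le> (\<Sum>k\<in>{0..<M}. \<Sum>s\<in>{0..<n}. \<Sum>t\<in>{0..<n}. p (k + s) (k + t))"
    by (intro sum_mono) (use win in \<open>simp add: p_def inner_sum_left inner_sum_right[of "Q _"]\<close>)
  also have "\<dots> \<le> (n - 1) * (\<Sum>i\<in>{0..<M}. \<Sum>j\<in>{0..<M}. p i j) + (\<Sum>i\<in>{0..<M}. p i i)"
    by (rule knabe_counting[OF n M]) (auto simp: p_def Qper inner_commute pos[unfolded p_def])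
  finally show ?thesis
    by (simp add: p_def inner_sum_left inner_sum_right[of "Q _"] algebra_simps)
qed

section \<open>The martingale method\<close>

text \<open>The increments \<open>D j\<close> are orthogonal and sum to \<open>x\<close>. Testing
  \<open>x\<close> against \<open>D j\<close> leaves the local defect \<open>b j\<close> and the
  part of \<open>oproj (W j) x\<close> seen by \<open>D j\<close>. Increments after \<open>j\<close>
  add nothing to that part because they lie in \<open>W j\<close>; those at least three stages
  earlier add nothing by commutation. The remaining three are bounded together by the overlap
  \<open>e\<close>. In the sum of squares over the stages every increment is then counted at most
  three times.\<close>

lemma martingale_bound:
  fixes G W :: "nat \<Rightarrow> 'a::real_inner set" and m :: nat
  assumes G: "\<And>j. fdim_subspace (G j)" and W: "\<And>j. fdim_subspace (W j)"
    and dec: "\<And>i j. i \<le> j \<Longrightarrow> G j \<subseteq> G i" and GW: "\<And>j. G j \<subseteq> W j" and W0: "W 0 = G 0"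
    and comm: "\<And>i j y. i + 3 \<le> j \<Longrightarrow> j \<le> m \<Longrightarrow> y \<in> F \<Longrightarrow> oproj (W j) (oproj (G i) y) = oproj (G i) (oproj (W j) y)"
    and e: "e \<ge> 0" "sqrt 3 * e \<le> 1"
    and overlap: "\<And>j y z. Suc j \<le> m \<Longrightarrow> y \<in> G j \<Longrightarrow> (\<And>v. v \<in> G (Suc j) \<Longrightarrow> inner y v = 0) \<Longrightarrow> z \<in> W (Suc j)
        \<Longrightarrow> inner z y \<le> e * norm z * norm y"
    and xF: "x \<in> F" and x: "\<And>v. v \<in> G m \<Longrightarrow> inner x v = 0"
  shows "(1 - sqrt 3 * e)\<^sup>2 * inner x x \<le> (\<Sum>j\<le>m. inner (x - oproj (W j) x) (x - oproj (W j) x))"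
proof -
  \<comment> \<open>For \<open>j = 0\<close> the space preceding \<open>G 0\<close> is the whole
    space.\<close>
  define E where "E j y = (if j = 0 then y else oproj (G (j - 1)) y) - oproj (G j) y" for j y
  define D where "D j = E j x" for j
  define a where "a j = norm (D j)" for j
  define b where "b j = norm (x - oproj (W j) x)" for j
  have sumD: "(\<Sum>i\<le>j. D i) = x - oproj (G j) x" for j
    by (induction j) (auto simp: D_def E_def)
  have Gm: "oproj (G m) x = 0" by (rule oproj_eq_0[OF G]) (rule x)
  have xD: "x = (\<Sum>i\<le>m. D i)" using sumD[of m] Gm by simp
  have E_orth: "inner (E j y) v = 0" if "v \<in> G j" for j y v
  proof (cases j)
    case 0 then show ?thesis using oproj_orth[OF G that] by (simp add: E_def)
  next
    case (Suc i)
    have "v \<in> G i" using that dec[of i j] Suc by auto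
    then have "inner (oproj (G i) y) v = inner y v" "inner (oproj (G j) y) v = inner y v"
      using that inner_oproj_right[OF G] by auto
    then show ?thesis using Suc by (simp add: E_def inner_diff_left)
  qed
  have D_in: "D j \<in> G i" if "i < j" for i j
  proof -
    have "oproj (G (j - 1)) x \<in> G i" "oproj (G j) x \<in> G i"
      using oproj_in[OF G] dec[of i "j-1"] dec[of i j] that by force+
    then show ?thesis using that fdim_subspace_imp_subspace[OF G] subspace_diff
      by (auto simp: D_def E_def)
  qed
  have ED_orth: "inner (E i y) (D j) = 0" if "i < j" for i j y using E_orth D_in[OF that] by blast
  have D_orth: "inner (D i) (D j) = 0" if "i \<noteq> j" for i j
    using that ED_orth[of i j x] ED_orth[of j i x] by (cases "i < j") (auto simp: D_def[of i] D_def[of j] inner_commute)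
  have norm_sum: "(norm (\<Sum>i\<in>I. D i))\<^sup>2 = (\<Sum>i\<in>I. (a i)\<^sup>2)" if "finite I" for I
    using that
  proof (induction I rule: finite_induct)
    case (insert i I)
    have "inner (D i) (\<Sum>i\<in>I. D i) = 0"
      unfolding inner_sum_right using insert.hyps D_orth by (intro sum.neutral) metis
    then show ?case using insert
      by (simp add: power2_norm_eq_inner inner_add_left inner_add_right inner_commute a_def)
  qed simp
  define J where "J j = {i. i \<le> j \<and> j \<le> i + 2}" for j :: nat
  have finJ: "finite (J j)" for j by (rule finite_subset[of _ "{..j}"]) (auto simp: J_def)
  define s where "s j = sqrt (\<Sum>i\<in>J j. (a i)\<^sup>2)" for j
  have key: "a j \<le> b j + e * s j" if jm: "j \<le> m" for j
  proof -
    have "(a j)\<^sup>2 = inner x (D j)"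
    proof -
      have "inner x (D j) = (\<Sum>i\<le>m. inner (D i) (D j))" by (subst xD) (simp add: inner_sum_left)
      also have "\<dots> = (\<Sum>i\<le>m. if i = j then (a j)\<^sup>2 else 0)"
        by (intro sum.cong refl) (auto simp: D_orth a_def power2_norm_eq_inner)
      also have "\<dots> = (a j)\<^sup>2" using jm by simp
      finally show ?thesis by simp
    qed
    also have "\<dots> = inner (x - oproj (W j) x) (D j) + inner (oproj (W j) x) (D j)"
      by (simp add: inner_diff_left)
    also have "inner (x - oproj (W j) x) (D j) \<le> b j * a j"
      unfolding a_def b_def by (rule norm_cauchy_schwarz)
    also have "inner (oproj (W j) x) (D j) \<le> e * s j * a j"
    proof (cases j)
      case 0
      then have "inner (oproj (W j) x) (D j) = 0"
        using E_orth[of "oproj (G 0) x" 0 x] oproj_in[OF G] by (simp add: W0 D_def inner_commute)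
      moreover have "0 \<le> e * s j * a j" using e by (simp add: s_def a_def sum_nonneg)
      ultimately show ?thesis by simp
    next
      case (Suc k)
      define u where "u = (\<Sum>i\<in>J j. D i)"
      have "inner (oproj (W j) x) (D j) = (\<Sum>i\<le>m. inner (D i) (oproj (W j) (D j)))"
        unfolding oproj_symmetric[OF W] by (subst xD) (simp add: inner_sum_left)
      also have "\<dots> = (\<Sum>i\<in>J j. inner (D i) (oproj (W j) (D j)))"
      proof (rule sum.mono_neutral_right)
        show "J j \<subseteq> {..m}" using jm by (auto simp: J_def)
        show "\<forall>i\<in>{..m} - J j. inner (D i) (oproj (W j) (D j)) = 0"
        proof
          fix i assume "i \<in> {..m} - J j"
          then consider "i > j" | "i + 3 \<le> j" by (force simp: J_def)
          then show "inner (D i) (oproj (W j) (D j)) = 0"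
          proof cases
            case 1
            then have "D i \<in> W j" using D_in GW by blast
            then have "oproj (W j) (D i) = D i" using oproj_ident[OF W] by blast
            then have "inner (D i) (oproj (W j) (D j)) = inner (D i) (D j)"
              by (metis oproj_symmetric[OF W])
            then show ?thesis using 1 D_orth by simp
          next
            case 2
            have c: "oproj (W j) (oproj (G i') x) = oproj (G i') (oproj (W j) x)" if "i' \<le> i" for i'
              using comm[of i' j x] 2 jm xF that by linarith
            have "oproj (W j) (D i) = E i (oproj (W j) x)"
              using c[of i] c[of "i-1"] by (simp add: D_def E_def oproj_diff[OF W])
            then show ?thesis using ED_orth[of i j] 2 by (simp add: oproj_symmetric[OF W, symmetric])
          qed
        qed
      qed simp
      also have "\<dots> = inner (oproj (W j) u) (D j)"
        by (simp add: u_def inner_sum_left oproj_symmetric[OF W])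
      also have "\<dots> \<le> e * norm (oproj (W j) u) * norm (D j)"
        using overlap[of k "D j" "oproj (W j) u"] Suc jm D_in[of k j] E_orth[of _ j x] oproj_in[OF W, of j u]
        by (simp add: D_def)
      also have "\<dots> \<le> e * norm u * norm (D j)"
        using e norm_oproj_le[OF W] by (intro mult_right_mono mult_left_mono) auto
      also have "norm u = s j"
        using norm_sum[OF finJ, of j] by (simp add: s_def u_def real_sqrt_unique[symmetric])
      finally show ?thesis by (simp add: a_def)
    qed
    finally have "a j * a j \<le> (b j + e * s j) * a j" by (simp add: power2_eq_square algebra_simps)
    moreover have "0 \<le> b j + e * s j" using e by (simp add: b_def s_def sum_nonneg)
    ultimately show ?thesis by (cases "a j = 0") (auto simp: a_def)
  qed
  have xx: "(norm x)\<^sup>2 = (\<Sum>i\<le>m. (a i)\<^sup>2)" using norm_sum[of "{..m}"] xD by simp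
  have "L2_set a {..m} \<le> L2_set (\<lambda>j. b j + e * s j) {..m}"
    using key by (intro L2_set_mono) (auto simp: a_def)
  also have "\<dots> \<le> L2_set b {..m} + L2_set (\<lambda>j. e * s j) {..m}" by (rule L2_set_triangle_ineq)
  also have "L2_set (\<lambda>j. e * s j) {..m} = e * L2_set s {..m}"
    using e by (simp add: L2_set_right_distrib)
  also have "L2_set s {..m} \<le> sqrt 3 * norm x"
  proof -
    have "(\<Sum>j\<le>m. (s j)\<^sup>2) = (\<Sum>j\<le>m. \<Sum>i\<in>J j. (a i)\<^sup>2)" by (simp add: s_def sum_nonneg)
    also have "\<dots> = (\<Sum>j\<le>m. \<Sum>i\<le>m. if i \<in> J j then (a i)\<^sup>2 else 0)"
    proof (rule sum.cong[OF refl])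
      fix j assume "j \<in> {..m}"
      then have "{i\<in>{..m}. i \<in> J j} = J j" by (auto simp: J_def)
      then show "(\<Sum>i\<in>J j. (a i)\<^sup>2) = (\<Sum>i\<le>m. if i \<in> J j then (a i)\<^sup>2 else 0)"
        using sum.inter_filter[of "{..m}" "\<lambda>i. (a i)\<^sup>2" "\<lambda>i. i \<in> J j"] by simp
    qed
    also have "\<dots> = (\<Sum>i\<le>m. \<Sum>j\<le>m. if i \<in> J j then (a i)\<^sup>2 else 0)" by (rule sum.swap)
    also have "\<dots> \<le> (\<Sum>i\<le>m. 3 * (a i)\<^sup>2)"
    proof (rule sum_mono)
      fix i assume "i \<in> {..m}"
      have "(\<Sum>j\<le>m. if i \<in> J j then (a i)\<^sup>2 else 0) = (\<Sum>j\<in>{j\<in>{..m}. i \<in> J j}. (a i)\<^sup>2)"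
        by (rule sum.inter_filter[symmetric]) simp
      also have "\<dots> \<le> (\<Sum>j\<in>{i, i+1, i+2}. (a i)\<^sup>2)"
        by (rule sum_mono2) (auto simp: J_def)
      finally show "(\<Sum>j\<le>m. if i \<in> J j then (a i)\<^sup>2 else 0) \<le> 3 * (a i)\<^sup>2" by simp
    qed
    finally have "(\<Sum>j\<le>m. (s j)\<^sup>2) \<le> 3 * (norm x)\<^sup>2" by (simp add: xx sum_distrib_left)
    then show ?thesis
      unfolding L2_set_def by (intro real_le_lsqrt) (auto simp: sum_nonneg power_mult_distrib)
  qed
  finally have "L2_set a {..m} \<le> L2_set b {..m} + e * (sqrt 3 * norm x)"
    using e by (simp add: mult_left_mono)
  moreover have "L2_set a {..m} = norm x" by (simp add: L2_set_def xx[symmetric])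
  ultimately have "(1 - sqrt 3 * e) * norm x \<le> L2_set b {..m}" by (simp add: algebra_simps)
  then have "((1 - sqrt 3 * e) * norm x)\<^sup>2 \<le> (L2_set b {..m})\<^sup>2"
    using e by (intro power_mono) auto
  then show ?thesis
    by (simp add: power_mult_distrib power2_norm_eq_inner[symmetric] L2_set_def sum_nonneg b_def)
qed

section \<open>Finitely supported amplitudes as a real inner product space\<close>

text \<open>One type holds the Fock spaces of all site sets, as the subspaces \<open>FV Lam\<close>.
  Finite support makes the inner product a finite sum; only its real part is kept, so that real
  inner product geometry applies.\<close>

typedef fvec = "{psi :: fstate. finite {S. psi S \<noteq> 0}}" morphisms amp Fvec
  by (rule exI[of _ "\<lambda>_. 0"]) simp

setup_lifting type_definition_fvec

lemma finite_amp: "finite {S. amp x S \<noteq> 0}" using amp[of x] by simp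

instantiation fvec :: real_vector
begin

lift_definition zero_fvec :: fvec is "\<lambda>_. 0" by simp
lift_definition plus_fvec :: "fvec \<Rightarrow> fvec \<Rightarrow> fvec" is "\<lambda>f g S. f S + g S"
proof -
  fix f g :: fstate
  assume "finite {S. f S \<noteq> 0}" "finite {S. g S \<noteq> 0}"
  then show "finite {S. f S + g S \<noteq> 0}"
    by - (rule finite_subset[of _ "{S. f S \<noteq> 0} \<union> {S. g S \<noteq> 0}"], auto)
qed
lift_definition minus_fvec :: "fvec \<Rightarrow> fvec \<Rightarrow> fvec" is "\<lambda>f g S. f S - g S"
proof -
  fix f g :: fstate
  assume "finite {S. f S \<noteq> 0}" "finite {S. g S \<noteq> 0}"
  then show "finite {S. f S - g S \<noteq> 0}"
    by - (rule finite_subset[of _ "{S. f S \<noteq> 0} \<union> {S. g S \<noteq> 0}"], auto)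
qed
lift_definition uminus_fvec :: "fvec \<Rightarrow> fvec" is "\<lambda>f S. - f S" by simp
lift_definition scaleR_fvec :: "real \<Rightarrow> fvec \<Rightarrow> fvec" is "\<lambda>c f S. complex_of_real c * f S"
  by (rule finite_subset) auto

instance
  by standard (transfer; simp add: fun_eq_iff algebra_simps)+

end

instantiation fvec :: real_inner
begin

definition inner_fvec :: "fvec \<Rightarrow> fvec \<Rightarrow> real" where
  "inner_fvec x y = (\<Sum>S | amp x S \<noteq> 0. Re (cnj (amp x S) * amp y S))"
definition norm_fvec :: "fvec \<Rightarrow> real" where "norm_fvec x = sqrt (inner x x)"
definition dist_fvec :: "fvec \<Rightarrow> fvec \<Rightarrow> real" where "dist_fvec x y = norm (x - y)"
definition sgn_fvec :: "fvec \<Rightarrow> fvec" where "sgn_fvec x = x /\<^sub>R norm x"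
definition uniformity_fvec :: "(fvec \<times> fvec) filter" where
  "uniformity_fvec = (INF e\<in>{0<..}. principal {(x, y). dist x y < e})"
definition open_fvec :: "fvec set \<Rightarrow> bool" where
  "open_fvec U = (\<forall>x\<in>U. eventually (\<lambda>(x', y). x' = x \<longrightarrow> y \<in> U) uniformity)"

lemma inner_fvec_superset:
  assumes "finite A" "{S. amp x S \<noteq> 0} \<subseteq> A"
  shows "inner x y = (\<Sum>S\<in>A. Re (cnj (amp x S) * amp y S))"
  unfolding inner_fvec_def using assms by (intro sum.mono_neutral_left) auto

instance
proof
  fix x y z :: fvec and r :: real
  let ?A = "{S. amp x S \<noteq> 0} \<union> {S. amp y S \<noteq> 0}"
  have A: "finite ?A" by (simp add: finite_amp)
  show "inner x y = inner y x"
    using inner_fvec_superset[OF A, of x y] inner_fvec_superset[OF A, of y x]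
    by (simp add: algebra_simps)
  have "{S. amp (x + y) S \<noteq> 0} \<subseteq> ?A" by (auto simp: plus_fvec.rep_eq)
  then show "inner (x + y) z = inner x z + inner y z"
    using inner_fvec_superset[OF A, of x z] inner_fvec_superset[OF A, of y z] inner_fvec_superset[OF A, of "x + y" z]
    by (simp add: plus_fvec.rep_eq sum.distrib[symmetric] algebra_simps)
  have "{S. amp (r *\<^sub>R x) S \<noteq> 0} \<subseteq> ?A" by (auto simp: scaleR_fvec.rep_eq)
  then show "inner (r *\<^sub>R x) y = r * inner x y"
    using inner_fvec_superset[OF A, of x y] inner_fvec_superset[OF A, of "r *\<^sub>R x" y]
    by (simp add: scaleR_fvec.rep_eq sum_distrib_left algebra_simps)
  have sq: "inner x x = (\<Sum>S | amp x S \<noteq> 0. (cmod (amp x S))\<^sup>2)"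
    unfolding inner_fvec_def by (intro sum.cong refl) (simp add: cmod_power2, simp add: power2_eq_square)
  show "0 \<le> inner x x" unfolding sq by (simp add: sum_nonneg)
  show "inner x x = 0 \<longleftrightarrow> x = 0"
  proof
    assume "inner x x = 0"
    then have "\<forall>S\<in>{S. amp x S \<noteq> 0}. (cmod (amp x S))\<^sup>2 = 0"
      unfolding sq by (subst (asm) sum_nonneg_eq_0_iff) (auto simp: finite_amp)
    then have "amp x S = amp 0 S" for S by (auto simp: zero_fvec.rep_eq)
    then show "x = 0" by (simp add: amp_inject[symmetric] fun_eq_iff)
  qed (simp add: inner_fvec_def zero_fvec.rep_eq)
qed (simp_all add: norm_fvec_def dist_fvec_def sgn_fvec_def uniformity_fvec_def open_fvec_def)

end

lemma amp_sum: "amp (\<Sum>i\<in>I. f i) S = (\<Sum>i\<in>I. amp (f i) S)"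
  by (induction I rule: infinite_finite_induct) (auto simp: zero_fvec.rep_eq plus_fvec.rep_eq)

section \<open>Fock space\<close>

lemma fock_outside: "psi \<in> fock Lam \<Longrightarrow> \<not> S \<subseteq> Lam \<Longrightarrow> psi S = 0"
  by (simp add: fock_def)

lemma amp_Fvec: "finite Lam \<Longrightarrow> psi \<in> fock Lam \<Longrightarrow> amp (Fvec psi) = psi"
  by (rule Fvec_inverse) (auto intro!: finite_subset[of _ "Pow Lam"] simp: fock_def)

definition FV :: "int set \<Rightarrow> fvec set" where "FV Lam = {x. amp x \<in> fock Lam}"

lemma Fvec_in_FV: "finite Lam \<Longrightarrow> psi \<in> fock Lam \<Longrightarrow> Fvec psi \<in> FV Lam"
  by (simp add: FV_def amp_Fvec)

lemma inner_eq_finner: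
  assumes "finite Lam" "x \<in> FV Lam"
  shows "inner x y = Re (finner Lam (amp x) (amp y))"
proof -
  have "{S. amp x S \<noteq> 0} \<subseteq> Pow Lam" using assms(2) by (auto simp: FV_def fock_def)
  then show ?thesis using inner_fvec_superset[of "Pow Lam" x y] assms(1) by (simp add: finner_def)
qed

lemma inner_Fvec:
  "finite Lam \<Longrightarrow> phi \<in> fock Lam \<Longrightarrow> psi \<in> fock Lam \<Longrightarrow> inner (Fvec phi) (Fvec psi) = Re (finner Lam phi psi)"
  by (simp add: inner_eq_finner[of Lam] Fvec_in_FV amp_Fvec)

text \<open>With real scalars each configuration needs two spanning vectors, of amplitude 1 and of
  amplitude the imaginary unit.\<close>

lemma fdim_FV:
  assumes "finite Lam"
  shows "fdim_subspace (FV Lam)"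
proof -
  define d where "d c S = Fvec (\<lambda>R. if R = S then c else 0)" for c S
  have d: "amp (d c S) R = (if R = S then c else 0)" for c S R
    unfolding d_def by (subst Fvec_inverse) (auto intro: finite_subset[of _ "{S}"])
  have "x \<in> span (d 1 ` Pow Lam \<union> d \<i> ` Pow Lam)" if x: "x \<in> FV Lam" for x
  proof -
    have "x = (\<Sum>S\<in>Pow Lam. Re (amp x S) *\<^sub>R d 1 S + Im (amp x S) *\<^sub>R d \<i> S)"
    proof -
      have "amp x R = amp (\<Sum>S\<in>Pow Lam. Re (amp x S) *\<^sub>R d 1 S + Im (amp x S) *\<^sub>R d \<i> S) R" for R
      proof -
        have "amp x R = (\<Sum>S\<in>Pow Lam. if R = S then amp x S else 0)"
          using x assms by (auto simp: FV_def fock_def)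
        also have "\<dots> = (\<Sum>S\<in>Pow Lam. amp (Re (amp x S) *\<^sub>R d 1 S + Im (amp x S) *\<^sub>R d \<i> S) R)"
          by (intro sum.cong refl)
             (simp add: plus_fvec.rep_eq scaleR_fvec.rep_eq d complex_eq[symmetric] mult.commute[of _ \<i>])
        finally show ?thesis by (simp add: amp_sum)
      qed
      then show ?thesis by (intro iffD1[OF amp_inject] ext)
    qed
    also have "\<dots> \<in> span (d 1 ` Pow Lam \<union> d \<i> ` Pow Lam)"
      by (intro span_sum span_add span_scale span_base) auto
    finally show ?thesis .
  qed
  moreover have "subspace (FV Lam)"
    by (auto simp: subspace_def FV_def fock_def zero_fvec.rep_eq plus_fvec.rep_eq scaleR_fvec.rep_eq)
  ultimately show ?thesis unfolding fdim_subspace_def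
    using assms by (intro conjI exI[of _ "d 1 ` Pow Lam \<union> d \<i> ` Pow Lam"]) auto
qed

definition sqn :: "int set \<Rightarrow> fstate \<Rightarrow> real" where
  "sqn Lam psi = (\<Sum>S\<in>Pow Lam. (cmod (psi S))\<^sup>2)"

lemma finner_self: "finner Lam psi psi = complex_of_real (sqn Lam psi)"
  unfolding finner_def sqn_def of_real_sum
  by (intro sum.cong refl) (metis complex_norm_square mult.commute)

lemma sqn_nonneg: "sqn Lam psi \<ge> 0" by (simp add: sqn_def sum_nonneg)

lemma fnorm_eq: "fnorm Lam psi = sqrt (sqn Lam psi)" by (simp add: fnorm_def finner_self)

lemma sqn_eq_0_iff:
  assumes "finite Lam" "psi \<in> fock Lam"
  shows "sqn Lam psi = 0 \<longleftrightarrow> psi = (\<lambda>_. 0)"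
proof
  assume "sqn Lam psi = 0"
  then have "\<forall>S\<in>Pow Lam. (cmod (psi S))\<^sup>2 = 0"
    unfolding sqn_def using assms(1) by (subst (asm) sum_nonneg_eq_0_iff) auto
  then show "psi = (\<lambda>_. 0)" using assms(2) by (auto simp: fock_def fun_eq_iff)
qed (simp add: sqn_def)

lemma sqn_scale: "sqn Lam (\<lambda>S. c * psi S) = (cmod c)\<^sup>2 * sqn Lam psi"
  by (simp add: sqn_def sum_distrib_left norm_mult power_mult_distrib)

lemma finner_cnj: "cnj (finner Lam phi psi) = finner Lam psi phi"
  by (simp add: finner_def mult.commute)

lemma finner_scale_left: "finner Lam (\<lambda>S. c * phi S) psi = cnj c * finner Lam phi psi"
  by (simp add: finner_def sum_distrib_left mult.assoc)

lemma finner_scale_right: "finner Lam phi (\<lambda>S. c * psi S) = c * finner Lam phi psi"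
  by (simp add: finner_def sum_distrib_left mult_ac)

lemma finner_add_right: "finner Lam phi (\<lambda>S. psi S + psi' S) = finner Lam phi psi + finner Lam phi psi'"
  by (simp add: finner_def algebra_simps sum.distrib)

lemma finner_diff_right: "finner Lam phi (\<lambda>S. psi S - psi' S) = finner Lam phi psi - finner Lam phi psi'"
  by (simp add: finner_def algebra_simps sum_subtractf)

lemma finner_diff_left: "finner Lam (\<lambda>S. psi S - psi' S) phi = finner Lam psi phi - finner Lam psi' phi"
  by (simp add: finner_def algebra_simps sum_subtractf)

lemma finner_sum_right: "finner Lam phi (\<lambda>S. \<Sum>x\<in>X. psi x S) = (\<Sum>x\<in>X. finner Lam phi (psi x))"
  unfolding finner_def sum_distrib_left by (rule sum.swap)

lemma Re_finner_le:
  assumes "finite Lam" "phi \<in> fock Lam" "psi \<in> fock Lam"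
  shows "Re (finner Lam phi psi) \<le> fnorm Lam phi * fnorm Lam psi"
  using norm_cauchy_schwarz[of "Fvec phi" "Fvec psi"] assms
  by (simp add: norm_eq_sqrt_inner inner_Fvec fnorm_def)

section \<open>Linear operators on Fock space\<close>

definition flinear :: "fop \<Rightarrow> bool" where
  "flinear A \<longleftrightarrow> (\<forall>phi psi c. A (\<lambda>S. phi S + c * psi S) = (\<lambda>S. A phi S + c * A psi S))"

definition fmaps :: "int set \<Rightarrow> fop \<Rightarrow> bool" where
  "fmaps Lam A \<longleftrightarrow> (\<forall>psi\<in>fock Lam. A psi \<in> fock Lam)"

lemma flinear_zero: assumes "flinear A" shows "A (\<lambda>_. 0) = (\<lambda>_. 0)"
proof -
  have "A (\<lambda>S. 0 + 0) = (\<lambda>S. A (\<lambda>_. 0) S + A (\<lambda>_. 0) S)"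
    using assms[unfolded flinear_def, rule_format, of "\<lambda>_. 0" 1 "\<lambda>_. 0"] by simp
  then show ?thesis by (simp add: fun_eq_iff)
qed

lemma flinear_scale: assumes "flinear A" shows "A (\<lambda>S. c * psi S) = (\<lambda>S. c * A psi S)"
  using assms[unfolded flinear_def, rule_format, of "\<lambda>_. 0" c psi] flinear_zero[OF assms] by simp

lemma flinear_add: assumes "flinear A" shows "A (\<lambda>S. phi S + psi S) = (\<lambda>S. A phi S + A psi S)"
  using assms[unfolded flinear_def, rule_format, of phi 1 psi] by simp

lemma flinear_uminus: "flinear A \<Longrightarrow> A (\<lambda>S. - psi S) = (\<lambda>S. - A psi S)"
  using flinear_scale[of A "-1" psi] by simp

lemma flinear_diff: assumes "flinear A" shows "A (\<lambda>S. phi S - c * psi S) = (\<lambda>S. A phi S - c * A psi S)"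
  using assms[unfolded flinear_def, rule_format, of phi "- c" psi] by simp

lemma flinear_sum: "flinear A \<Longrightarrow> A (\<lambda>S. \<Sum>x\<in>X. f x S) = (\<lambda>S. \<Sum>x\<in>X. A (f x) S)"
  by (induction X rule: infinite_finite_induct) (auto simp: flinear_zero flinear_add[of A])

lemma flinear_compose: "flinear A \<Longrightarrow> flinear B \<Longrightarrow> flinear (\<lambda>psi. A (B psi))"
  by (simp add: flinear_def)

lemma flinear_lincomb:
  "flinear A \<Longrightarrow> flinear B \<Longrightarrow> flinear (\<lambda>psi S. A psi S + k * B psi S)"
  "flinear A \<Longrightarrow> flinear B \<Longrightarrow> flinear (\<lambda>psi S. A psi S - k * B psi S)"
  by (auto simp: flinear_def fun_eq_iff algebra_simps)

lemma flinear_sumop: "(\<And>x. x \<in> X \<Longrightarrow> flinear (A x)) \<Longrightarrow> flinear (\<lambda>psi S. \<Sum>x\<in>X. A x psi S)"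
  by (auto simp: flinear_def fun_eq_iff sum.distrib sum_distrib_left)

lemma flinear_ann: "flinear (ann x)" and flinear_cre: "flinear (cre x)"
  by (auto simp: flinear_def ann_def cre_def fun_eq_iff algebra_simps)

lemma fmaps_ann: "fmaps Lam (ann x)"
  by (auto simp: fmaps_def fock_def ann_def)

lemma fmaps_cre: "x \<in> Lam \<Longrightarrow> fmaps Lam (cre x)"
proof -
  assume "x \<in> Lam"
  then have "S - {x} \<subseteq> Lam \<longleftrightarrow> S \<subseteq> Lam" for S by blast
  then show ?thesis by (simp add: fmaps_def fock_def cre_def)
qed

definition restr :: "int set \<Rightarrow> fstate \<Rightarrow> fstate" where
  "restr Lam psi = (\<lambda>S. if S \<subseteq> Lam then psi S else 0)"

lemma restr_fock: "restr Lam psi \<in> fock Lam" by (simp add: restr_def fock_def)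
lemma restr_id: "psi \<in> fock Lam \<Longrightarrow> restr Lam psi = psi" by (auto simp: restr_def fock_def)

text \<open>Cutting the argument down to \<open>Lam\<close> first makes this a linear map on the
  whole type with values in \<open>FV Lam\<close>, which agrees with \<open>A\<close> on
  \<open>FV Lam\<close>.\<close>

definition flift :: "int set \<Rightarrow> fop \<Rightarrow> fvec \<Rightarrow> fvec" where
  "flift Lam A x = Fvec (A (restr Lam (amp x)))"

lemma amp_flift:
  "finite Lam \<Longrightarrow> fmaps Lam A \<Longrightarrow> amp (flift Lam A x) = A (restr Lam (amp x))"
  unfolding flift_def by (intro amp_Fvec) (auto simp: fmaps_def restr_fock)

lemma linear_flift:
  assumes "finite Lam" "fmaps Lam A" "flinear A"
  shows "linear (flift Lam A)"
proof (rule linearI)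
  fix x y
  have "restr Lam (amp (x + y)) = (\<lambda>S. restr Lam (amp x) S + restr Lam (amp y) S)"
    by (auto simp: restr_def plus_fvec.rep_eq)
  then show "flift Lam A (x + y) = flift Lam A x + flift Lam A y"
    by (simp add: amp_inject[symmetric] plus_fvec.rep_eq amp_flift assms flinear_add)
next
  fix c x
  have "restr Lam (amp (c *\<^sub>R x)) = (\<lambda>S. complex_of_real c * restr Lam (amp x) S)"
    by (auto simp: restr_def scaleR_fvec.rep_eq)
  then show "flift Lam A (c *\<^sub>R x) = c *\<^sub>R flift Lam A x"
    by (simp add: amp_inject[symmetric] scaleR_fvec.rep_eq amp_flift assms flinear_scale)
qed

lemma flift_in_FV: "finite Lam \<Longrightarrow> fmaps Lam A \<Longrightarrow> flift Lam A x \<in> FV Lam"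
  using restr_fock[of Lam "amp x"] by (simp add: FV_def amp_flift fmaps_def)

definition KV :: "int set \<Rightarrow> fop \<Rightarrow> fvec set" where
  "KV Lam A = {x \<in> FV Lam. A (amp x) = (\<lambda>_. 0)}"

lemma KV_eq_flift:
  "finite Lam \<Longrightarrow> fmaps Lam A \<Longrightarrow> KV Lam A = {x \<in> FV Lam. flift Lam A x = 0}"
  by (auto simp: KV_def FV_def amp_inject[symmetric] amp_flift restr_id zero_fvec.rep_eq)

lemma KV_eq_ker: "x \<in> KV Lam A \<longleftrightarrow> amp x \<in> ker_op Lam A"
  by (auto simp: KV_def FV_def ker_op_def)

lemma fdim_KV:
  assumes "finite Lam" "flinear A"
  shows "fdim_subspace (KV Lam A)"
proof (rule fdim_subspace_mono[OF fdim_FV[OF assms(1)]])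
  show "subspace (KV Lam A)"
    using fdim_subspace_imp_subspace[OF fdim_FV[OF assms(1)]]
    unfolding subspace_def KV_def
    by (auto simp: zero_fvec.rep_eq flinear_zero[OF assms(2)] plus_fvec.rep_eq flinear_add[OF assms(2)]
        scaleR_fvec.rep_eq flinear_scale[OF assms(2)])
qed (auto simp: KV_def)

text \<open>Kernels are closed under multiplication by the imaginary unit, so real and complex
  orthogonality to them agree.\<close>

lemma finner_kernel_eq_0:
  assumes fin: "finite Lam" and A: "flinear A" and x: "x \<in> FV Lam"
    and orth: "\<And>v. v \<in> KV Lam A \<Longrightarrow> inner x v = 0" and phi: "phi \<in> ker_op Lam A"
  shows "finner Lam phi (amp x) = 0"
proof -
  have r: "Re (finner Lam phi' (amp x)) = 0" if "phi' \<in> ker_op Lam A" for phi'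
  proof -
    have f: "phi' \<in> fock Lam" using that by (simp add: ker_op_def)
    have "Fvec phi' \<in> KV Lam A" using that by (simp add: KV_eq_ker amp_Fvec[OF fin f])
    from orth[OF this] show ?thesis
      using inner_eq_finner[OF fin Fvec_in_FV[OF fin f], of x] by (simp add: amp_Fvec[OF fin f] inner_commute)
  qed
  have "(\<lambda>S. \<i> * phi S) \<in> ker_op Lam A"
    using phi by (auto simp: ker_op_def fock_def flinear_scale[OF A])
  from r[OF this] have "Im (finner Lam phi (amp x)) = 0" by (simp add: finner_scale_left)
  with r[OF phi] show ?thesis by (simp add: complex_eq_iff)
qed

subsection \<open>Gap and norm of an operator\<close>

text \<open>Nonnegativity of the form bounds the set of energies from below; without it
  \<open>Inf\<close> would carry no information. The rest is normalisation of
  \<open>psi\<close>.\<close>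

lemma op_gap_bound:
  assumes fin: "finite Lam" and A: "flinear A"
    and psd: "\<And>psi. psi \<in> fock Lam \<Longrightarrow> Re (finner Lam psi (A psi)) \<ge> 0"
    and psi: "psi \<in> fock Lam" and orth: "\<And>phi. phi \<in> ker_op Lam A \<Longrightarrow> finner Lam phi psi = 0"
  shows "op_gap Lam A * sqn Lam psi \<le> Re (finner Lam psi (A psi))"
proof (cases "sqn Lam psi = 0")
  case True
  then show ?thesis using psd[OF psi] by simp
next
  case False
  then have pos: "sqn Lam psi > 0" using sqn_nonneg[of Lam psi] by linarith
  define c where "c = 1 / sqrt (sqn Lam psi)"
  have c2: "c\<^sup>2 = 1 / sqn Lam psi" using pos by (simp add: c_def power_divide)
  let ?u = "\<lambda>S. complex_of_real c * psi S"
  have u: "?u \<in> fock Lam" "\<forall>phi\<in>ker_op Lam A. finner Lam phi ?u = 0" "fnorm Lam ?u = 1"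
    using psi orth pos c2 by (auto simp: fock_def finner_scale_right fnorm_eq sqn_scale)
  have "op_gap Lam A \<le> Re (finner Lam ?u (A ?u))"
    unfolding op_gap_def by (rule cInf_lower) (use u psd in \<open>auto intro!: bdd_belowI[of _ 0]\<close>)
  also have "\<dots> = c\<^sup>2 * Re (finner Lam psi (A psi))"
    by (simp add: flinear_scale[OF A] finner_scale_left finner_scale_right power2_eq_square)
  finally show ?thesis using pos by (simp add: c2 field_simps)
qed

text \<open>The infimum of an empty set of reals says nothing, so a unit vector \<open>psi0\<close>
  orthogonal to the kernel has to be exhibited.\<close>

lemma op_gap_greatest:
  assumes ex: "psi0 \<in> fock Lam" "\<And>phi. phi \<in> ker_op Lam A \<Longrightarrow> finner Lam phi psi0 = 0" "fnorm Lam psi0 = 1"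
    and bd: "\<And>psi. psi \<in> fock Lam \<Longrightarrow> (\<And>phi. phi \<in> ker_op Lam A \<Longrightarrow> finner Lam phi psi = 0) \<Longrightarrow>
        c * sqn Lam psi \<le> Re (finner Lam psi (A psi))"
  shows "c \<le> op_gap Lam A"
  unfolding op_gap_def
proof (rule cInf_greatest)
  show "{Re (finner Lam psi (A psi)) |psi. psi \<in> fock Lam \<and> (\<forall>phi\<in>ker_op Lam A. finner Lam phi psi = 0) \<and> fnorm Lam psi = 1} \<noteq> {}"
    using ex by blast
next
  fix t assume "t \<in> {Re (finner Lam psi (A psi)) |psi. psi \<in> fock Lam \<and> (\<forall>phi\<in>ker_op Lam A. finner Lam phi psi = 0) \<and> fnorm Lam psi = 1}"
  then obtain psi where psi: "t = Re (finner Lam psi (A psi))" "psi \<in> fock Lam"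
    "\<forall>phi\<in>ker_op Lam A. finner Lam phi psi = 0" "fnorm Lam psi = 1" by blast
  then have "sqn Lam psi = 1" by (simp add: fnorm_eq)
  then show "c \<le> t" using bd[of psi] psi by simp
qed

text \<open>A real supremum is meaningful only for a bounded set. The amplitudes of a unit vector
  are at most 1, so the absolute row sums \<open>C T\<close> of the matrix of \<open>A\<close> give
  a crude bound.\<close>

lemma op_norm_bdd:
  assumes fin: "finite Lam" and A: "flinear A"
  shows "bdd_above {fnorm Lam (A psi) | psi. psi \<in> fock Lam \<and> fnorm Lam psi = 1}"
proof -
  define d where "d S = (\<lambda>R. if R = S then 1 else 0 :: complex)" for S :: "int set"
  define C where "C T = (\<Sum>S\<in>Pow Lam. cmod (A (d S) T))" for T
  have "fnorm Lam (A psi) \<le> sqrt (\<Sum>T\<in>Pow Lam. (C T)\<^sup>2)" if psi: "psi \<in> fock Lam" "fnorm Lam psi = 1" for psi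
  proof -
    have le1: "cmod (psi S) \<le> 1" if "S \<in> Pow Lam" for S
    proof -
      have "(cmod (psi S))\<^sup>2 \<le> sqn Lam psi"
        unfolding sqn_def using fin that by (intro member_le_sum) auto
      also have "\<dots> = 1" using psi(2) by (simp add: fnorm_eq)
      finally show ?thesis by (simp add: power_le_one_iff)
    qed
    have "psi = (\<lambda>R. \<Sum>S\<in>Pow Lam. psi S * d S R)"
    proof
      fix R
      have "(\<Sum>S\<in>Pow Lam. psi S * d S R) = (\<Sum>S\<in>Pow Lam. if R = S then psi S else 0)"
        by (intro sum.cong refl) (simp add: d_def)
      also have "\<dots> = psi R" using fin psi(1) by (auto simp: fock_def)
      finally show "psi R = (\<Sum>S\<in>Pow Lam. psi S * d S R)" by simp
    qed
    then have "A psi = A (\<lambda>R. \<Sum>S\<in>Pow Lam. psi S * d S R)" by simp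
    also have "\<dots> = (\<lambda>T. \<Sum>S\<in>Pow Lam. psi S * A (d S) T)"
      by (simp add: flinear_sum[OF A] flinear_scale[OF A])
    finally have Ap: "A psi T = (\<Sum>S\<in>Pow Lam. psi S * A (d S) T)" for T by simp
    have "cmod (A psi T) \<le> C T" for T
      unfolding Ap C_def using le1 by (intro sum_norm_le) (auto simp: norm_mult intro!: mult_left_le_one_le)
    then have "sqn Lam (A psi) \<le> (\<Sum>T\<in>Pow Lam. (C T)\<^sup>2)"
      unfolding sqn_def by (intro sum_mono power_mono) auto
    then show ?thesis by (simp add: fnorm_eq)
  qed
  then show ?thesis by (intro bdd_aboveI) blast
qed

lemma fnorm_le_op_norm:
  assumes fin: "finite Lam" and A: "flinear A" and psi: "psi \<in> fock Lam"
  shows "fnorm Lam (A psi) \<le> op_norm Lam A * fnorm Lam psi"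
proof (cases "sqn Lam psi = 0")
  case True
  then have "psi = (\<lambda>_. 0)" using sqn_eq_0_iff[OF fin psi] by simp
  then show ?thesis using flinear_zero[OF A] by (simp add: fnorm_eq sqn_def)
next
  case False
  then have pos: "sqn Lam psi > 0" using sqn_nonneg[of Lam psi] by linarith
  define c where "c = 1 / sqrt (sqn Lam psi)"
  have c: "c > 0" "c * sqrt (sqn Lam psi) = 1" using pos by (auto simp: c_def)
  let ?u = "\<lambda>S. complex_of_real c * psi S"
  have u: "?u \<in> fock Lam" "fnorm Lam ?u = 1"
    using psi c by (auto simp: fock_def fnorm_eq sqn_scale real_sqrt_mult)
  have "fnorm Lam (A ?u) \<le> op_norm Lam A"
    unfolding op_norm_def by (rule cSup_upper[OF _ op_norm_bdd[OF fin A]]) (use u in blast)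
  then have "c * fnorm Lam (A psi) \<le> op_norm Lam A"
    using c by (simp add: flinear_scale[OF A] fnorm_eq sqn_scale real_sqrt_mult)
  then show ?thesis using pos by (simp add: c_def fnorm_eq field_simps)
qed

lemma form_le_op_norm:
  assumes fin: "finite Lam" and A: "flinear A" "fmaps Lam A" and psi: "psi \<in> fock Lam"
  shows "Re (finner Lam psi (A psi)) \<le> op_norm Lam A * sqn Lam psi"
proof -
  have "Re (finner Lam psi (A psi)) \<le> fnorm Lam psi * fnorm Lam (A psi)"
    using Re_finner_le[OF fin psi] A(2) psi by (auto simp: fmaps_def)
  also have "\<dots> \<le> fnorm Lam psi * (op_norm Lam A * fnorm Lam psi)"
    using fnorm_le_op_norm[OF fin A(1) psi] by (intro mult_left_mono) (auto simp: fnorm_eq sqn_nonneg)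
  also have "\<dots> = op_norm Lam A * sqn Lam psi" by (simp add: fnorm_eq sqn_nonneg)
  finally show ?thesis .
qed

section \<open>The Hamiltonians as sums of local terms\<close>

lemma jw_sign_sq: "jw_sign S x * jw_sign S x = 1"
  by (simp add: jw_sign_def power_mult_distrib[symmetric])

lemma jw_sign_insert: "jw_sign (insert x S) x = jw_sign S x"
proof -
  have "{y \<in> insert x S. y < x} = {y \<in> S. y < x}" by auto
  then show ?thesis by (simp add: jw_sign_def)
qed

lemma jw_sign_remove: "jw_sign (S - {x}) x = jw_sign S x"
proof -
  have "{y \<in> S - {x}. y < x} = {y \<in> S. y < x}" by auto
  then show ?thesis by (simp add: jw_sign_def)
qed

lemma jw_sign_insert_other:
  assumes "finite S" "y \<notin> S" "y \<noteq> x"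
  shows "jw_sign (insert y S) x = (if y < x then - jw_sign S x else jw_sign S x)"
proof (cases "y < x")
  case True
  then have "{z \<in> insert y S. z < x} = insert y {z \<in> S. z < x}" by auto
  then show ?thesis using assms True by (simp add: jw_sign_def)
next
  case False
  then have "{z \<in> insert y S. z < x} = {z \<in> S. z < x}" by auto
  then show ?thesis using False by (simp add: jw_sign_def)
qed

lemma jw_sign_remove_other:
  assumes "finite S" "y \<in> S" "y \<noteq> x"
  shows "jw_sign (S - {y}) x = (if y < x then - jw_sign S x else jw_sign S x)"
  using jw_sign_insert_other[of "S - {y}" y x] assms by (auto simp: insert_absorb split: if_splits)

lemma nn_term_eq: "nn_term w x psi = (\<lambda>S. if w x \<in> S \<and> w (x+2) \<in> S then psi S else 0)"
  by (rule ext)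
     (auto simp: nn_term_def cre_def ann_def jw_sign_remove jw_sign_sq mult.assoc[symmetric] insert_absorb)

lemma cnj_jw_sign: "cnj (jw_sign S x) = jw_sign S x" by (simp add: jw_sign_def)

lemma finner_cre:
  assumes "finite Lam" "x \<in> Lam"
  shows "finner Lam phi (cre x psi) = finner Lam (ann x phi) psi"
proof -
  have "finner Lam phi (cre x psi) = (\<Sum>S\<in>{S\<in>Pow Lam. x \<in> S}. cnj (phi S) * (jw_sign S x * psi (S - {x})))"
    unfolding finner_def cre_def using assms by (subst sum.inter_filter) (auto intro!: sum.cong)
  also have "\<dots> = (\<Sum>S\<in>{S\<in>Pow Lam. x \<notin> S}. cnj (phi (insert x S)) * (jw_sign S x * psi S))"
    by (rule sum.reindex_bij_witness[of _ "insert x" "\<lambda>S. S - {x}"])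
       (use assms in \<open>auto simp: jw_sign_remove insert_absorb\<close>)
  also have "\<dots> = finner Lam (ann x phi) psi"
    unfolding finner_def ann_def using assms by (subst sum.inter_filter) (auto intro!: sum.cong simp: cnj_jw_sign)
  finally show ?thesis .
qed

lemma finner_qadj:
  assumes "finite Lam" "{w x, w (x+1), w (x+2), w (x+3)} \<subseteq> Lam"
  shows "finner Lam phi (qadj lam w x psi) = finner Lam (qop lam w x phi) psi"
  using assms
  by (simp add: qadj_def qop_def finner_diff_right finner_diff_left finner_scale_left finner_scale_right finner_cre)

lemma flinear_nn_term: "flinear (nn_term w x)"
  by (auto simp: flinear_def nn_term_eq)

lemma flinear_qop: "flinear (qop lam w x)"
  unfolding qop_def by (intro flinear_lincomb flinear_compose[OF flinear_ann flinear_ann])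

lemma flinear_qadj: "flinear (qadj lam w x)"
  unfolding qadj_def by (intro flinear_lincomb flinear_compose[OF flinear_cre flinear_cre])

lemma fmaps_nn_term: "fmaps Lam (nn_term w x)"
  by (auto simp: fmaps_def fock_def nn_term_eq)

lemma fmaps_qop: "fmaps Lam (qop lam w x)"
proof -
  have "ann y (ann z psi) S = 0" if "psi \<in> fock Lam" "\<not> S \<subseteq> Lam" for y z psi S
    using fmaps_ann that unfolding fmaps_def by (meson fock_outside)
  then show ?thesis by (simp add: fmaps_def qop_def fock_def)
qed

lemma fmaps_qadj:
  assumes "{w x, w (x+1), w (x+2), w (x+3)} \<subseteq> Lam"
  shows "fmaps Lam (qadj lam w x)"
proof -
  have "cre y (cre z psi) S = 0" if "psi \<in> fock Lam" "\<not> S \<subseteq> Lam" "y \<in> Lam" "z \<in> Lam" for y z psi S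
    using fmaps_cre that unfolding fmaps_def by (meson fock_outside)
  then show ?thesis using assms by (simp add: fmaps_def qadj_def fock_def)
qed

text \<open>One family covers the open chain, the ring and the segments of both: the labelling
  \<open>w\<close> carries the boundary condition, \<open>X\<close> and \<open>Y\<close> the places
  of the two kinds of terms. Labels may run beyond the seam of a ring.\<close>

definition H_terms :: "real \<Rightarrow> complex \<Rightarrow> (int \<Rightarrow> int) \<Rightarrow> int set \<Rightarrow> int set \<Rightarrow> fop" where
  "H_terms kap lam w X Y psi = (\<lambda>S. (\<Sum>x\<in>X. nn_term w x psi S)
      + complex_of_real kap * (\<Sum>x\<in>Y. qadj lam w x (qop lam w x psi) S))"

definition term_sites :: "(int \<Rightarrow> int) \<Rightarrow> int set \<Rightarrow> int set \<Rightarrow> int set" where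
  "term_sites w X Y = (\<Union>x\<in>X. {w x, w (x+2)}) \<union> (\<Union>x\<in>Y. {w x, w (x+1), w (x+2), w (x+3)})"

text \<open>The quadratic form of the Hamiltonian as a sum of squared norms: every
  \<open>nn_term\<close> is an orthogonal projection and the other terms have the form q* q. As a
  sum over labels it can be compared between windows by mere counting.\<close>

definition energy :: "int set \<Rightarrow> real \<Rightarrow> complex \<Rightarrow> (int \<Rightarrow> int) \<Rightarrow> int set \<Rightarrow> int set \<Rightarrow> fstate \<Rightarrow> real" where
  "energy Lam kap lam w X Y psi =
     (\<Sum>x\<in>X. sqn Lam (nn_term w x psi)) + kap * (\<Sum>x\<in>Y. sqn Lam (qop lam w x psi))"

lemma H_open_eq: "H_open kap lam a b = H_terms kap lam id {a..b-2} {a..b-3}"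
  by (intro ext) (simp add: H_open_def H_terms_def)

lemma H_per_eq: "H_per kap lam a b = H_terms kap lam (wrap a b) {a..b} {a..b}"
  by (intro ext) (simp add: H_per_def H_terms_def sum.distrib sum_distrib_left)

lemma flinear_H_terms: "flinear (H_terms kap lam w X Y)"
  unfolding H_terms_def
  by (intro flinear_lincomb flinear_sumop flinear_nn_term flinear_compose[OF flinear_qadj flinear_qop])

lemma fmaps_H_terms:
  assumes "term_sites w X Y \<subseteq> Lam"
  shows "fmaps Lam (H_terms kap lam w X Y)"
proof -
  have "nn_term w x psi S = 0" if "psi \<in> fock Lam" "\<not> S \<subseteq> Lam" for x psi S
    using fmaps_nn_term that unfolding fmaps_def by (meson fock_outside)
  moreover have "qadj lam w x (qop lam w x psi) S = 0" if "psi \<in> fock Lam" "\<not> S \<subseteq> Lam" "x \<in> Y" for x psi S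
  proof -
    have "{w x, w (x+1), w (x+2), w (x+3)} \<subseteq> Lam" using assms that(3) by (auto simp: term_sites_def)
    then show ?thesis using fmaps_qop[of Lam lam w x] fmaps_qadj[of w x Lam lam] that unfolding fmaps_def by (meson fock_outside)
  qed
  ultimately show ?thesis by (simp add: fmaps_def H_terms_def fock_def)
qed

lemma finner_H_terms:
  assumes "finite Lam" "term_sites w X Y \<subseteq> Lam"
  shows "finner Lam phi (H_terms kap lam w X Y psi) =
    (\<Sum>x\<in>X. finner Lam (nn_term w x phi) (nn_term w x psi))
      + complex_of_real kap * (\<Sum>x\<in>Y. finner Lam (qop lam w x phi) (qop lam w x psi))"
proof -
  have "finner Lam phi (nn_term w x psi) = finner Lam (nn_term w x phi) (nn_term w x psi)" for x
    unfolding finner_def by (intro sum.cong refl) (simp add: nn_term_eq)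
  moreover have "finner Lam phi (qadj lam w x (qop lam w x psi)) = finner Lam (qop lam w x phi) (qop lam w x psi)"
    if "x \<in> Y" for x
    using assms that by (intro finner_qadj) (auto simp: term_sites_def)
  ultimately show ?thesis
    by (simp add: H_terms_def finner_add_right finner_scale_right finner_sum_right)
qed

lemma form_H_terms:
  assumes "finite Lam" "term_sites w X Y \<subseteq> Lam"
  shows "finner Lam psi (H_terms kap lam w X Y psi) = complex_of_real (energy Lam kap lam w X Y psi)"
  by (simp add: finner_H_terms[OF assms] finner_self energy_def)

lemma H_terms_symmetric:
  assumes "finite Lam" "term_sites w X Y \<subseteq> Lam"
  shows "finner Lam (H_terms kap lam w X Y phi) psi = finner Lam phi (H_terms kap lam w X Y psi)"
proof -
  have "finner Lam (H_terms kap lam w X Y phi) psi = cnj (finner Lam psi (H_terms kap lam w X Y phi))"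
    by (simp add: finner_cnj)
  also have "\<dots> = finner Lam phi (H_terms kap lam w X Y psi)"
    unfolding finner_H_terms[OF assms] by (simp add: finner_cnj)
  finally show ?thesis .
qed

lemma energy_nonneg: "kap \<ge> 0 \<Longrightarrow> energy Lam kap lam w X Y psi \<ge> 0"
  by (simp add: energy_def sqn_nonneg sum_nonneg)

lemma energy_eq_0_iff:
  assumes "finite Lam" "kap > 0" "finite X" "finite Y" "psi \<in> fock Lam"
  shows "energy Lam kap lam w X Y psi = 0 \<longleftrightarrow>
    (\<forall>x\<in>X. nn_term w x psi = (\<lambda>_. 0)) \<and> (\<forall>x\<in>Y. qop lam w x psi = (\<lambda>_. 0))"
proof
  assume "energy Lam kap lam w X Y psi = 0"
  then have e: "(\<Sum>x\<in>X. sqn Lam (nn_term w x psi)) + kap * (\<Sum>x\<in>Y. sqn Lam (qop lam w x psi)) = 0"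
    by (simp add: energy_def)
  have n1: "(\<Sum>x\<in>X. sqn Lam (nn_term w x psi)) \<ge> 0" "(\<Sum>x\<in>Y. sqn Lam (qop lam w x psi)) \<ge> 0"
    by (simp_all add: sqn_nonneg sum_nonneg)
  then have "kap * (\<Sum>x\<in>Y. sqn Lam (qop lam w x psi)) \<ge> 0" using assms(2) by simp
  then have "(\<Sum>x\<in>X. sqn Lam (nn_term w x psi)) = 0" "kap * (\<Sum>x\<in>Y. sqn Lam (qop lam w x psi)) = 0"
    using e n1 by linarith+
  then have "\<forall>x\<in>X. sqn Lam (nn_term w x psi) = 0" "\<forall>x\<in>Y. sqn Lam (qop lam w x psi) = 0"
    using assms(2-4) by (simp_all add: sum_nonneg_eq_0_iff sqn_nonneg)
  moreover have "nn_term w x psi \<in> fock Lam" "qop lam w x psi \<in> fock Lam" for x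
    using fmaps_nn_term fmaps_qop assms(5) unfolding fmaps_def by blast+
  ultimately show "(\<forall>x\<in>X. nn_term w x psi = (\<lambda>_. 0)) \<and> (\<forall>x\<in>Y. qop lam w x psi = (\<lambda>_. 0))"
    using sqn_eq_0_iff[OF assms(1)] by blast
qed (simp add: energy_def sqn_def)

text \<open>Frustration-freeness: the energy is a sum of nonnegative terms with positive weights, so
  a ground state is annihilated by each term. Kernels of larger collections of terms are therefore
  smaller.\<close>

lemma H_terms_eq_0_iff:
  assumes "finite Lam" "kap > 0" "finite X" "finite Y" "term_sites w X Y \<subseteq> Lam" "psi \<in> fock Lam"
  shows "H_terms kap lam w X Y psi = (\<lambda>_. 0) \<longleftrightarrow>
    (\<forall>x\<in>X. nn_term w x psi = (\<lambda>_. 0)) \<and> (\<forall>x\<in>Y. qop lam w x psi = (\<lambda>_. 0))"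
proof
  assume "H_terms kap lam w X Y psi = (\<lambda>_. 0)"
  then have "energy Lam kap lam w X Y psi = 0"
    using form_H_terms[OF assms(1,5), of psi kap lam] by (simp add: finner_def)
  then show "(\<forall>x\<in>X. nn_term w x psi = (\<lambda>_. 0)) \<and> (\<forall>x\<in>Y. qop lam w x psi = (\<lambda>_. 0))"
    using energy_eq_0_iff assms by blast
next
  assume *: "(\<forall>x\<in>X. nn_term w x psi = (\<lambda>_. 0)) \<and> (\<forall>x\<in>Y. qop lam w x psi = (\<lambda>_. 0))"
  show "H_terms kap lam w X Y psi = (\<lambda>_. 0)"
    unfolding H_terms_def using * by (simp add: flinear_zero[OF flinear_qadj])
qed

lemma KV_H_terms_iff:
  assumes "finite Lam" "kap > 0" "finite X" "finite Y" "term_sites w X Y \<subseteq> Lam"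
  shows "x \<in> KV Lam (H_terms kap lam w X Y) \<longleftrightarrow> x \<in> FV Lam \<and>
    (\<forall>y\<in>X. nn_term w y (amp x) = (\<lambda>_. 0)) \<and> (\<forall>y\<in>Y. qop lam w y (amp x) = (\<lambda>_. 0))"
  using H_terms_eq_0_iff[OF assms, of "amp x" lam] by (auto simp: KV_def FV_def)

text \<open>Each term annihilates the kernel component, so no squared norm in the energy
  changes.\<close>

lemma energy_minus_oproj:
  assumes fin: "finite Lam" "kap > 0" "finite X" "finite Y" "term_sites w X Y \<subseteq> Lam"
  shows "energy Lam kap lam w X Y (amp (x - oproj (KV Lam (H_terms kap lam w X Y)) x))
    = energy Lam kap lam w X Y (amp x)"
proof -
  define v where "v = oproj (KV Lam (H_terms kap lam w X Y)) x"
  define u where "u = x - v"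
  have "v \<in> KV Lam (H_terms kap lam w X Y)"
    unfolding v_def by (rule oproj_in[OF fdim_KV[OF fin(1) flinear_H_terms]])
  then have v0: "\<forall>y\<in>X. nn_term w y (amp v) = (\<lambda>_. 0)" "\<forall>y\<in>Y. qop lam w y (amp v) = (\<lambda>_. 0)"
    using KV_H_terms_iff[OF fin] by blast+
  have "amp x = amp (u + v)" by (simp add: u_def)
  then have xx: "amp x = (\<lambda>S. amp u S + amp v S)" by (simp add: plus_fvec.rep_eq)
  have "nn_term w y (amp x) = nn_term w y (amp u)" if "y \<in> X" for y
    unfolding xx flinear_add[OF flinear_nn_term] using v0(1) that by simp
  moreover have "qop lam w y (amp x) = qop lam w y (amp u)" if "y \<in> Y" for y
    unfolding xx flinear_add[OF flinear_qop] using v0(2) that by simp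
  ultimately show ?thesis by (simp add: energy_def u_def v_def)
qed

lemma H_terms_shift:
  "H_terms kap lam (\<lambda>x. w (s + x)) X Y = H_terms kap lam w ((+) s ` X) ((+) s ` Y)"
proof -
  have "nn_term (\<lambda>x. w (s + x)) x = nn_term w (s + x)"
    "qop lam (\<lambda>x. w (s + x)) x = qop lam w (s + x)" "qadj lam (\<lambda>x. w (s + x)) x = qadj lam w (s + x)" for x
    by (auto simp: nn_term_def qop_def qadj_def add.assoc)
  then show ?thesis by (intro ext) (simp add: H_terms_def sum.reindex)
qed

lemma energy_shift:
  "energy Lam kap lam (\<lambda>x. w (s + x)) X Y psi = energy Lam kap lam w ((+) s ` X) ((+) s ` Y) psi"
proof -
  have "nn_term (\<lambda>x. w (s + x)) x = nn_term w (s + x)"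
    "qop lam (\<lambda>x. w (s + x)) x = qop lam w (s + x)" for x
    by (auto simp: nn_term_def qop_def add.assoc)
  then show ?thesis by (simp add: energy_def sum.reindex)
qed

lemma sqn_amp: "finite Lam \<Longrightarrow> x \<in> FV Lam \<Longrightarrow> sqn Lam (amp x) = inner x x"
  by (simp add: inner_eq_finner finner_self)

section \<open>Operators with disjoint supports commute\<close>

definition fcomm :: "int set \<Rightarrow> fop \<Rightarrow> fop \<Rightarrow> bool" where
  "fcomm Lam A B \<longleftrightarrow> (\<forall>psi\<in>fock Lam. A (B psi) = B (A psi))"

definition facomm :: "int set \<Rightarrow> fop \<Rightarrow> fop \<Rightarrow> bool" where
  "facomm Lam A B \<longleftrightarrow> (\<forall>psi\<in>fock Lam. A (B psi) = (\<lambda>S. - B (A psi) S))"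

lemma fcomm_sym: "fcomm Lam A B \<Longrightarrow> fcomm Lam B A"
  by (simp add: fcomm_def)

lemma facomm_sym: "facomm Lam A B \<Longrightarrow> facomm Lam B A"
  by (simp add: facomm_def fun_eq_iff)

text \<open>On an infinite configuration \<open>card\<close> may be 0 and the sign rules break down.
  The anticommutation relations survive because amplitudes supported on a finite \<open>Lam\<close>
  vanish there.\<close>

lemma amp_infinite_eq_0:
  assumes "finite Lam" "psi \<in> fock Lam" "\<not> finite S"
  shows "psi (insert x (insert y S)) = 0" "psi (insert x (S - {y})) = 0" "psi (insert x S - {y}) = 0"
    "psi (S - {x} - {y}) = 0"
  using assms by (auto intro!: fock_outside[of psi Lam] dest: finite_subset)

lemma facomm_ann_ann:
  assumes "finite Lam" "x \<noteq> y"
  shows "facomm Lam (ann x) (ann y)"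
proof -
  have "ann x (ann y psi) S = - ann y (ann x psi) S" if psi: "psi \<in> fock Lam" for psi S
  proof (cases "finite S")
    case True
    then show ?thesis using assms
      by (auto simp: ann_def jw_sign_insert_other insert_commute)
  next
    case False
    then show ?thesis using amp_infinite_eq_0[OF assms(1) psi] by (simp add: ann_def)
  qed
  then show ?thesis by (simp add: facomm_def fun_eq_iff)
qed

lemma facomm_cre_cre:
  assumes "finite Lam" "x \<noteq> y"
  shows "facomm Lam (cre x) (cre y)"
proof -
  have "cre x (cre y psi) S = - cre y (cre x psi) S" if psi: "psi \<in> fock Lam" for psi S
  proof (cases "finite S")
    case True
    have "S - {x} - {y} = S - {y} - {x}" by auto
    then show ?thesis using assms True
      by (auto simp: cre_def jw_sign_remove_other)
  next
    case False
    then show ?thesis using amp_infinite_eq_0[OF assms(1) psi] by (simp add: cre_def)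
  qed
  then show ?thesis by (simp add: facomm_def fun_eq_iff)
qed

lemma facomm_ann_cre:
  assumes "finite Lam" "x \<noteq> y"
  shows "facomm Lam (ann x) (cre y)"
proof -
  have "ann x (cre y psi) S = - cre y (ann x psi) S" if psi: "psi \<in> fock Lam" for psi S
  proof (cases "finite S")
    case True
    have "insert x S - {y} = insert x (S - {y})" using assms by auto
    then show ?thesis using assms True
      by (auto simp: ann_def cre_def jw_sign_remove_other jw_sign_insert_other)
  next
    case False
    then show ?thesis using amp_infinite_eq_0[OF assms(1) psi] assms(2) by (simp add: ann_def cre_def)
  qed
  then show ?thesis by (simp add: facomm_def fun_eq_iff)
qed

text \<open>Two anticommutations compensate: this is why pairs of fermionic operators behave like
  local operators.\<close>

lemma fcomm_of_facomm:
  assumes "facomm Lam A C" "facomm Lam B C" "flinear A" "fmaps Lam B"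
  shows "fcomm Lam (\<lambda>psi. A (B psi)) C"
  unfolding fcomm_def
proof
  fix psi assume psi: "psi \<in> fock Lam"
  have "A (B (C psi)) = A (\<lambda>S. - C (B psi) S)" using assms(2) psi by (simp add: facomm_def)
  also have "\<dots> = (\<lambda>S. - A (C (B psi)) S)" by (rule flinear_uminus[OF assms(3)])
  also have "\<dots> = C (A (B psi))" using assms(1,4) psi by (simp add: facomm_def fmaps_def)
  finally show "A (B (C psi)) = C (A (B psi))" .
qed

lemma fcomm_compose:
  assumes "fcomm Lam A C" "fcomm Lam B C" "fmaps Lam B"
  shows "fcomm Lam (\<lambda>psi. A (B psi)) C"
  using assms by (auto simp: fcomm_def fmaps_def)

lemma fcomm_qadj_qop:
  assumes "fcomm Lam (qadj lam w x) C" "fcomm Lam (qop lam w x) C"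
  shows "fcomm Lam (\<lambda>psi. qadj lam w x (qop lam w x psi)) C"
  by (rule fcomm_compose[where A = "qadj lam w x" and B = "qop lam w x", OF assms fmaps_qop])

lemma fcomm_diff:
  assumes "fcomm Lam A C" "fcomm Lam B C" "flinear C"
  shows "fcomm Lam (\<lambda>psi S. A psi S - k * B psi S) C"
  using assms flinear_diff[OF assms(3)] by (simp add: fcomm_def)

lemma fcomm_H_terms:
  assumes "\<And>x. x \<in> X \<Longrightarrow> fcomm Lam (nn_term w x) C"
    and "\<And>x. x \<in> Y \<Longrightarrow> fcomm Lam (\<lambda>psi. qadj lam w x (qop lam w x psi)) C" and "flinear C"
  shows "fcomm Lam (H_terms kap lam w X Y) C"
  using assms(1,2)
  by (simp add: fcomm_def H_terms_def flinear_add[OF assms(3)] flinear_scale[OF assms(3)] flinear_sum[OF assms(3)])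

lemma fcomm_elementary:
  assumes "finite Lam" "z \<noteq> x" "z \<noteq> y" "y \<in> Lam" "x \<in> Lam" "E = ann z \<or> E = cre z"
  shows "fcomm Lam (\<lambda>psi. ann x (ann y psi)) E" "fcomm Lam (\<lambda>psi. cre x (cre y psi)) E"
proof -
  have "facomm Lam (ann u) E" "facomm Lam (cre u) E" if "u \<noteq> z" for u
    using assms(1,6) that
      facomm_ann_ann[of Lam u z] facomm_ann_cre[of Lam u z] facomm_cre_cre[of Lam u z] facomm_sym[OF facomm_ann_cre[of Lam z u]]
    by auto
  note ac = this[OF assms(2)[symmetric]] this[OF assms(3)[symmetric]]
  show "fcomm Lam (\<lambda>psi. ann x (ann y psi)) E"
    by (rule fcomm_of_facomm[where A = "ann x" and B = "ann y", OF ac(1,3) flinear_ann fmaps_ann])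
  show "fcomm Lam (\<lambda>psi. cre x (cre y psi)) E"
    by (rule fcomm_of_facomm[where A = "cre x" and B = "cre y", OF ac(2,4) flinear_cre fmaps_cre[OF assms(4)]])
qed

lemma flinear_elementary: "E = ann z \<or> E = cre z \<Longrightarrow> flinear E"
  using flinear_ann flinear_cre by blast

lemma fcomm_q_elementary:
  assumes "finite Lam" "{w x, w (x+1), w (x+2), w (x+3)} \<subseteq> Lam"
    and "z \<notin> {w x, w (x+1), w (x+2), w (x+3)}" "E = ann z \<or> E = cre z"
  shows "fcomm Lam (qop lam w x) E" "fcomm Lam (qadj lam w x) E"
proof -
  have lE: "flinear E" using flinear_elementary[OF assms(4)] .
  show "fcomm Lam (qop lam w x) E" unfolding qop_def
    by (rule fcomm_diff[OF fcomm_elementary(1) fcomm_elementary(1) lE]) (use assms in auto)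
  show "fcomm Lam (qadj lam w x) E" unfolding qadj_def
    by (rule fcomm_diff[OF fcomm_elementary(2) fcomm_elementary(2) lE]) (use assms in auto)
qed

lemma fcomm_q_q:
  assumes fin: "finite Lam" and s: "{w x, w (x+1), w (x+2), w (x+3)} \<subseteq> Lam" "{w y, w (y+1), w (y+2), w (y+3)} \<subseteq> Lam"
    and d: "{w x, w (x+1), w (x+2), w (x+3)} \<inter> {w y, w (y+1), w (y+2), w (y+3)} = {}"
    and Q: "Q = qop lam w y \<or> Q = qadj lam w y"
  shows "fcomm Lam (qop lam w x) Q" "fcomm Lam (qadj lam w x) Q"
proof -
  have el: "fcomm Lam E Q" if "z \<in> {w x, w (x+1), w (x+2), w (x+3)}" "E = ann z \<or> E = cre z" for z E
    using fcomm_q_elementary[OF fin s(2), of z E lam] d that Q by (auto intro!: fcomm_sym[of Lam Q E])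
  have lQ: "flinear Q" using Q flinear_qop flinear_qadj by blast
  have aa: "fcomm Lam (\<lambda>psi. ann y (ann z psi)) Q"
    if "y \<in> {w x, w (x+1), w (x+2), w (x+3)}" "z \<in> {w x, w (x+1), w (x+2), w (x+3)}" for y z
    by (rule fcomm_compose[where A = "ann y" and B = "ann z",
          OF el[OF that(1) disjI1[OF refl]] el[OF that(2) disjI1[OF refl]] fmaps_ann])
  have cc: "fcomm Lam (\<lambda>psi. cre y (cre z psi)) Q"
    if "y \<in> {w x, w (x+1), w (x+2), w (x+3)}" "z \<in> {w x, w (x+1), w (x+2), w (x+3)}" for y z
    by (rule fcomm_compose[where A = "cre y" and B = "cre z",
          OF el[OF that(1) disjI2[OF refl]] el[OF that(2) disjI2[OF refl]] fmaps_cre]) (use that s(1) in auto)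
  show "fcomm Lam (qop lam w x) Q" unfolding qop_def
    by (rule fcomm_diff[OF aa aa lQ]) auto
  show "fcomm Lam (qadj lam w x) Q" unfolding qadj_def
    by (rule fcomm_diff[OF cc cc lQ]) auto
qed

lemma fcomm_nn_nn: "fcomm Lam (nn_term w x) (nn_term w y)"
  by (auto simp: fcomm_def nn_term_eq)

lemma fcomm_nn_q:
  assumes "{w x, w (x+2)} \<inter> {w y, w (y+1), w (y+2), w (y+3)} = {}"
  shows "fcomm Lam (nn_term w x) (qop lam w y)" "fcomm Lam (nn_term w x) (qadj lam w y)"
proof -
  let ?N = "nn_term w x"
  have el: "?N (ann z psi) = ann z (?N psi)" "?N (cre z psi) = cre z (?N psi)"
    if "z \<notin> {w x, w (x+2)}" for z psi
    using that by (auto simp: nn_term_eq ann_def cre_def)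
  have "?N (ann u (ann z psi)) = ann u (ann z (?N psi))" "?N (cre u (cre z psi)) = cre u (cre z (?N psi))"
    if "u \<in> {w y, w (y+1), w (y+2), w (y+3)}" "z \<in> {w y, w (y+1), w (y+2), w (y+3)}" for u z psi
    using assms that el by (metis disjoint_iff)+
  then show "fcomm Lam ?N (qop lam w y)" "fcomm Lam ?N (qadj lam w y)"
    by (simp_all add: fcomm_def qop_def qadj_def flinear_diff[OF flinear_nn_term])
qed

text \<open>The q-terms are of even degree in the CAR operators, so all signs from exchanging
  operators on distinct sites cancel; the distance-two terms are diagonal and see only their own
  sites.\<close>

lemma H_terms_commute:
  assumes fin: "finite Lam" and s: "term_sites w X Y \<subseteq> Lam" "term_sites w X' Y' \<subseteq> Lam"
    and d: "term_sites w X Y \<inter> term_sites w X' Y' = {}"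
  shows "fcomm Lam (H_terms kap lam w X Y) (H_terms kap lam w X' Y')"
proof (rule fcomm_H_terms[OF _ _ flinear_H_terms])
  fix x assume x: "x \<in> X"
  show "fcomm Lam (nn_term w x) (H_terms kap lam w X' Y')"
  proof (rule fcomm_sym, rule fcomm_H_terms[OF _ _ flinear_nn_term])
    fix y assume y: "y \<in> Y'"
    have d': "{w x, w (x+2)} \<inter> {w y, w (y+1), w (y+2), w (y+3)} = {}"
      using d x y by (auto simp: term_sites_def)
    show "fcomm Lam (\<lambda>psi. qadj lam w y (qop lam w y psi)) (nn_term w x)"
      by (intro fcomm_qadj_qop fcomm_sym[of Lam "nn_term w x"] fcomm_nn_q[OF d'])
  qed (rule fcomm_nn_nn)
next
  fix x assume x: "x \<in> Y"
  have sx: "{w x, w (x+1), w (x+2), w (x+3)} \<subseteq> Lam" using s(1) x by (auto simp: term_sites_def)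
  show "fcomm Lam (\<lambda>psi. qadj lam w x (qop lam w x psi)) (H_terms kap lam w X' Y')"
  proof (rule fcomm_sym, rule fcomm_H_terms[OF _ _ flinear_compose[OF flinear_qadj flinear_qop]])
    fix y assume y: "y \<in> X'"
    have d': "{w y, w (y+2)} \<inter> {w x, w (x+1), w (x+2), w (x+3)} = {}"
      using d x y by (auto simp: term_sites_def)
    show "fcomm Lam (nn_term w y) (\<lambda>psi. qadj lam w x (qop lam w x psi))"
      by (rule fcomm_sym) (intro fcomm_qadj_qop fcomm_sym[of Lam "nn_term w y"] fcomm_nn_q[OF d'])
  next
    fix y assume y: "y \<in> Y'"
    have sy: "{w y, w (y+1), w (y+2), w (y+3)} \<subseteq> Lam" using s(2) y by (auto simp: term_sites_def)
    have d': "{w x, w (x+1), w (x+2), w (x+3)} \<inter> {w y, w (y+1), w (y+2), w (y+3)} = {}"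
      using d x y unfolding term_sites_def by blast
    have "fcomm Lam (\<lambda>psi. qadj lam w x (qop lam w x psi)) Q" if "Q = qop lam w y \<or> Q = qadj lam w y" for Q
      by (rule fcomm_qadj_qop[OF fcomm_q_q(2)[OF fin sx sy d' that] fcomm_q_q(1)[OF fin sx sy d' that]])
    note * = this[OF disjI1[OF refl]] this[OF disjI2[OF refl]]
    show "fcomm Lam (\<lambda>psi. qadj lam w y (qop lam w y psi)) (\<lambda>psi. qadj lam w x (qop lam w x psi))"
      by (rule fcomm_qadj_qop[OF fcomm_sym[OF *(2)] fcomm_sym[OF *(1)]])
  qed
qed

lemma H_terms_projections_commute:
  assumes fin: "finite Lam" and s: "term_sites w X Y \<subseteq> Lam" "term_sites w X' Y' \<subseteq> Lam"
    and d: "term_sites w X Y \<inter> term_sites w X' Y' = {}" and x: "x \<in> FV Lam"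
  shows "oproj (KV Lam (H_terms kap lam w X Y)) (oproj (KV Lam (H_terms kap lam w X' Y')) x) =
    oproj (KV Lam (H_terms kap lam w X' Y')) (oproj (KV Lam (H_terms kap lam w X Y)) x)"
proof -
  let ?A = "H_terms kap lam w X Y" and ?B = "H_terms kap lam w X' Y'"
  note f = fmaps_H_terms[OF s(1), of kap lam] fmaps_H_terms[OF s(2), of kap lam]
  have symm: "inner (flift Lam H y) z = inner y (flift Lam H z)"
    if "y \<in> FV Lam" "z \<in> FV Lam" "H = H_terms kap lam w U V" "term_sites w U V \<subseteq> Lam" for y z H U V
  proof -
    note fm = fmaps_H_terms[OF that(4), of kap lam]
    have yz: "amp y \<in> fock Lam" "amp z \<in> fock Lam" using that by (auto simp: FV_def)
    have "inner (flift Lam H y) z = Re (finner Lam (H (amp y)) (amp z))"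
      using inner_eq_finner[OF fin flift_in_FV[OF fin fm], of y z] that(3)
      by (simp add: amp_flift[OF fin fm] restr_id yz)
    also have "\<dots> = Re (finner Lam (amp y) (H (amp z)))"
      using H_terms_symmetric[OF fin that(4)] that(3) by simp
    also have "\<dots> = inner y (flift Lam H z)"
      using inner_eq_finner[OF fin that(1), of "flift Lam H z"] that(3)
      by (simp add: amp_flift[OF fin fm] restr_id yz)
    finally show ?thesis .
  qed
  show ?thesis
    unfolding KV_eq_flift[OF fin f(1)] KV_eq_flift[OF fin f(2)]
  proof (rule kernel_projections_commute[OF fdim_FV[OF fin]])
    fix y assume y: "y \<in> FV Lam"
    then have yf: "amp y \<in> fock Lam" by (simp add: FV_def)
    have "?A (?B (amp y)) = ?B (?A (amp y))"
      using H_terms_commute[OF fin s d] yf by (simp add: fcomm_def)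
    moreover have "?A (amp y) \<in> fock Lam" "?B (amp y) \<in> fock Lam" using f yf by (auto simp: fmaps_def)
    ultimately show "flift Lam ?A (flift Lam ?B y) = flift Lam ?B (flift Lam ?A y)"
      by (simp add: amp_inject[symmetric] amp_flift[OF fin] f restr_id yf)
  qed (use x f s symm in \<open>auto intro!: linear_flift fin flinear_H_terms flift_in_FV\<close>)
qed

section \<open>Restriction to a window\<close>

text \<open>Multiplication by this sign turns the Jordan--Wigner signs of the natural order of the sites into
  those of the order given by the rank function \<open>rho\<close>. Ranking the sites of a window first makes the
  operators on the window act as on a chain of its own, for any configuration outside.\<close>

definition inv_sign :: "(int \<Rightarrow> int) \<Rightarrow> int set \<Rightarrow> complex" where
  "inv_sign rho R = (-1) ^ card {(y, z). y \<in> R \<and> z \<in> R \<and> y < z \<and> rho z < rho y}"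

lemma inv_sign_sq: "inv_sign rho R * inv_sign rho R = 1"
  by (simp add: inv_sign_def power_mult_distrib[symmetric])

lemma cnj_inv_sign: "cnj (inv_sign rho R) = inv_sign rho R" by (simp add: inv_sign_def)

text \<open>Adding \<open>z\<close> creates the inversions counted by \<open>a\<close> and
  \<open>b\<close>. The sites before \<open>z\<close> are \<open>a\<close> and \<open>c\<close> in
  the natural order, \<open>b\<close> and \<open>c\<close> in the rank order, so the two sides
  differ by twice \<open>card b\<close> in the exponent.\<close>

lemma inv_sign_insert:
  assumes fin: "finite R" and z: "z \<notin> R" and inj: "\<And>y. y \<in> R \<Longrightarrow> rho y \<noteq> rho z"
  shows "inv_sign rho R * jw_sign R z = (-1) ^ card {y \<in> R. rho y < rho z} * inv_sign rho (insert z R)"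
proof -
  let ?I = "\<lambda>R. {(y, z). y \<in> R \<and> z \<in> R \<and> y < z \<and> rho z < rho y}"
  define a b c where "a = {y \<in> R. y < z \<and> rho z < rho y}" and "b = {y \<in> R. z < y \<and> rho y < rho z}"
    and "c = {y \<in> R. y < z \<and> rho y < rho z}"
  have fabc: "finite a" "finite b" "finite c" using fin by (auto simp: a_def b_def c_def)
  have fI: "finite (?I R)" by (rule finite_subset[of _ "R \<times> R"]) (use fin in auto)
  have "?I (insert z R) = ?I R \<union> ((\<lambda>y. (y, z)) ` a \<union> (\<lambda>y. (z, y)) ` b)"
    using z by (auto simp: a_def b_def)
  moreover have "card (?I R \<union> ((\<lambda>y. (y, z)) ` a \<union> (\<lambda>y. (z, y)) ` b)) = card (?I R) + (card a + card b)"
  proof -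
    have "card ((\<lambda>y. (y, z)) ` a \<union> (\<lambda>y. (z, y)) ` b) = card a + card b"
      using fabc z by (subst card_Un_disjoint) (auto simp: card_image inj_on_def a_def b_def)
    moreover have "?I R \<inter> ((\<lambda>y. (y, z)) ` a \<union> (\<lambda>y. (z, y)) ` b) = {}" using z by auto
    ultimately show ?thesis using fI fabc by (subst card_Un_disjoint) auto
  qed
  ultimately have cI: "card (?I (insert z R)) = card (?I R) + (card a + card b)" by simp
  have "{y \<in> R. y < z} = a \<union> c" using inj by (auto simp: a_def c_def) (metis linorder_neqE)
  moreover have "a \<inter> c = {}" by (auto simp: a_def c_def)
  ultimately have ac: "card {y \<in> R. y < z} = card a + card c" using fabc by (simp add: card_Un_disjoint)
  have "{y \<in> R. rho y < rho z} = b \<union> c" using z by (auto simp: b_def c_def) (metis linorder_neqE)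
  moreover have "b \<inter> c = {}" by (auto simp: b_def c_def)
  ultimately have bc: "card {y \<in> R. rho y < rho z} = card b + card c" using fabc by (simp add: card_Un_disjoint)
  have "(-1::complex) ^ card b * (-1) ^ card b = 1" by (simp add: power_mult_distrib[symmetric])
  then show ?thesis
    unfolding inv_sign_def jw_sign_def cI ac bc by (simp add: power_add mult_ac)
qed

text \<open>\<open>v\<close> places a chain of length \<open>m\<close> injectively among the sites,
  possibly across the seam of a ring. The rank \<open>rho\<close> recovers the position inside the
  window and puts all outside sites behind it; signs are compared only when a window site is
  added.\<close>

locale window =
  fixes Lam :: "int set" and v :: "int \<Rightarrow> int" and m :: int and rho :: "int \<Rightarrow> int"
  assumes fin: "finite Lam" and inj: "inj_on v {1..m}" and img: "v ` {1..m} \<subseteq> Lam"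
    and rho_v: "\<And>x. x \<in> {1..m} \<Longrightarrow> rho (v x) = x"
    and rho_out: "\<And>y. y \<in> Lam - v ` {1..m} \<Longrightarrow> rho y > m"
begin

abbreviation "V \<equiv> v ` {1..m}"
abbreviation "outs \<equiv> Pow (Lam - V)"

text \<open>The fibre of \<open>psi\<close> over a fixed outside configuration \<open>T\<close>,
  read as a state of the chain on 1, ..., m. The sign makes every window operator act on the fibres
  exactly as on that chain, so the Fock space becomes a direct sum of copies of the chain's Fock
  space.\<close>

definition fib :: "int set \<Rightarrow> fstate \<Rightarrow> fstate" where
  "fib T psi = (\<lambda>S. if S \<subseteq> {1..m} then inv_sign rho (v ` S \<union> T) * psi (v ` S \<union> T) else 0)"

lemma fib_fock: "fib T psi \<in> fock {1..m}" by (auto simp: fib_def fock_def)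

lemma v_mem:
  assumes "S \<subseteq> {1..m}" "T \<in> outs" "x \<in> {1..m}"
  shows "v x \<in> v ` S \<union> T \<longleftrightarrow> x \<in> S"
  using inj_on_image_mem_iff[OF inj assms(3,1)] assms(2,3) by auto

text \<open>Outside sites rank behind the window, so the sites ranked before \<open>v x\<close> are
  the images of the sites of \<open>S\<close> before \<open>x\<close>. Their number gives the
  Jordan-Wigner sign of the standalone chain.\<close>

lemma window_sign:
  assumes S: "S \<subseteq> {1..m}" and T: "T \<in> outs" and x: "x \<in> {1..m}" "x \<notin> S"
  shows "inv_sign rho (v ` S \<union> T) * jw_sign (v ` S \<union> T) (v x)
    = jw_sign S x * inv_sign rho (insert (v x) (v ` S \<union> T))"
proof -
  have finS: "finite S" using S finite_subset by blast
  have finT: "finite T" using T fin finite_subset by blast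
  have notin: "v x \<notin> v ` S \<union> T" using v_mem[OF S T x(1)] x(2) by simp
  have rho1: "rho y \<noteq> rho (v x)" if y: "y \<in> v ` S \<union> T" for y
  proof (cases "y \<in> T")
    case True then have "rho y > m" using T rho_out by blast
    then show ?thesis using rho_v x by auto
  next
    case False
    then obtain s where "y = v s" "s \<in> S" using y by auto
    then show ?thesis using rho_v[of s] rho_v[OF x(1)] S x by auto
  qed
  have "{y \<in> v ` S \<union> T. rho y < rho (v x)} = v ` {s \<in> S. s < x}"
  proof -
    have "rho y < rho (v x) \<longleftrightarrow> False" if "y \<in> T" for y
      using that T rho_out[of y] rho_v[OF x(1)] x by auto
    moreover have "rho (v s) < rho (v x) \<longleftrightarrow> s < x" if "s \<in> S" for s
      using that S rho_v[OF x(1)] rho_v[of s] by auto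
    ultimately show ?thesis by auto
  qed
  moreover have "card (v ` {s \<in> S. s < x}) = card {s \<in> S. s < x}"
    by (rule card_image) (rule inj_on_subset[OF inj], use S in auto)
  ultimately show ?thesis
    using inv_sign_insert[of "v ` S \<union> T" "v x" rho] finS finT notin rho1
    by (simp add: jw_sign_def)
qed

lemma fib_ann:
  assumes T: "T \<in> outs" and x: "x \<in> {1..m}"
  shows "fib T (ann (v x) psi) = ann x (fib T psi)"
proof
  fix S
  show "fib T (ann (v x) psi) S = ann x (fib T psi) S"
  proof (cases "S \<subseteq> {1..m}")
    case True
    note mem = v_mem[OF True T x]
    show ?thesis
    proof (cases "x \<in> S")
      case xS: False
      have "insert x S \<subseteq> {1..m}" using True x by auto
      then show ?thesis using True xS mem window_sign[OF True T x xS]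
        by (simp add: fib_def ann_def mult.assoc[symmetric])
    qed (use True mem in \<open>simp add: fib_def ann_def\<close>)
  next
    case False
    then show ?thesis by (auto simp: fib_def ann_def)
  qed
qed

lemma fib_cre:
  assumes T: "T \<in> outs" and x: "x \<in> {1..m}"
  shows "fib T (cre (v x) psi) = cre x (fib T psi)"
proof
  fix S
  show "fib T (cre (v x) psi) S = cre x (fib T psi) S"
  proof (cases "S \<subseteq> {1..m}")
    case True
    note mem = v_mem[OF True T x]
    show ?thesis
    proof (cases "x \<in> S")
      case xS: True
      let ?S = "S - {x}"
      have S': "?S \<subseteq> {1..m}" "x \<notin> ?S" using True by auto
      have R: "insert (v x) (v ` ?S \<union> T) = v ` S \<union> T" using xS by auto
      have vxn: "v x \<notin> v ` ?S \<union> T" using v_mem[OF S'(1) T x] by simp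
      have R': "v ` S \<union> T - {v x} = v ` ?S \<union> T" using R vxn by auto
      have s: "inv_sign rho (v ` ?S \<union> T) * jw_sign (v ` ?S \<union> T) (v x)
          = jw_sign ?S x * inv_sign rho (v ` S \<union> T)"
        using window_sign[OF S'(1) T x S'(2)] R by simp
      have j: "jw_sign (v ` ?S \<union> T) (v x) = jw_sign (v ` S \<union> T) (v x)" "jw_sign ?S x = jw_sign S x"
        using jw_sign_insert[of "v x" "v ` ?S \<union> T"] R by (simp_all add: jw_sign_remove)
      let ?e = "inv_sign rho (v ` ?S \<union> T)" and ?e' = "inv_sign rho (v ` S \<union> T)"
        and ?j = "jw_sign (v ` S \<union> T) (v x)" and ?k = "jw_sign S x"
      \<comment> \<open>All these signs square to 1, so the relation for annihilation at
        \<open>x\<close> can be solved for the one needed for creation.\<close>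
      have "?e' * ?j = (?k * ?k) * (?e' * ?j)" by (simp add: jw_sign_sq)
      also have "\<dots> = ?k * (?k * ?e') * ?j" by (simp only: mult_ac)
      also have "?k * ?e' = ?e * ?j" using s j by simp
      also have "?k * (?e * ?j) * ?j = ?k * ?e * (?j * ?j)" by (simp only: mult_ac)
      finally have "?e' * ?j = ?k * ?e" by (simp add: jw_sign_sq)
      then show ?thesis using True xS mem S' R'
        by (simp add: fib_def cre_def mult.assoc[symmetric])
    qed (use True mem in \<open>simp add: fib_def cre_def\<close>)
  next
    case False
    then show ?thesis using x by (auto simp: fib_def cre_def)
  qed
qed

lemma fib_lincomb:
  "fib T (\<lambda>S. phi S - c * psi S) = (\<lambda>S. fib T phi S - c * fib T psi S)"
  "fib T (\<lambda>S. phi S + c * psi S) = (\<lambda>S. fib T phi S + c * fib T psi S)"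
  "fib T (\<lambda>S. \<Sum>x\<in>X. f x S) = (\<lambda>S. \<Sum>x\<in>X. fib T (f x) S)"
  by (auto simp: fib_def algebra_simps sum_distrib_left)

lemma fib_nn_term:
  assumes "T \<in> outs" "x \<in> {1..m}" "x + 2 \<in> {1..m}"
  shows "fib T (nn_term v x psi) = nn_term id x (fib T psi)"
  using assms by (simp add: nn_term_def fib_cre fib_ann)

lemma fib_qop:
  assumes "T \<in> outs" "x \<in> {1..m}" "x + 3 \<in> {1..m}"
  shows "fib T (qop lam v x psi) = qop lam id x (fib T psi)"
  using assms by (simp add: qop_def fib_lincomb fib_ann)

lemma fib_qadj:
  assumes "T \<in> outs" "x \<in> {1..m}" "x + 3 \<in> {1..m}"
  shows "fib T (qadj lam v x psi) = qadj lam id x (fib T psi)"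
  using assms by (simp add: qadj_def fib_lincomb fib_cre)

lemma fib_H_terms:
  assumes T: "T \<in> outs" and X: "X \<subseteq> {1..m-2}" "Y \<subseteq> {1..m-3}"
  shows "fib T (H_terms kap lam v X Y psi) = H_terms kap lam id X Y (fib T psi)"
proof -
  have x2: "fib T (nn_term v x psi) S = nn_term id x (fib T psi) S" if "x \<in> X" for x S
    using X T that by (subst fib_nn_term) auto
  have x3: "fib T (qadj lam v x (qop lam v x psi)) S = qadj lam id x (qop lam id x (fib T psi)) S" if "x \<in> Y" for x S
  proof -
    have "x \<in> {1..m}" "x + 3 \<in> {1..m}" using X that by auto
    then show ?thesis using T by (simp add: fib_qop fib_qadj)
  qed
  show ?thesis unfolding H_terms_def
    by (simp add: fib_lincomb x2 x3)
qed

lemma sum_Pow_window: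
  fixes f :: "int set \<Rightarrow> 'b::comm_monoid_add"
  shows "(\<Sum>R\<in>Pow Lam. f R) = (\<Sum>T\<in>outs. \<Sum>S\<in>Pow {1..m}. f (v ` S \<union> T))"
proof -
  have "(\<Sum>T\<in>outs. \<Sum>S\<in>Pow {1..m}. f (v ` S \<union> T)) = (\<Sum>(T, S)\<in>outs \<times> Pow {1..m}. f (v ` S \<union> T))"
    by (rule sum.cartesian_product)
  also have "\<dots> = (\<Sum>R\<in>Pow Lam. f R)"
  proof (rule sum.reindex_bij_witness[of _ "\<lambda>R. (R - V, {x\<in>{1..m}. v x \<in> R})" "\<lambda>(T, S). v ` S \<union> T"])
    fix p assume "p \<in> outs \<times> Pow {1..m}"
    then obtain T S where p: "p = (T, S)" "T \<in> outs" "S \<subseteq> {1..m}" by auto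
    have "v ` S \<union> T - V = T" using p by auto
    moreover have "{x \<in> {1..m}. v x \<in> v ` S \<union> T} = S"
    proof -
      have "v x \<in> v ` S \<union> T \<longleftrightarrow> x \<in> S" if "x \<in> {1..m}" for x
        using v_mem[OF p(3,2) that] .
      then show ?thesis using p by auto
    qed
    ultimately show "((case p of (T, S) \<Rightarrow> v ` S \<union> T) - V, {x \<in> {1..m}. v x \<in> (case p of (T, S) \<Rightarrow> v ` S \<union> T)}) = p"
      using p by simp
    show "(case p of (T, S) \<Rightarrow> v ` S \<union> T) \<in> Pow Lam" using p img by auto
  qed (auto split: prod.splits)
  finally show ?thesis by simp
qed

lemma finner_fib: "finner Lam phi psi = (\<Sum>T\<in>outs. finner {1..m} (fib T phi) (fib T psi))"
proof -
  have "cnj (fib T phi S) * fib T psi S = cnj (phi (v ` S \<union> T)) * psi (v ` S \<union> T)" if "S \<in> Pow {1..m}" for S T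
  proof -
    have "cnj (fib T phi S) * fib T psi S = (inv_sign rho (v ` S \<union> T) * inv_sign rho (v ` S \<union> T)) *
        (cnj (phi (v ` S \<union> T)) * psi (v ` S \<union> T))"
      using that by (simp add: fib_def cnj_inv_sign)
    then show ?thesis by (simp add: inv_sign_sq)
  qed
  then show ?thesis unfolding finner_def sum_Pow_window by simp
qed

lemma sqn_fib: "sqn Lam psi = (\<Sum>T\<in>outs. sqn {1..m} (fib T psi))"
proof -
  have "complex_of_real (sqn Lam psi) = complex_of_real (\<Sum>T\<in>outs. sqn {1..m} (fib T psi))"
    unfolding finner_self[symmetric] of_real_sum by (rule finner_fib)
  then show ?thesis by (simp only: of_real_eq_iff)
qed

text \<open>A section of \<open>fib T\<close>: the chain state \<open>eta\<close> is placed over the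
  single outside configuration \<open>T\<close>. It supplies the test vectors by which orthogonality
  passes to a fibre.\<close>

definition emb :: "int set \<Rightarrow> fstate \<Rightarrow> fstate" where
  "emb T eta = (\<lambda>R. if R \<subseteq> Lam \<and> R - V = T then inv_sign rho R * eta {x\<in>{1..m}. v x \<in> R} else 0)"

lemma emb_fock: "emb T eta \<in> fock Lam" by (auto simp: emb_def fock_def)

lemma fib_emb:
  assumes T: "T \<in> outs" "T' \<in> outs" and eta: "eta \<in> fock {1..m}"
  shows "fib T' (emb T eta) = (if T' = T then eta else (\<lambda>_. 0))"
proof
  fix S
  show "fib T' (emb T eta) S = (if T' = T then eta else (\<lambda>_. 0)) S"
  proof (cases "S \<subseteq> {1..m}")
    case True
    have "v ` S \<union> T' - V = T'" "v ` S \<union> T' \<subseteq> Lam" using T True img by blast+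
    moreover have "{x \<in> {1..m}. v x \<in> v ` S \<union> T'} = S"
    proof -
      have "v x \<in> v ` S \<union> T' \<longleftrightarrow> x \<in> S" if "x \<in> {1..m}" for x
        using v_mem[OF True T(2) that] .
      then show ?thesis using True by auto
    qed
    ultimately show ?thesis using True
      by (cases "T' = T") (simp_all add: fib_def emb_def inv_sign_sq mult.assoc[symmetric])
  next
    case False
    then show ?thesis using eta by (auto simp: fib_def fock_def)
  qed
qed

lemma finner_emb:
  assumes T: "T \<in> outs" and eta: "eta \<in> fock {1..m}"
  shows "finner Lam (emb T eta) psi = finner {1..m} eta (fib T psi)"
proof -
  have "finner Lam (emb T eta) psi = (\<Sum>T'\<in>outs. if T' = T then finner {1..m} eta (fib T psi) else 0)"
    unfolding finner_fib by (intro sum.cong refl) (auto simp: fib_emb[OF T _ eta] finner_def)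
  also have "\<dots> = finner {1..m} eta (fib T psi)" using T fin by simp
  finally show ?thesis .
qed

lemma fib_eq_0_imp:
  assumes "psi \<in> fock Lam" "\<And>T. T \<in> outs \<Longrightarrow> fib T psi = (\<lambda>_. 0)"
  shows "psi = (\<lambda>_. 0)"
proof -
  have "sqn Lam psi = 0" unfolding sqn_fib using assms(2) by (simp add: sqn_def)
  then show ?thesis using sqn_eq_0_iff[OF fin assms(1)] by simp
qed

lemma term_sites_window:
  assumes "X \<subseteq> {1..m-2}" "Y \<subseteq> {1..m-3}"
  shows "term_sites v X Y \<subseteq> Lam"
proof -
  have "v x \<in> Lam" if "x \<in> {1..m}" for x using img that by auto
  then show ?thesis using assms unfolding term_sites_def by fastforce
qed

lemma emb_kernel:
  assumes T: "T \<in> outs" and X: "X \<subseteq> {1..m-2}" "Y \<subseteq> {1..m-3}"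
    and eta: "eta \<in> ker_op {1..m} (H_terms kap lam id X Y)"
  shows "emb T eta \<in> ker_op Lam (H_terms kap lam v X Y)"
proof -
  have ef: "eta \<in> fock {1..m}" "H_terms kap lam id X Y eta = (\<lambda>_. 0)" using eta by (auto simp: ker_op_def)
  have "H_terms kap lam v X Y (emb T eta) = (\<lambda>_. 0)"
  proof (rule fib_eq_0_imp)
    show "H_terms kap lam v X Y (emb T eta) \<in> fock Lam"
      using fmaps_H_terms[OF term_sites_window[OF X]] emb_fock by (auto simp: fmaps_def)
    fix T' assume T': "T' \<in> outs"
    show "fib T' (H_terms kap lam v X Y (emb T eta)) = (\<lambda>_. 0)"
      unfolding fib_H_terms[OF T' X] fib_emb[OF T T' ef(1)]
      using ef(2) flinear_zero[OF flinear_H_terms] by simp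
  qed
  then show ?thesis by (simp add: ker_op_def emb_fock)
qed

lemma fib_kernel:
  assumes T: "T \<in> outs" and X: "X \<subseteq> {1..m-2}" "Y \<subseteq> {1..m-3}"
    and psi: "psi \<in> ker_op Lam (H_terms kap lam v X Y)"
  shows "fib T psi \<in> ker_op {1..m} (H_terms kap lam id X Y)"
proof -
  have "H_terms kap lam id X Y (fib T psi) = fib T (\<lambda>_. 0)"
    using fib_H_terms[OF T X, of kap lam psi] psi by (simp add: ker_op_def)
  also have "\<dots> = (\<lambda>_. 0)" by (auto simp: fib_def)
  finally show ?thesis by (simp add: ker_op_def fib_fock)
qed

lemma fib_orth:
  assumes T: "T \<in> outs" and X: "X \<subseteq> {1..m-2}" "Y \<subseteq> {1..m-3}"
    and orth: "\<And>phi. phi \<in> ker_op Lam (H_terms kap lam v X Y) \<Longrightarrow> finner Lam phi psi = 0"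
    and eta: "eta \<in> ker_op {1..m} (H_terms kap lam id X Y)"
  shows "finner {1..m} eta (fib T psi) = 0"
  using orth[OF emb_kernel[OF T X eta]] finner_emb[OF T, of eta psi] eta by (simp add: ker_op_def)

lemma window_form_fib:
  "Re (finner Lam psi (H_terms kap lam v {1..m-2} {1..m-3} psi)) =
    (\<Sum>T\<in>outs. Re (finner {1..m} (fib T psi) (H_open kap lam 1 m (fib T psi))))"
  unfolding finner_fib H_open_eq by (simp add: fib_H_terms)

text \<open>The window Hamiltonian is a direct sum of copies of the open chain Hamiltonian, one per
  outside configuration, and orthogonality to its kernel holds in each fibre. So the gap of the
  standalone chain applies fibre by fibre.\<close>

lemma window_gap:
  assumes kap: "kap \<ge> 0" and psi: "psi \<in> fock Lam"
    and orth: "\<And>phi. phi \<in> ker_op Lam (H_terms kap lam v {1..m-2} {1..m-3}) \<Longrightarrow> finner Lam phi psi = 0"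
  shows "gap_open kap lam m * sqn Lam psi \<le> energy Lam kap lam v {1..m-2} {1..m-3} psi"
proof -
  have ts: "term_sites id {1..m-2} {1..m-3} \<subseteq> {1..m}" by (auto simp: term_sites_def)
  have "gap_open kap lam m * sqn {1..m} (fib T psi) \<le> Re (finner {1..m} (fib T psi) (H_open kap lam 1 m (fib T psi)))"
    if T: "T \<in> outs" for T
    unfolding gap_open_def
  proof (rule op_gap_bound)
    show "flinear (H_open kap lam 1 m)" by (simp add: H_open_eq flinear_H_terms)
    show "0 \<le> Re (finner {1..m} eta (H_open kap lam 1 m eta))" for eta
      unfolding H_open_eq using form_H_terms[OF _ ts, of eta kap lam] energy_nonneg[OF kap] by simp
    show "finner {1..m} eta (fib T psi) = 0" if "eta \<in> ker_op {1..m} (H_open kap lam 1 m)" for eta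
      using fib_orth[OF T _ _ orth that[unfolded H_open_eq]] by simp
  qed (auto simp: fib_fock)
  then have "(\<Sum>T\<in>outs. gap_open kap lam m * sqn {1..m} (fib T psi)) \<le>
      Re (finner Lam psi (H_terms kap lam v {1..m-2} {1..m-3} psi))"
    unfolding window_form_fib by (rule sum_mono)
  then show ?thesis
    using form_H_terms[OF fin term_sites_window, of "{1..m-2}" "{1..m-3}" psi kap lam]
    by (simp add: sqn_fib sum_distrib_left)
qed

lemma window_norm:
  "energy Lam kap lam v {1..m-2} {1..m-3} psi \<le> norm_open kap lam m * sqn Lam psi"
proof -
  have ts: "term_sites id {1..m-2} {1..m-3} \<subseteq> {1..m}" by (auto simp: term_sites_def)
  have "Re (finner {1..m} (fib T psi) (H_open kap lam 1 m (fib T psi))) \<le> norm_open kap lam m * sqn {1..m} (fib T psi)" for T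
    unfolding norm_open_def
    by (rule form_le_op_norm) (auto simp: H_open_eq flinear_H_terms fmaps_H_terms[OF ts] fib_fock)
  then have "Re (finner Lam psi (H_terms kap lam v {1..m-2} {1..m-3} psi)) \<le>
      (\<Sum>T\<in>outs. norm_open kap lam m * sqn {1..m} (fib T psi))"
    unfolding window_form_fib by (rule sum_mono)
  then show ?thesis
    using form_H_terms[OF fin term_sites_window, of "{1..m-2}" "{1..m-3}" psi kap lam]
    by (simp add: sqn_fib sum_distrib_left)
qed

lemma window_gap_FV:
  assumes kap: "kap \<ge> 0" and x: "x \<in> FV Lam"
    and orth: "\<And>y. y \<in> KV Lam (H_terms kap lam v {1..m-2} {1..m-3}) \<Longrightarrow> inner x y = 0"
  shows "gap_open kap lam m * inner x x \<le> energy Lam kap lam v {1..m-2} {1..m-3} (amp x)"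
  using window_gap[OF kap, of "amp x" lam] finner_kernel_eq_0[OF fin flinear_H_terms x orth] x
  by (simp add: sqn_amp[OF fin] FV_def)

end

section \<open>Segments of a chain or ring as windows\<close>

lemma window_shift_exists:
  fixes w :: "int \<Rightarrow> int"
  assumes "inj_on w {s+1..s+m}" "w ` {s+1..s+m} \<subseteq> {1..L}"
  shows "\<exists>rho. window {1..L} (\<lambda>x. w (s + x)) m rho"
proof -
  let ?v = "\<lambda>x. w (s + x)"
  have inj: "inj_on ?v {1..m}"
  proof (rule inj_onI)
    fix x y assume "x \<in> {1..m}" "y \<in> {1..m}" "w (s + x) = w (s + y)"
    then show "x = y" using inj_onD[OF assms(1), of "s + x" "s + y"] by auto
  qed
  have img: "?v ` {1..m} \<subseteq> {1..L}" using assms(2) by (force simp: image_subset_iff)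
  show ?thesis
  \<comment> \<open>Outside sites are at least 1, so \<open>m + y\<close> ranks them behind the
    window.\<close>
  proof (intro exI[of _ "\<lambda>y. if y \<in> ?v ` {1..m} then the_inv_into {1..m} ?v y else m + y"], unfold_locales)
    fix x assume "x \<in> {1..m}"
    then show "(if ?v x \<in> ?v ` {1..m} then the_inv_into {1..m} ?v (?v x) else m + ?v x) = x"
      using the_inv_into_f_f[OF inj] by simp
  qed (use inj img in auto)
qed

lemma term_sites_interval: "term_sites w {a+1..b-2} {a+1..b-3} \<subseteq> w ` {a+1..b}"
  by (auto simp: term_sites_def)

text \<open>The segments below consist of the sites \<open>a + 1, \<dots>, b\<close>: the left end \<open>a\<close> is excluded.\<close>

definition H_seg :: "real \<Rightarrow> complex \<Rightarrow> (int \<Rightarrow> int) \<Rightarrow> int \<Rightarrow> int \<Rightarrow> fop" where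
  "H_seg kap lam w a b = H_terms kap lam w {a+1..b-2} {a+1..b-3}"

definition E_seg :: "int set \<Rightarrow> real \<Rightarrow> complex \<Rightarrow> (int \<Rightarrow> int) \<Rightarrow> int \<Rightarrow> int \<Rightarrow> fstate \<Rightarrow> real" where
  "E_seg Lam kap lam w a b = energy Lam kap lam w {a+1..b-2} {a+1..b-3}"

context
  fixes kap :: real and lam :: complex and w :: "int \<Rightarrow> int" and a b L :: int
  assumes kap: "kap > 0" and inj: "inj_on w {a+1..b}" and img: "w ` {a+1..b} \<subseteq> {1..L}"
begin

lemma seg_sites: "term_sites w {a+1..b-2} {a+1..b-3} \<subseteq> {1..L}"
  using term_sites_interval img by blast

lemma seg_shift:
  "H_terms kap lam (\<lambda>x. w (a + x)) {1..(b-a)-2} {1..(b-a)-3} = H_seg kap lam w a b"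
  "energy Lam kap lam (\<lambda>x. w (a + x)) {1..(b-a)-2} {1..(b-a)-3} = E_seg Lam kap lam w a b"
proof -
  have "(+) a ` {1..(b-a)-2} = {a+1..b-2}" "(+) a ` {1..(b-a)-3} = {a+1..b-3}" by simp_all
  then show "H_terms kap lam (\<lambda>x. w (a + x)) {1..(b-a)-2} {1..(b-a)-3} = H_seg kap lam w a b"
    "energy Lam kap lam (\<lambda>x. w (a + x)) {1..(b-a)-2} {1..(b-a)-3} = E_seg Lam kap lam w a b"
    unfolding H_seg_def E_seg_def by (simp_all add: H_terms_shift fun_eq_iff energy_shift add.commute[of 1 a])
qed

lemma seg_gap:
  assumes x: "x \<in> FV {1..L}" and orth: "\<And>y. y \<in> KV {1..L} (H_seg kap lam w a b) \<Longrightarrow> inner x y = 0"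
  shows "gap_open kap lam (b - a) * inner x x \<le> E_seg {1..L} kap lam w a b (amp x)"
proof -
  obtain rho where "window {1..L} (\<lambda>x. w (a + x)) (b - a) rho"
    using window_shift_exists[of w a "b - a" L] inj img by auto
  from window.window_gap_FV[OF this, of kap x lam] show ?thesis
    using x orth kap by (simp add: seg_shift)
qed

lemma seg_norm: "x \<in> FV {1..L} \<Longrightarrow> E_seg {1..L} kap lam w a b (amp x) \<le> norm_open kap lam (b - a) * inner x x"
proof -
  assume x: "x \<in> FV {1..L}"
  obtain rho where "window {1..L} (\<lambda>x. w (a + x)) (b - a) rho"
    using window_shift_exists[of w a "b - a" L] inj img by auto
  from window.window_norm[OF this, of kap lam "amp x"] show ?thesis
    using x by (simp add: seg_shift sqn_amp)
qed

lemma fdim_KV_seg: "fdim_subspace (KV {1..L} (H_seg kap lam w a b))"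
  unfolding H_seg_def by (rule fdim_KV) (simp_all add: flinear_H_terms)

lemma seg_energy_proj:
  "E_seg {1..L} kap lam w a b (amp (x - oproj (KV {1..L} (H_seg kap lam w a b)) x)) = E_seg {1..L} kap lam w a b (amp x)"
  unfolding H_seg_def E_seg_def by (rule energy_minus_oproj) (use kap seg_sites in auto)

lemma minus_proj_FV:
  "x \<in> FV {1..L} \<Longrightarrow> x - oproj (KV {1..L} (H_seg kap lam w a b)) x \<in> FV {1..L}"
  using oproj_in[OF fdim_KV_seg, of x] fdim_subspace_imp_subspace[OF fdim_FV[of "{1..L}"]]
  by (auto simp: KV_def intro: subspace_diff)

text \<open>With \<open>seg_norm_proj\<close>, the segment energy is caught between two multiples of
  the squared norm of the complement of the kernel projection. This is where Hamiltonians are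
  exchanged for projections.\<close>

lemma seg_gap_proj:
  assumes x: "x \<in> FV {1..L}" and u: "u = x - oproj (KV {1..L} (H_seg kap lam w a b)) x"
  shows "gap_open kap lam (b - a) * inner u u \<le> E_seg {1..L} kap lam w a b (amp x)"
  using seg_gap[of u] seg_energy_proj[of x] minus_proj_FV[OF x] oproj_orth[OF fdim_KV_seg] by (simp add: u)

lemma seg_norm_proj:
  assumes x: "x \<in> FV {1..L}" and u: "u = x - oproj (KV {1..L} (H_seg kap lam w a b)) x"
  shows "E_seg {1..L} kap lam w a b (amp x) \<le> norm_open kap lam (b - a) * inner u u"
  using seg_norm[of u] seg_energy_proj[of x] minus_proj_FV[OF x] by (simp add: u)

lemma KV_seg_iff:
  "x \<in> KV {1..L} (H_seg kap lam w a b) \<longleftrightarrow> x \<in> FV {1..L} \<and>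
    (\<forall>y\<in>{a+1..b-2}. nn_term w y (amp x) = (\<lambda>_. 0)) \<and> (\<forall>y\<in>{a+1..b-3}. qop lam w y (amp x) = (\<lambda>_. 0))"
  unfolding H_seg_def by (rule KV_H_terms_iff) (use kap seg_sites in auto)

end

section \<open>Elementary bounds on gaps and norms\<close>

text \<open>The test vector for nontriviality: two particles at distance two are penalised by the
  first term, so every ground state vanishes on this configuration. It is a unit vector orthogonal
  to all kernels considered and shows that norms are positive.\<close>

definition delta13 :: fstate where "delta13 = (\<lambda>S. if S = {1, 3} then 1 else 0)"

lemma delta13: "L \<ge> 3 \<Longrightarrow> delta13 \<in> fock {1..L}" "L \<ge> 3 \<Longrightarrow> sqn {1..L} delta13 = 1"
proof -
  show "L \<ge> 3 \<Longrightarrow> delta13 \<in> fock {1..L}" by (auto simp: fock_def delta13_def)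
  assume "L \<ge> 3"
  then have "{1, 3} \<in> Pow {1..L}" by auto
  moreover have "(cmod (delta13 S))\<^sup>2 = (if S = {1, 3} then 1 else 0)" for S by (simp add: delta13_def)
  ultimately show "sqn {1..L} delta13 = 1" by (simp add: sqn_def)
qed

lemma finner_delta13: "L \<ge> 3 \<Longrightarrow> finner {1..L} phi delta13 = cnj (phi {1, 3})"
proof -
  assume "L \<ge> 3"
  then have "{1, 3} \<in> Pow {1..L}" by auto
  moreover have "cnj (phi S) * delta13 S = (if S = {1, 3} then cnj (phi {1, 3}) else 0)" for S by (simp add: delta13_def)
  ultimately show ?thesis by (simp add: finner_def)
qed

lemma kernel_at_13:
  assumes "kap > 0" "finite X" "finite Y" "term_sites w X Y \<subseteq> {1..L}" "1 \<in> X" "w 1 = 1" "w 3 = 3"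
    and phi: "phi \<in> ker_op {1..L} (H_terms kap lam w X Y)"
  shows "phi {1, 3} = 0"
proof -
  have "nn_term w 1 phi = (\<lambda>_. 0)"
    using phi H_terms_eq_0_iff[of "{1..L}" kap X Y w phi lam] assms by (auto simp: ker_op_def)
  then have "nn_term w 1 phi {1, 3} = 0" by simp
  then show ?thesis using assms by (simp add: nn_term_eq)
qed

lemma op_gap_greatest_H_terms:
  assumes kap: "kap > 0" "finite X" "finite Y" "term_sites w X Y \<subseteq> {1..L}" "1 \<in> X" "w 1 = 1" "w 3 = 3" and L: "L \<ge> 3"
    and bd: "\<And>x. x \<in> FV {1..L} \<Longrightarrow> (\<And>y. y \<in> KV {1..L} (H_terms kap lam w X Y) \<Longrightarrow> inner x y = 0) \<Longrightarrow>
        c * inner x x \<le> energy {1..L} kap lam w X Y (amp x)"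
  shows "c \<le> op_gap {1..L} (H_terms kap lam w X Y)"
proof (rule op_gap_greatest)
  show "delta13 \<in> fock {1..L}" "fnorm {1..L} delta13 = 1" using delta13 L by (auto simp: fnorm_eq)
  show "finner {1..L} phi delta13 = 0" if "phi \<in> ker_op {1..L} (H_terms kap lam w X Y)" for phi
    using kernel_at_13[OF kap that] finner_delta13[OF L] by simp
  fix psi assume psi: "psi \<in> fock {1..L}"
    and o: "\<And>phi. phi \<in> ker_op {1..L} (H_terms kap lam w X Y) \<Longrightarrow> finner {1..L} phi psi = 0"
  have a: "amp (Fvec psi) = psi" using amp_Fvec[OF _ psi] by simp
  have F: "Fvec psi \<in> FV {1..L}" using Fvec_in_FV[OF _ psi] by simp
  have "inner (Fvec psi) y = 0" if "y \<in> KV {1..L} (H_terms kap lam w X Y)" for y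
  proof -
    have "finner {1..L} (amp y) psi = 0" using o that by (simp add: KV_eq_ker)
    then have "inner y (Fvec psi) = 0"
      using inner_eq_finner[of "{1..L}" y "Fvec psi"] that a by (simp add: KV_def)
    then show ?thesis by (simp add: inner_commute)
  qed
  from bd[OF F this] show "c * sqn {1..L} psi \<le> Re (finner {1..L} psi (H_terms kap lam w X Y psi))"
    using form_H_terms[of "{1..L}" w X Y psi kap lam] kap(4) sqn_amp[OF _ F] a by simp
qed

lemma gap_open_nonneg:
  assumes "kap > 0" "m \<ge> 3"
  shows "gap_open kap lam m \<ge> 0"
  unfolding gap_open_def H_open_eq
  by (rule op_gap_greatest_H_terms) (use assms energy_nonneg in \<open>auto simp: term_sites_def\<close>)

lemma norm_open_pos:
  assumes "kap > 0" "m \<ge> 3"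
  shows "norm_open kap lam m > 0"
proof -
  have ts: "term_sites id {1..m-2} {1..m-3} \<subseteq> {1..m}" by (auto simp: term_sites_def)
  have "1 = sqn {1..m} (nn_term id 1 delta13)"
  proof -
    have "nn_term id 1 delta13 = delta13" by (auto simp: nn_term_eq delta13_def)
    then show ?thesis using delta13(2)[OF assms(2)] by simp
  qed
  also have "\<dots> \<le> (\<Sum>x\<in>{1..m-2}. sqn {1..m} (nn_term id x delta13))"
    using assms by (intro member_le_sum) (auto simp: sqn_nonneg)
  also have "\<dots> \<le> energy {1..m} kap lam id {1..m-2} {1..m-3} delta13"
    using assms by (simp add: energy_def sum_nonneg sqn_nonneg)
  also have "\<dots> \<le> norm_open kap lam m * sqn {1..m} delta13"
    unfolding norm_open_def
    using form_le_op_norm[OF _ flinear_H_terms fmaps_H_terms[OF ts] delta13(1)[OF assms(2)], of kap lam]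
      form_H_terms[OF _ ts, of delta13 kap lam] by (simp add: H_open_eq)
  finally show ?thesis using delta13(2)[OF assms(2)] by simp
qed

section \<open>Finite-size criterion on the ring\<close>

lemma wrap_periodic: "wrap 1 L (y + L) = wrap 1 L y"
proof -
  have "(y + L - 1) mod L = (y - 1 + L) mod L" by (simp add: algebra_simps)
  then show ?thesis by (simp add: wrap_def)
qed

lemma wrap_range: "L \<ge> 1 \<Longrightarrow> wrap 1 L y \<in> {1..L}"
proof -
  assume "L \<ge> 1"
  then have "(y - 1) mod L < L" "(y - 1) mod L \<ge> 0" by simp_all
  then have "1 \<le> 1 + (y - 1) mod L" "1 + (y - 1) mod L \<le> L" by linarith+
  then show ?thesis by (simp only: wrap_def atLeastAtMost_iff) simp
qed

lemma wrap_inj: "inj_on (wrap 1 L) {s+1..s+L}"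
proof (rule inj_onI)
  fix x y assume xy: "x \<in> {s+1..s+L}" "y \<in> {s+1..s+L}" "wrap 1 L x = wrap 1 L y"
  then have "(x - 1) mod L = (y - 1) mod L" by (simp add: wrap_def)
  then have "L dvd (x - 1) - (y - 1)" by (simp add: mod_eq_dvd_iff)
  then have "L dvd x - y" by simp
  moreover have "\<bar>x - y\<bar> < L" using xy by auto
  ultimately have "x - y = 0" using dvd_imp_le_int[of "x - y" L] by (cases "x - y = 0") auto
  then show "x = y" by simp
qed

text \<open>The ring of \<open>3 M + j\<close> sites is cut into \<open>M\<close> blocks of three or four sites with no two
  adjacent blocks of four; \<open>block_pos M j i\<close> is the number of sites before block \<open>i\<close>.\<close>

definition block_extra :: "int \<Rightarrow> int \<Rightarrow> int \<Rightarrow> int" where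
  "block_extra M j i = (i div M) * j + min j ((i mod M + 1) div 2)"

definition block_pos :: "int \<Rightarrow> int \<Rightarrow> int \<Rightarrow> int" where
  "block_pos M j i = 3 * i + block_extra M j i"

lemma block_extra_eq: "0 \<le> t \<Longrightarrow> t < M \<Longrightarrow> block_extra M j (q * M + t) = q * j + min j ((t + 1) div 2)"
  by (simp add: block_extra_def)

context
  fixes M j :: int
  assumes M: "M \<ge> 6" and j: "0 \<le> j" "j \<le> 2"
begin

text \<open>The long blocks of each turn are the even ones of index below 2 j, that is 0 and 2 at
  most. With \<open>M \<ge> 6\<close> the last blocks of a turn are short, so two consecutive blocks
  contain at most one extra site even if they straddle the seam. The cases follow the position of
  the seam.\<close>

lemma block_extra_step:
  "block_extra M j i \<le> block_extra M j (i + 1)"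
  "block_extra M j (i + 2) - block_extra M j i \<in> {0, 1}"
proof -
  define q t where "q = i div M" and "t = i mod M"
  have i: "i = q * M + t" by (simp add: q_def t_def)
  have t: "0 \<le> t" "t < M" using M by (auto simp: t_def)
  have e0: "block_extra M j i = q * j + min j ((t + 1) div 2)" unfolding i by (rule block_extra_eq[OF t])
  consider "t + 2 < M" | "t = M - 2" | "t = M - 1" using t by linarith
  then have "block_extra M j i \<le> block_extra M j (i + 1) \<and> block_extra M j (i + 2) - block_extra M j i \<in> {0, 1}"
  proof cases
    case 1
    have i12: "i + 1 = q * M + (t + 1)" "i + 2 = q * M + (t + 2)" by (simp_all add: i)
    have e12: "block_extra M j (i + 1) = q * j + min j ((t + 1 + 1) div 2)"
      "block_extra M j (i + 2) = q * j + min j ((t + 2 + 1) div 2)"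
      unfolding i12 by (rule block_extra_eq; use t 1 in simp)+
    have "(t + 1) div 2 \<le> (t + 1 + 1) div 2" "(t + 2 + 1) div 2 = (t + 1) div 2 + 1" by linarith+
    then show ?thesis unfolding e0 e12 by (auto simp: min_def)
  next
    case 2
    have i12: "i + 1 = q * M + (M - 1)" "i + 2 = (q + 1) * M + 0" using 2 by (simp_all add: i distrib_right)
    have e12: "block_extra M j (i + 1) = q * j + min j ((M - 1 + 1) div 2)"
      "block_extra M j (i + 2) = (q + 1) * j + min j ((0 + 1) div 2)"
      unfolding i12 by (rule block_extra_eq; use M in simp)+
    have "(M - 2 + 1) div 2 \<ge> 2" "(M - 1 + 1) div 2 \<ge> 2" using M by linarith+
    then show ?thesis unfolding e0 e12 2 using j by (simp add: distrib_right min_def)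
  next
    case 3
    have i12: "i + 1 = (q + 1) * M + 0" "i + 2 = (q + 1) * M + 1" using 3 by (simp_all add: i distrib_right)
    have e12: "block_extra M j (i + 1) = (q + 1) * j + min j ((0 + 1) div 2)"
      "block_extra M j (i + 2) = (q + 1) * j + min j ((1 + 1) div 2)"
      unfolding i12 by (rule block_extra_eq; use M in simp)+
    have "(M - 1 + 1) div 2 \<ge> 2" using M by linarith
    then show ?thesis unfolding e0 e12 3 using j by (auto simp: distrib_right min_def)
  qed
  then show "block_extra M j i \<le> block_extra M j (i + 1)"
    "block_extra M j (i + 2) - block_extra M j i \<in> {0, 1}" by auto
qed

lemma block_extra_period: "block_extra M j (i + M) = block_extra M j i + j"
proof -
  have "(i + M) div M = i div M + 1" using M by (simp add: div_add_self2)
  then show ?thesis by (simp add: block_extra_def distrib_right)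
qed

lemma block_extra_mono: "i \<le> k \<Longrightarrow> block_extra M j i \<le> block_extra M j k"
proof (induction k rule: int_ge_induct)
  case (step k) then show ?case using block_extra_step(1)[of k] by linarith
qed simp

lemma block_pos_step: "block_pos M j i + 3 \<le> block_pos M j (i + 1)"
  using block_extra_step(1)[of i] by (simp add: block_pos_def)

lemma block_pos_two: "block_pos M j (i + 2) - block_pos M j i \<in> {6, 7}"
  using block_extra_step(2)[of i] by (auto simp: block_pos_def)

lemma block_pos_mono: "i \<le> k \<Longrightarrow> block_pos M j i \<le> block_pos M j k"
  using block_extra_mono[of i k] by (simp add: block_pos_def)

lemma block_pos_period: "block_pos M j (i + M) = block_pos M j i + (3 * M + j)"
  unfolding block_pos_def block_extra_period by simp

lemma block_pos_0: "block_pos M j 0 = 0" using j by (simp add: block_pos_def block_extra_def)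

lemma sum_blocks:
  fixes t :: "int \<Rightarrow> real"
  shows "(\<Sum>i\<in>{a..<a + int k}. \<Sum>y\<in>{block_pos M j i+1..block_pos M j (i+1)}. t y)
    = (\<Sum>y\<in>{block_pos M j a+1..block_pos M j (a + int k)}. t y)"
proof (induction k)
  case (Suc k)
  have 1: "{a..<a + int (Suc k)} = insert (a + int k) {a..<a + int k}" by auto
  have 2: "{block_pos M j a+1..block_pos M j (a + int (Suc k))} =
    {block_pos M j a+1..block_pos M j (a + int k)} \<union> {block_pos M j (a + int k)+1..block_pos M j (a + int k + 1)}"
    using block_pos_mono[of a "a + int k"] block_pos_mono[of "a + int k" "a + int k + 1"]
    by (auto simp: algebra_simps)
  show ?case unfolding 1 2 using Suc by (subst sum.union_disjoint) auto
qed simp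

text \<open>A window consists of two consecutive blocks, so over one turn of the ring every block
  sum occurs twice.\<close>

lemma sum_windows_le:
  fixes t :: "int \<Rightarrow> real"
  assumes t: "\<And>y. t y \<ge> 0" and per: "\<And>y. t (y + (3 * M + j)) = t y" and c: "c \<ge> 0"
  shows "(\<Sum>i\<in>{0..<M}. \<Sum>y\<in>{block_pos M j i+1..block_pos M j (i+2)-c}. t y) \<le> 2 * (\<Sum>y\<in>{1..3*M+j}. t y)"
proof -
  define B where "B i = (\<Sum>y\<in>{block_pos M j i+1..block_pos M j (i+1)}. t y)" for i
  have Bper: "B (i + M) = B i" for i
  proof -
    have "block_pos M j (i + M + 1) = block_pos M j (i + 1) + (3 * M + j)"
      using block_pos_period[of "i + 1"] by (simp add: algebra_simps)
    then have "B (i + M) = (\<Sum>y\<in>{block_pos M j i+1..block_pos M j (i+1)}. t (y + (3 * M + j)))"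
      unfolding B_def block_pos_period
      by (intro sum.reindex_bij_witness[of _ "\<lambda>y. y + (3 * M + j)" "\<lambda>y. y - (3 * M + j)"]) auto
    then show ?thesis by (simp add: per B_def)
  qed
  have Bsum: "(\<Sum>i\<in>{0..<M}. B i) = (\<Sum>y\<in>{1..3*M+j}. t y)"
    using sum_blocks[of t 0 "nat M"] M block_pos_period[of 0] by (simp add: B_def block_pos_0)
  have "(\<Sum>y\<in>{block_pos M j i+1..block_pos M j (i+2)-c}. t y) \<le> B i + B (i + 1)" for i
  proof -
    have "(\<Sum>y\<in>{block_pos M j i+1..block_pos M j (i+2)-c}. t y) \<le>
      (\<Sum>y\<in>{block_pos M j i+1..block_pos M j (i+2)}. t y)"
      using t c by (intro sum_mono2) auto
    also have "\<dots> = (\<Sum>k\<in>{i..<i + int 2}. B k)" using sum_blocks[of t i 2] by (simp add: B_def)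
    also have "{i..<i + int 2} = {i, i + 1}" by auto
    finally show ?thesis by simp
  qed
  then have "(\<Sum>i\<in>{0..<M}. \<Sum>y\<in>{block_pos M j i+1..block_pos M j (i+2)-c}. t y) \<le> (\<Sum>i\<in>{0..<M}. B i + B (i + 1))"
    by (rule sum_mono)
  also have "\<dots> = 2 * (\<Sum>i\<in>{0..<M}. B i)"
    using sum_shift_periodic_int[of B M 1] Bper by (simp add: sum.distrib)
  finally show ?thesis by (simp add: Bsum)
qed

text \<open>Neighbouring windows share a block of at least three sites. A term cut off at the end of
  one window reaches at most \<open>c \<le> 3\<close> sites to the right and thus starts inside the
  next window.\<close>

lemma sum_windows_ge:
  fixes t :: "int \<Rightarrow> real"
  assumes t: "\<And>y. t y \<ge> 0" and c: "c \<le> 3"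
  shows "(\<Sum>y\<in>{block_pos M j a+1..block_pos M j (a + int (Suc k) + 1)-c}. t y)
    \<le> (\<Sum>i\<in>{a..<a + int (Suc k)}. \<Sum>y\<in>{block_pos M j i+1..block_pos M j (i+2)-c}. t y)"
proof (induction k)
  case 0
  have "{a..<a + int (Suc 0)} = {a}" by auto
  then show ?case by (simp add: add.commute)
next
  case (Suc k)
  let ?b = "a + int (Suc k)"
  have 1: "{a..<a + int (Suc (Suc k))} = insert ?b {a..<?b}" by auto
  have sub: "{block_pos M j a+1..block_pos M j (a + int (Suc (Suc k)) + 1)-c} \<subseteq>
     {block_pos M j a+1..block_pos M j (?b + 1)-c} \<union> {block_pos M j ?b+1..block_pos M j (?b+2)-c}"
    using block_pos_step[of ?b] c by (auto simp: algebra_simps)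
  have "(\<Sum>y\<in>{block_pos M j a+1..block_pos M j (a + int (Suc (Suc k)) + 1)-c}. t y) \<le>
     (\<Sum>y\<in>{block_pos M j a+1..block_pos M j (?b + 1)-c} \<union> {block_pos M j ?b+1..block_pos M j (?b+2)-c}. t y)"
    using sub t by (intro sum_mono2) auto
  also have "\<dots> \<le> (\<Sum>y\<in>{block_pos M j a+1..block_pos M j (?b + 1)-c}. t y) + (\<Sum>y\<in>{block_pos M j ?b+1..block_pos M j (?b+2)-c}. t y)"
    using t by (simp add: sum_Un sum_nonneg)
  also have "\<dots> \<le> (\<Sum>i\<in>{a..<?b}. \<Sum>y\<in>{block_pos M j i+1..block_pos M j (i+2)-c}. t y) + (\<Sum>y\<in>{block_pos M j ?b+1..block_pos M j (?b+2)-c}. t y)"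
    using Suc by simp
  finally show ?case unfolding 1 by simp
qed

end

section \<open>Knabe's bound applied to the windows of the ring\<close>

lemma sum_minus_oproj_operator:
  fixes K :: "int \<Rightarrow> 'a::real_inner set"
  assumes K: "\<And>i. i \<in> I \<Longrightarrow> fdim_subspace (K i)" "\<And>i. i \<in> I \<Longrightarrow> K i \<subseteq> F" and F: "fdim_subspace F"
    and A: "A = (\<lambda>x. \<Sum>i\<in>I. x - oproj (K i) x)"
  shows "linear A" "x \<in> F \<Longrightarrow> A x \<in> F" "inner (A x) y = inner x (A y)"
    "inner x (A x) = (\<Sum>i\<in>I. inner (x - oproj (K i) x) (x - oproj (K i) x))"
proof -
  have "linear (\<lambda>x. x - oproj (K i) x)" if "i \<in> I" for i
    by (rule linearI) (auto simp: oproj_add[OF K(1)[OF that]] oproj_scaleR[OF K(1)[OF that]] algebra_simps)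
  then show "linear A" unfolding A by (intro linear_compose_sum) auto
  have sF: "subspace F" using F by (simp add: fdim_subspace_def)
  show "x \<in> F \<Longrightarrow> A x \<in> F"
    unfolding A using K sF oproj_in[OF K(1)]
    by (intro subspace_sum subspace_diff) blast+
  show "inner (A x) y = inner x (A y)"
    unfolding A inner_sum_left inner_sum_right
    by (intro sum.cong refl) (rule minus_oproj_symmetric[OF K(1)])
  show "inner x (A x) = (\<Sum>i\<in>I. inner (x - oproj (K i) x) (x - oproj (K i) x))"
    unfolding A inner_sum_right by (intro sum.cong refl) (rule inner_self_minus_oproj[OF K(1)])
qed

text \<open>The ring energy dominates gam / 2 times the form of the sum of all window complements. A
  run of n windows spans n + 1 blocks: its segment has gap at least g, while its energy is at most
  Gam times the sum of its n complements. That sum therefore has gap at least g / Gam, and the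
  counting bound lifts this to the sum around the ring.\<close>

lemma ring_gap:
  fixes kap :: real and lam :: complex and M j :: int and n :: nat
  assumes kap: "kap > 0" and M: "M \<ge> 6" and j: "0 \<le> j" "j \<le> 2" and n: "n \<ge> 2" and Mn: "M \<ge> 2 * int n"
    and gam: "gam \<le> gap_open kap lam 6" "gam \<le> gap_open kap lam 7" "gam \<ge> 0"
    and Gam: "norm_open kap lam 6 \<le> Gam" "norm_open kap lam 7 \<le> Gam"
    and g: "\<And>r. 0 \<le> r \<Longrightarrow> r \<le> 5 \<Longrightarrow> g \<le> gap_open kap lam (3 * (int n + 1) + r)" and gG: "g > Gam / real n"
  shows "gam * real n / (2 * Gam * (real n - 1)) * (g - Gam / real n) \<le> gap_per kap lam (3 * M + j)"
proof -
  define L where "L = 3 * M + j"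
  define w where "w = wrap 1 L"
  define s where "s = block_pos M j"
  define F where "F = FV {1..L}"
  define K where "K i = KV {1..L} (H_seg kap lam w (s i) (s (i + 2)))" for i
  have L: "L \<ge> 18" using M j by (simp add: L_def)
  have Gpos: "Gam > 0" using norm_open_pos[OF kap, of 6 lam] Gam by simp
  have gpos: "g > 0" using gG Gpos n by (smt (verit) divide_nonneg_nonneg of_nat_0_le_iff)
  note bp = block_pos_step[OF M j] block_pos_two[OF M j] block_pos_mono[OF M j] block_pos_period[OF M j] block_pos_0[OF M j]
  have wimg: "w ` X \<subseteq> {1..L}" for X using wrap_range[of L] L by (auto simp: w_def)
  have winj: "inj_on w {a+1..b}" if "b - a \<le> L" for a b
    unfolding w_def by (rule inj_on_subset[OF wrap_inj[of L a]]) (use that in auto)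
  have ts: "term_sites w X Y \<subseteq> {1..L}" for X Y
    using wrap_range[of L] L unfolding term_sites_def w_def by auto
  have two: "s (i + 2) - s i = 6 \<or> s (i + 2) - s i = 7" for i using bp(2)[of i] by (auto simp: s_def)
  have winj2: "inj_on w {s i + 1..s (i + 2)}" for i by (rule winj) (use two[of i] L in auto)
  have Fdim: "fdim_subspace F" unfolding F_def by (rule fdim_FV) simp
  have Kdim: "fdim_subspace (K i)" for i unfolding K_def H_seg_def by (rule fdim_KV) (simp_all add: flinear_H_terms)
  have KF: "K i \<subseteq> F" for i by (auto simp: K_def F_def KV_def)
  have Kper: "K (i + M) = K i" for i
  proof -
    have "s (i + M) = L + s i" "s (i + M + 2) = L + s (i + 2)"
      using bp(4)[of i] bp(4)[of "i + 2"] by (simp_all add: s_def L_def algebra_simps)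
    then have "H_seg kap lam w (s (i + M)) (s (i + M + 2)) =
      H_terms kap lam w ((+) L ` {s i + 1..s (i + 2) - 2}) ((+) L ` {s i + 1..s (i + 2) - 3})"
      by (simp add: H_seg_def algebra_simps)
    also have "\<dots> = H_terms kap lam (\<lambda>x. w (L + x)) {s i + 1..s (i + 2) - 2} {s i + 1..s (i + 2) - 3}"
      by (simp only: H_terms_shift)
    also have "(\<lambda>x. w (L + x)) = w" using wrap_periodic[of L] by (simp add: w_def add.commute fun_eq_iff)
    finally show ?thesis by (simp add: K_def H_seg_def)
  qed
  define Q where "Q x i = x - oproj (K i) x" for x i
  define E where "E i x = E_seg {1..L} kap lam w (s i) (s (i + 2)) (amp x)" for i x
  have E_up: "E i x \<le> Gam * inner (Q x i) (Q x i)" if x: "x \<in> F" for i x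
  proof -
    have "E i x \<le> norm_open kap lam (s (i + 2) - s i) * inner (Q x i) (Q x i)"
      unfolding E_def using x
      by (intro seg_norm_proj[OF kap winj2 wimg]) (simp_all add: F_def Q_def K_def)
    also have "\<dots> \<le> Gam * inner (Q x i) (Q x i)"
      using two[of i] Gam by (intro mult_right_mono) auto
    finally show ?thesis .
  qed
  have E_low: "gam * inner (Q x i) (Q x i) \<le> E i x" if x: "x \<in> F" for i x
  proof -
    have "gam * inner (Q x i) (Q x i) \<le> gap_open kap lam (s (i + 2) - s i) * inner (Q x i) (Q x i)"
      using two[of i] gam by (intro mult_right_mono) auto
    also have "\<dots> \<le> E i x"
      unfolding E_def using x
      by (intro seg_gap_proj[OF kap winj2 wimg]) (simp_all add: F_def Q_def K_def)
    finally show ?thesis .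
  qed
  define t1 t2 where "t1 x y = sqn {1..L} (nn_term w y (amp x))" and "t2 x y = sqn {1..L} (qop lam w y (amp x))" for x y
  have tpos: "t1 x y \<ge> 0" "t2 x y \<ge> 0" for x y by (auto simp: t1_def t2_def sqn_nonneg)
  have tper: "t1 x (y + (3 * M + j)) = t1 x y" "t2 x (y + (3 * M + j)) = t2 x y" for x y
  proof -
    have "w (y + L + z) = w (y + z)" for z
      using wrap_periodic[of L "y + z"] by (simp add: w_def algebra_simps)
    from this[of 0] this[of 1] this[of 2] this[of 3] show "t1 x (y + (3 * M + j)) = t1 x y" "t2 x (y + (3 * M + j)) = t2 x y"
      by (simp_all add: t1_def t2_def nn_term_def qop_def flip: L_def)
  qed
  have E_eq: "E i x = (\<Sum>y\<in>{s i+1..s (i+2)-2}. t1 x y) + kap * (\<Sum>y\<in>{s i+1..s (i+2)-3}. t2 x y)" for i x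
    by (simp add: E_def E_seg_def energy_def t1_def t2_def)
  define Ep where "Ep x = energy {1..L} kap lam w {1..L} {1..L} (amp x)" for x
  have Ep_eq: "Ep x = (\<Sum>y\<in>{1..L}. t1 x y) + kap * (\<Sum>y\<in>{1..L}. t2 x y)" for x
    by (simp add: Ep_def energy_def t1_def t2_def)
  have sum_E_le: "(\<Sum>i\<in>{0..<M}. E i x) \<le> 2 * Ep x" for x
  proof -
    have "(\<Sum>i\<in>{0..<M}. E i x) = (\<Sum>i\<in>{0..<M}. \<Sum>y\<in>{s i+1..s (i+2)-2}. t1 x y)
       + kap * (\<Sum>i\<in>{0..<M}. \<Sum>y\<in>{s i+1..s (i+2)-3}. t2 x y)"
      by (simp add: E_eq sum.distrib sum_distrib_left)
    also have "\<dots> \<le> 2 * (\<Sum>y\<in>{1..L}. t1 x y) + kap * (2 * (\<Sum>y\<in>{1..L}. t2 x y))"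
      unfolding s_def L_def using kap tpos tper by (intro add_mono mult_left_mono sum_windows_le[OF M j]) auto
    finally show ?thesis by (simp add: Ep_eq algebra_simps)
  qed
  have sum_E_ge: "E_seg {1..L} kap lam w (s a) (s (a + int (Suc k) + 1)) (amp x) \<le> (\<Sum>i\<in>{a..<a + int (Suc k)}. E i x)" for a k x
  proof -
    have "E_seg {1..L} kap lam w (s a) (s (a + int (Suc k) + 1)) (amp x) =
       (\<Sum>y\<in>{s a+1..s (a + int (Suc k) + 1)-2}. t1 x y) + kap * (\<Sum>y\<in>{s a+1..s (a + int (Suc k) + 1)-3}. t2 x y)"
      by (simp add: E_seg_def energy_def t1_def t2_def)
    also have "\<dots> \<le> (\<Sum>i\<in>{a..<a + int (Suc k)}. \<Sum>y\<in>{s i+1..s (i+2)-2}. t1 x y)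
       + kap * (\<Sum>i\<in>{a..<a + int (Suc k)}. \<Sum>y\<in>{s i+1..s (i+2)-3}. t2 x y)"
      unfolding s_def using kap tpos by (intro add_mono mult_left_mono sum_windows_ge[OF M j]) auto
    finally show ?thesis by (simp add: E_eq sum.distrib sum_distrib_left)
  qed
  have Ep_le: "Ep x \<le> (\<Sum>i\<in>{0..<M}. E i x)" for x
  proof -
    \<comment> \<open>The windows 0, ..., M - 1 extend one block past the seam, at least three
      sites, so they contain also the terms that wrap around the ring.\<close>
    have s1: "s (0 + int (Suc (nat M - 1)) + 1) \<ge> L + 3" "s 0 = 0"
      using bp(1)[of M] bp(4)[of 0] bp(5) M by (simp_all add: s_def L_def add.commute)
    have "Ep x \<le> E_seg {1..L} kap lam w (s 0) (s (0 + int (Suc (nat M - 1)) + 1)) (amp x)"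
      unfolding Ep_eq E_seg_def energy_def t1_def[symmetric] t2_def[symmetric]
      using kap tpos s1 by (intro add_mono mult_left_mono sum_mono2) auto
    also have "\<dots> \<le> (\<Sum>i\<in>{0..<0 + int (Suc (nat M - 1))}. E i x)" by (rule sum_E_ge)
    also have "0 + int (Suc (nat M - 1)) = M" using M by simp
    finally show ?thesis .
  qed
  define e where "e = g / Gam"
  have e0: "e > 0" using gpos Gpos by (simp add: e_def)
  have win: "e * (\<Sum>t\<in>{0..<int n}. inner (Q x (k + t)) (Q x (k + t)))
      \<le> inner (\<Sum>t\<in>{0..<int n}. Q x (k + t)) (\<Sum>t\<in>{0..<int n}. Q x (k + t))" if x: "x \<in> F" for x k
  proof -
    define A where "A = (\<lambda>x. \<Sum>t\<in>{0..<int n}. x - oproj (K (k + t)) x)"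
    note Aop = sum_minus_oproj_operator[where K = "\<lambda>t. K (k + t)" and I = "{0..<int n}", OF Kdim KF Fdim A_def]
    define b where "b = s (k + int n + 1)"
    have bk: "0 \<le> b - s k - 3 * (int n + 1)" "b - s k - 3 * (int n + 1) \<le> 2"
    \<comment> \<open>As n + 1 \<le> M, the run stays within one period of the ring and collects at
      most j \<le> 2 extra sites; this is where the lengths 3 (n + 1) + r come from.\<close>
    proof -
      have "k \<le> k + int n + 1" "k + int n + 1 \<le> k + M" using Mn n by linarith+
      from this[THEN block_extra_mono[OF M j]]
      show "0 \<le> b - s k - 3 * (int n + 1)" "b - s k - 3 * (int n + 1) \<le> 2"
        using block_extra_period[OF M j, of k] j by (auto simp: b_def s_def block_pos_def)
    qed
    have bL: "b - s k \<le> L" using bk Mn n M j by (simp add: L_def)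
    have gb: "g \<le> gap_open kap lam (b - s k)"
      using g[of "b - s k - 3 * (int n + 1)"] bk by simp
    have "e * inner x (A x) \<le> inner (A x) (A x)"
    proof (rule square_bound_from_gap[OF Fdim Aop(1-3) _ _ _ x])
      show "inner y (A y) \<ge> 0" for y unfolding Aop(4) by (simp add: sum_nonneg)
      show "0 \<le> e" using e0 by simp
      fix z assume z: "z \<in> F" and orth: "\<And>v. v \<in> F \<Longrightarrow> A v = 0 \<Longrightarrow> inner z v = 0"
      \<comment> \<open>Ground states of the long segment are ground states of each of its windows,
        so orthogonality to the kernel of \<open>A\<close> includes orthogonality to them.\<close>
      have zb: "inner z v = 0" if v: "v \<in> KV {1..L} (H_seg kap lam w (s k) b)" for v
      proof (rule orth)
        note vb = v[unfolded KV_seg_iff[OF kap winj[OF bL] wimg]]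
        show "v \<in> F" using vb by (simp add: F_def)
        have "v \<in> K (k + t)" if "t \<in> {0..<int n}" for t
        proof -
          have "s k \<le> s (k + t)" "s (k + t + 2) \<le> b"
            unfolding s_def b_def using that by (auto intro!: bp(3))
          then have "{s (k + t) + 1..s (k + t + 2) - 2} \<subseteq> {s k + 1..b - 2}"
            "{s (k + t) + 1..s (k + t + 2) - 3} \<subseteq> {s k + 1..b - 3}" by auto
          then show ?thesis unfolding K_def KV_seg_iff[OF kap winj2 wimg] using vb by blast
        qed
        then show "A v = 0" unfolding A_def using oproj_ident[OF Kdim] by simp
      qed
      have "g * inner z z \<le> gap_open kap lam (b - s k) * inner z z"
        using gb by (intro mult_right_mono) auto
      also have "\<dots> \<le> E_seg {1..L} kap lam w (s k) b (amp z)"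
        by (rule seg_gap[OF kap winj[OF bL] wimg]) (use z zb in \<open>auto simp: F_def\<close>)
      also have "\<dots> \<le> (\<Sum>i\<in>{k..<k + int n}. E i z)"
        using sum_E_ge[of k "n - 1" z] n by (simp add: b_def of_nat_diff)
      also have "\<dots> = (\<Sum>t\<in>{0..<int n}. E (k + t) z)"
        by (rule sum.reindex_bij_witness[of _ "\<lambda>t. k + t" "\<lambda>i. i - k"]) auto
      also have "\<dots> \<le> (\<Sum>t\<in>{0..<int n}. Gam * inner (Q z (k + t)) (Q z (k + t)))"
        using E_up[OF z] by (rule sum_mono)
      also have "\<dots> = Gam * inner z (A z)" by (simp add: Aop(4) Q_def sum_distrib_left)
      finally show "e * inner z z \<le> inner z (A z)" using Gpos by (simp add: e_def field_simps)
    qed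
    then show ?thesis by (simp add: Aop(4) Q_def) (simp add: A_def)
  qed
  define A where "A = (\<lambda>x. \<Sum>i\<in>{0..<M}. x - oproj (K i) x)"
  note Aop = sum_minus_oproj_operator[where K = K and I = "{0..<M}", OF Kdim KF Fdim A_def]
  \<comment> \<open>The gap of the sum of all complements; with \<open>e = g / Gam\<close> it equals
    n / (Gam (n - 1)) times (g - Gam / n).\<close>
  define c where "c = (real n * e - 1) / (real n - 1)"
  have nn: "real n > 1" using n by simp
  have "real n * e > 1" using gG Gpos nn by (simp add: e_def field_simps)
  then have cpos: "c > 0" using nn by (simp add: c_def)
  have sq: "c * inner x (A x) \<le> inner (A x) (A x)" if x: "x \<in> F" for x
  proof -
    have "(real_of_int (int n) * e - 1) * (\<Sum>i\<in>{0..<M}. inner (Q x i) (Q x i))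
      \<le> real_of_int (int n - 1) * inner (\<Sum>i\<in>{0..<M}. Q x i) (\<Sum>i\<in>{0..<M}. Q x i)"
    proof (rule knabe_square_bound[where Q = "Q x" and x = x and K = K, OF _ Mn Kdim Kper Q_def _ win[OF x]])
      show "2 \<le> int n" using n by simp
      fix i d assume d: "2 \<le> d" "d \<le> M - 2"
      \<comment> \<open>The second window begins after the first ends and ends before the first
        recurs on the ring, so the labels fit into one injective period.\<close>
      have d1: "s (i + 2) \<le> s (i + d)" "s (i + d + 2) \<le> s i + L" "s i \<le> s (i + 2)" "s (i + d) \<le> s (i + d + 2)"
        using d bp(3)[of "i + 2" "i + d"] bp(3)[of "i + d + 2" "i + M"] bp(4)[of i] bp(3)[of i "i + 2"] bp(3)[of "i + d" "i + d + 2"]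
        by (auto simp: s_def L_def)
      have "w ` {s i + 1..s (i + 2)} \<inter> w ` {s (i + d) + 1..s (i + d + 2)} = w ` ({s i + 1..s (i + 2)} \<inter> {s (i + d) + 1..s (i + d + 2)})"
        by (rule inj_on_image_Int[OF winj[of "s i + L" "s i"], symmetric]) (use d1 in auto)
      also have "\<dots> = {}" using d1 by auto
      finally have "term_sites w {s i + 1..s (i + 2) - 2} {s i + 1..s (i + 2) - 3} \<inter>
          term_sites w {s (i + d) + 1..s (i + d + 2) - 2} {s (i + d) + 1..s (i + d + 2) - 3} = {}"
        using term_sites_interval[of w "s i" "s (i + 2)"] term_sites_interval[of w "s (i + d)" "s (i + d + 2)"] by blast
      then show "oproj (K i) (oproj (K (i + d)) x) = oproj (K (i + d)) (oproj (K i) x)"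
        unfolding K_def H_seg_def by (intro H_terms_projections_commute ts) (use x in \<open>auto simp: F_def\<close>)
    qed
    then have "(real n * e - 1) * inner x (A x) \<le> (real n - 1) * inner (A x) (A x)"
      by (simp add: Aop(4) Q_def) (simp add: A_def)
    then show ?thesis using nn by (simp add: c_def field_simps)
  qed
  have w13: "w 1 = 1" "w 3 = 3" using L by (simp_all add: w_def wrap_def)
  have "gam / 2 * c \<le> op_gap {1..L} (H_terms kap lam w {1..L} {1..L})"
  proof (rule op_gap_greatest_H_terms[OF kap _ _ ts])
    show "1 \<in> {1..L}" "3 \<le> L" using L by auto
    fix x assume x: "x \<in> FV {1..L}" and orth: "\<And>y. y \<in> KV {1..L} (H_terms kap lam w {1..L} {1..L}) \<Longrightarrow> inner x y = 0"
    have xF: "x \<in> F" using x by (simp add: F_def)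
    have "c * inner x x \<le> inner x (A x)"
    proof (rule gap_from_square_bound[OF Fdim Aop(1-3) _ cpos sq xF])
      show "inner y (A y) \<ge> 0" for y unfolding Aop(4) by (simp add: sum_nonneg)
      \<comment> \<open>A zero of \<open>A\<close> has zero energy in every window. The windows
        cover all terms, so it is a ground state of the ring.\<close>
      fix v assume v: "v \<in> F" "A v = 0"
      then have "(\<Sum>i\<in>{0..<M}. inner (Q v i) (Q v i)) = 0" using Aop(4)[of v] by (simp add: Q_def)
      then have "\<forall>i\<in>{0..<M}. Q v i = 0" by (subst (asm) sum_nonneg_eq_0_iff) auto
      then have "E i v \<le> 0" if "i \<in> {0..<M}" for i using E_up[OF v(1), of i] that by simp
      then have "Ep v \<le> 0" using Ep_le[of v] sum_nonpos[of "{0..<M}" "\<lambda>i. E i v"] by simp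
      then have "Ep v = 0" using energy_nonneg[of kap "{1..L}" lam w] kap by (simp add: Ep_def antisym)
      then have "v \<in> KV {1..L} (H_terms kap lam w {1..L} {1..L})"
        using v(1) energy_eq_0_iff[of "{1..L}" kap "{1..L}" "{1..L}" "amp v" lam w] kap
        by (subst KV_H_terms_iff) (auto simp: ts F_def FV_def Ep_def)
      then show "inner x v = 0" by (rule orth)
    qed
    then have "gam * (c * inner x x) \<le> gam * inner x (A x)" using gam by (intro mult_left_mono) auto
    also have "\<dots> = (\<Sum>i\<in>{0..<M}. gam * inner (Q x i) (Q x i))" by (simp add: Aop(4) Q_def sum_distrib_left)
    also have "\<dots> \<le> (\<Sum>i\<in>{0..<M}. E i x)" using E_low[OF xF] by (rule sum_mono)
    also have "\<dots> \<le> 2 * Ep x" by (rule sum_E_le)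
    finally show "gam / 2 * c * inner x x \<le> energy {1..L} kap lam w {1..L} {1..L} (amp x)" by (simp add: Ep_def)
  qed (auto simp: w13)
  moreover have "gam * real n / (2 * Gam * (real n - 1)) * (g - Gam / real n) = gam / 2 * c"
    using Gpos nn by (simp add: c_def e_def field_simps)
  ultimately show ?thesis unfolding gap_per_def H_per_eq by (simp only: w_def L_def)
qed

text \<open>The residue modulo 6 decides between an even and an odd number of blocks, with at most
  two extra sites. From \<open>n < N\<close> and \<open>n \<ge> 2\<close> follow both M \<ge> 2 n
  and M \<ge> 6.\<close>

lemma ring_gap_all:
  fixes kap :: real and lam :: complex and n N :: nat and r :: int
  assumes kap: "kap > 0" and n: "n \<ge> 2" and N: "n < N" and r: "0 \<le> r" "r \<le> 5"
    and gam: "gam \<le> gap_open kap lam 6" "gam \<le> gap_open kap lam 7" "gam \<ge> 0"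
    and Gam: "norm_open kap lam 6 \<le> Gam" "norm_open kap lam 7 \<le> Gam"
    and g: "\<And>r. 0 \<le> r \<Longrightarrow> r \<le> 5 \<Longrightarrow> g \<le> gap_open kap lam (3 * (int n + 1) + r)" and gG: "g > Gam / real n"
  shows "gam * real n / (2 * Gam * (real n - 1)) * (g - Gam / real n) \<le> gap_per kap lam (6 * int N + r)"
proof (cases "r \<le> 2")
  case True
  then show ?thesis
    using ring_gap[OF kap _ _ _ n _ gam Gam g gG, of "2 * int N" r] n N r by simp
next
  case False
  have "6 * int N + r = 3 * (2 * int N + 1) + (r - 3)" by simp
  then show ?thesis
    using ring_gap[OF kap _ _ _ n _ gam Gam g gG, of "2 * int N + 1" "r - 3"] n N r False by simp
qed

section \<open>Ground states of an open chain\<close>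

text \<open>The Jordan--Wigner signs cancel in the open chain: a state is annihilated by all terms on
  \<open>{a..b}\<close> iff it vanishes on configurations with two particles at distance two and amplitudes
  are multiplied by \<open>lam\<close> when a pair at distance three moves inwards.\<close>

definition ground :: "complex \<Rightarrow> int \<Rightarrow> int \<Rightarrow> fstate \<Rightarrow> bool" where
  "ground lam a b psi \<longleftrightarrow>
    (\<forall>x S. a \<le> x \<and> x + 2 \<le> b \<and> x \<in> S \<and> x + 2 \<in> S \<longrightarrow> psi S = 0) \<and>
    (\<forall>x T. a \<le> x \<and> x + 3 \<le> b \<and> T \<inter> {x..x+3} = {} \<longrightarrow> psi (T \<union> {x+1, x+2}) = lam * psi (T \<union> {x, x+3}))"

lemma ground_distance_two:
  "ground lam a b psi \<Longrightarrow> x \<in> S \<Longrightarrow> y \<in> S \<Longrightarrow> a \<le> x \<Longrightarrow> y \<le> b \<Longrightarrow> y = x + 2 \<Longrightarrow> psi S = 0"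
  unfolding ground_def by blast

lemma ground_move:
  "ground lam a b psi \<Longrightarrow> a \<le> x \<Longrightarrow> x + 3 \<le> b \<Longrightarrow> T \<inter> {x..x+3} = {} \<Longrightarrow> psi (T \<union> {x+1, x+2}) = lam * psi (T \<union> {x, x+3})"
  unfolding ground_def by blast

text \<open>No particle of \<open>T\<close> lies on the four sites, so their Jordan-Wigner signs
  agree and both pair annihilations produce the same sign -1.\<close>

lemma qop_disjoint:
  assumes "finite T" "T \<inter> {x..x+3} = {}"
  shows "qop lam id x psi T = lam * psi (T \<union> {x, x+3}) - psi (T \<union> {x+1, x+2})"
proof -
  have n: "x \<notin> T" "x+1 \<notin> T" "x+2 \<notin> T" "x+3 \<notin> T" using assms(2) by auto
  have "{y\<in>T. y < x+1} = {y\<in>T. y < x}" "{y\<in>T. y < x+2} = {y\<in>T. y < x}" "{y\<in>T. y < x+3} = {y\<in>T. y < x}"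
  proof -
    have "y < x+3 \<longleftrightarrow> y < x" if "y \<in> T" for y
    proof -
      have "y \<noteq> x" "y \<noteq> x+1" "y \<noteq> x+2" using that n by auto
      then show ?thesis by linarith
    qed
    then show "{y\<in>T. y < x+1} = {y\<in>T. y < x}" "{y\<in>T. y < x+2} = {y\<in>T. y < x}" "{y\<in>T. y < x+3} = {y\<in>T. y < x}"
      by force+
  qed
  then have jw: "jw_sign T (x+1) = jw_sign T x" "jw_sign T (x+2) = jw_sign T x" "jw_sign T (x+3) = jw_sign T x"
    unfolding jw_sign_def by simp_all
  have 1: "ann (x+1) (ann (x+2) psi) T = - psi (T \<union> {x+1, x+2})"
    using n assms(1) jw
    by (simp add: ann_def jw_sign_insert_other mult.assoc[symmetric] jw_sign_sq insert_commute)
  have 2: "ann x (ann (x+3) psi) T = - psi (T \<union> {x, x+3})"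
    using n assms(1) jw
    by (simp add: ann_def jw_sign_insert_other mult.assoc[symmetric] jw_sign_sq insert_commute)
  show ?thesis unfolding qop_def using 1 2 by simp
qed

text \<open>A particle of \<open>T\<close> on one of the four sites blocks one of the two pair
  annihilations and, in the other, stands at distance two from a particle of the pair.\<close>

lemma qop_overlapping:
  assumes psi: "\<And>S z. z \<in> {x, x+1} \<Longrightarrow> z \<in> S \<Longrightarrow> z + 2 \<in> S \<Longrightarrow> psi S = 0" and T: "T \<inter> {x..x+3} \<noteq> {}"
  shows "qop lam id x psi T = 0"
proof -
  have c: "x \<in> T \<or> x+1 \<in> T \<or> x+2 \<in> T \<or> x+3 \<in> T"
  proof -
    obtain z where "z \<in> T" "x \<le> z" "z \<le> x+3" using T by auto
    then have "z = x \<or> z = x+1 \<or> z = x+2 \<or> z = x+3" by auto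
    then show ?thesis using \<open>z \<in> T\<close> by auto
  qed
  have p: "psi S = 0" if "x \<in> S \<and> x+2 \<in> S \<or> x+1 \<in> S \<and> x+3 \<in> S" for S
    using that psi[of x S] psi[of "x+1" S] by (auto simp: add.assoc)
  have "ann (x+1) (ann (x+2) psi) T = 0"
    using c by (auto simp: ann_def intro!: p)
  moreover have "ann x (ann (x+3) psi) T = 0"
    using c by (auto simp: ann_def intro!: p)
  ultimately show ?thesis by (simp add: qop_def)
qed

lemma kernel_iff_ground:
  assumes psi: "psi \<in> fock {1..L}"
  shows "(\<forall>x\<in>{a..b-2}. nn_term id x psi = (\<lambda>_. 0)) \<and> (\<forall>x\<in>{a..b-3}. qop lam id x psi = (\<lambda>_. 0))
    \<longleftrightarrow> ground lam a b psi" (is "?N \<and> ?Q \<longleftrightarrow> _")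
proof
  assume *: "?N \<and> ?Q"
  show "ground lam a b psi" unfolding ground_def
  proof (intro conjI allI impI; elim conjE)
    fix x S assume x: "a \<le> x" "x + 2 \<le> b" "x \<in> S" "x + 2 \<in> S"
    have "nn_term id x psi S = 0" using * x by simp
    then show "psi S = 0" using x by (simp add: nn_term_eq)
  next
    fix x T assume x: "a \<le> x" "x + 3 \<le> b" "T \<inter> {x..x + 3} = {}"
    show "psi (T \<union> {x + 1, x + 2}) = lam * psi (T \<union> {x, x + 3})"
    proof (cases "finite T")
      case True
      have "qop lam id x psi T = 0" using * x by simp
      then show ?thesis using qop_disjoint[OF True x(3), of lam psi] by simp
    next
      case False
      then have "\<not> T \<union> {x + 1, x + 2} \<subseteq> {1..L}" "\<not> T \<union> {x, x + 3} \<subseteq> {1..L}"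
        by (meson finite_Un finite_atLeastAtMost_int finite_subset)+
      then show ?thesis using psi by (simp add: fock_def)
    qed
  qed
next
  assume g: "ground lam a b psi"
  have ?N
  proof
    fix x assume x: "x \<in> {a..b-2}"
    have "psi S = 0" if "x \<in> S \<and> x + 2 \<in> S" for S
      by (rule ground_distance_two[OF g, of x _ "x+2"]) (use x that in auto)
    then show "nn_term id x psi = (\<lambda>_. 0)" by (simp add: nn_term_eq fun_eq_iff)
  qed
  moreover have ?Q
  proof (intro ballI ext)
    fix x T assume x: "x \<in> {a..b-3}"
    have ov: "psi S = 0" if "z \<in> {x, x+1}" "z \<in> S" "z + 2 \<in> S" for S z
      using ground_distance_two[OF g, of z S "z+2"] x that by auto
    show "qop lam id x psi T = 0"
    proof (cases "T \<inter> {x..x+3} = {}")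
      case True
      show ?thesis
      proof (cases "finite T")
        case fT: True
        then show ?thesis using qop_disjoint[OF fT True] ground_move[OF g _ _ True] x by simp
      next
        case False
        then have "\<not> insert u (insert v T) \<subseteq> {1..L}" for u v
          by (meson finite_insert finite_atLeastAtMost_int finite_subset)
        then show ?thesis using psi by (simp add: fock_def qop_def ann_def)
      qed
    next
      case False
      show ?thesis by (rule qop_overlapping[OF ov False])
    qed
  qed
  ultimately show "?N \<and> ?Q" ..
qed

subsection \<open>Configurations excluded from ground states\<close>

context
  fixes lam :: complex and a b :: int and psi :: fstate
  assumes lam: "lam \<noteq> 0" and g: "ground lam a b psi"
begin

text \<open>Moving the particles at \<open>z\<close> and \<open>z+3\<close> inwards puts one at
  \<open>z+2\<close>, at distance two from \<open>z+4\<close>. The amplitude of \<open>S\<close>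
  times \<open>lam\<close> is thus zero, and \<open>lam\<close> is nonzero.\<close>

lemma ground_10011:
  assumes "a \<le> z" "z + 4 \<le> b" "{z, z+3, z+4} \<subseteq> S"
  shows "psi S = 0"
proof (cases "z+1 \<in> S \<or> z+2 \<in> S")
  case True
  show ?thesis using True
  proof
    assume "z+1 \<in> S"
    show ?thesis by (rule ground_distance_two[OF g, of "z+1" S "z+3"]) (use assms \<open>z+1 \<in> S\<close> in auto)
  next
    assume "z+2 \<in> S"
    show ?thesis by (rule ground_distance_two[OF g, of "z" S "z+2"]) (use assms \<open>z+2 \<in> S\<close> in auto)
  qed
next
  case False
  let ?T = "S - {z, z+3}"
  have T: "?T \<inter> {z..z+3} = {}"
  proof -
    have "u = z \<or> u = z+1 \<or> u = z+2 \<or> u = z+3" if "u \<in> {z..z+3}" for u using that by auto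
    then show ?thesis using False by blast
  qed
  have "psi (?T \<union> {z+1, z+2}) = 0"
    by (rule ground_distance_two[OF g, of "z+2" _ "z+4"]) (use assms in auto)
  moreover have "?T \<union> {z, z+3} = S" using assms by auto
  ultimately show ?thesis using ground_move[OF g, of z ?T] T assms lam by simp
qed

text \<open>The mirror image of \<open>ground_10011\<close>: moving \<open>z+1\<close> and
  \<open>z+4\<close> inwards creates a particle at distance two from \<open>z\<close>.\<close>

lemma ground_11001:
  assumes "a \<le> z" "z + 4 \<le> b" "{z, z+1, z+4} \<subseteq> S"
  shows "psi S = 0"
proof (cases "z+2 \<in> S \<or> z+3 \<in> S")
  case True
  show ?thesis using True
  proof
    assume "z+2 \<in> S"
    show ?thesis by (rule ground_distance_two[OF g, of "z" S "z+2"]) (use assms \<open>z+2 \<in> S\<close> in auto)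
  next
    assume "z+3 \<in> S"
    show ?thesis by (rule ground_distance_two[OF g, of "z+1" S "z+3"]) (use assms \<open>z+3 \<in> S\<close> in auto)
  qed
next
  case False
  let ?T = "S - {z+1, z+4}"
  have T: "?T \<inter> {z+1..z+1+3} = {}"
  proof -
    have "u = z+4 \<or> u = z+1 \<or> u = z+2 \<or> u = z+3" if "u \<in> {z+1..z+1+3}" for u using that by auto
    then show ?thesis using False by blast
  qed
  have "psi (?T \<union> {z+1+1, z+1+2}) = 0"
    by (rule ground_distance_two[OF g, of z _ "z+2"]) (use assms in auto)
  moreover have "?T \<union> {z+1, z+1+3} = S" using assms by (auto simp: add.commute)
  ultimately show ?thesis using ground_move[OF g, of "z+1" ?T] T assms lam by simp
qed

text \<open>Spreading the right pair outwards leads to the excluded pattern 11001. This needs the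
  site \<open>z + 7\<close>; the next lemma spreads the left pair and needs \<open>z - 1\<close>
  instead. Which one applies depends on the room at the ends of the interval.\<close>

lemma ground_two_pairs_right:
  assumes "a \<le> z" "z + 7 \<le> b" "{z, z+1, z+5, z+6} \<subseteq> S"
  shows "psi S = 0"
proof (cases "z+4 \<in> S \<or> z+7 \<in> S")
  case True
  show ?thesis using True
  proof
    assume "z+4 \<in> S"
    show ?thesis by (rule ground_distance_two[OF g, of "z+4" S "z+6"]) (use assms \<open>z+4 \<in> S\<close> in auto)
  next
    assume "z+7 \<in> S"
    show ?thesis by (rule ground_distance_two[OF g, of "z+5" S "z+7"]) (use assms \<open>z+7 \<in> S\<close> in auto)
  qed
next
  case False
  let ?T = "S - {z+5, z+6}"
  have T: "?T \<inter> {z+4..z+4+3} = {}"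
  proof -
    have "u = z+4 \<or> u = z+5 \<or> u = z+6 \<or> u = z+7" if "u \<in> {z+4..z+4+3}" for u using that by auto
    then show ?thesis using False by blast
  qed
  have "psi (?T \<union> {z+4, z+4+3}) = 0"
    by (rule ground_11001[of z]) (use assms in auto)
  moreover have "?T \<union> {z+4+1, z+4+2} = S" using assms by (auto simp: add.commute)
  ultimately show ?thesis using ground_move[OF g, of "z+4" ?T] T assms by simp
qed

lemma ground_two_pairs_left:
  assumes "a \<le> z - 1" "z + 6 \<le> b" "{z, z+1, z+5, z+6} \<subseteq> S"
  shows "psi S = 0"
proof (cases "z-1 \<in> S \<or> z+2 \<in> S")
  case True
  show ?thesis using True
  proof
    assume "z-1 \<in> S"
    show ?thesis by (rule ground_distance_two[OF g, of "z-1" S "z+1"]) (use assms \<open>z-1 \<in> S\<close> in auto)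
  next
    assume "z+2 \<in> S"
    show ?thesis by (rule ground_distance_two[OF g, of "z" S "z+2"]) (use assms \<open>z+2 \<in> S\<close> in auto)
  qed
next
  case False
  let ?T = "S - {z, z+1}"
  have T: "?T \<inter> {z-1..z-1+3} = {}"
  proof -
    have "u = z-1 \<or> u = z \<or> u = z+1 \<or> u = z+2" if "u \<in> {z-1..z-1+3}" for u using that by auto
    then show ?thesis using False by blast
  qed
  have "psi (?T \<union> {z-1, z-1+3}) = 0"
    by (rule ground_10011[of "z+2"]) (use assms in \<open>auto simp: add.commute\<close>)
  moreover have "?T \<union> {z-1+1, z-1+2} = S"
  proof -
    have "z-1+1 = z" "z-1+2 = z+1" by simp_all
    moreover have "?T \<union> {z, z+1} = S" using assms by auto
    ultimately show ?thesis by (simp only:)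
  qed
  ultimately show ?thesis using ground_move[OF g, of "z-1" ?T] T assms by simp
qed

end

section \<open>Monomer-dimer chains\<close>

text \<open>A tiling lists monomers (\<open>False\<close>) and dimers (\<open>True\<close>) from right to left. A monomer with right
  end \<open>y\<close> occupies \<open>y\<close>; a dimer with right end \<open>y\<close> replaces two monomers and occupies \<open>y - 2\<close> and
  \<open>y - 1\<close>.\<close>

fun tsize :: "bool list \<Rightarrow> nat" where
  "tsize [] = 0" | "tsize (d # t) = (if d then 2 else 1) + tsize t"

fun conf :: "int \<Rightarrow> bool list \<Rightarrow> int set" where
  "conf y [] = {}"
| "conf y (False # t) = insert y (conf (y - 3) t)"
| "conf y (True # t) = {y - 2, y - 1} \<union> conf (y - 6) t"

definition dimers :: "bool list \<Rightarrow> nat" where "dimers t = length (filter id t)"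

definition tilings :: "nat \<Rightarrow> bool list set" where "tilings k = {t. tsize t = k}"

lemma dimers_simps [simp]: "dimers [] = 0" "dimers (False # t) = dimers t" "dimers (True # t) = Suc (dimers t)"
  by (auto simp: dimers_def)

lemma tilings_0: "tilings 0 = {[]}"
proof -
  have "tsize t = 0 \<longleftrightarrow> t = []" for t by (cases t) auto
  then show ?thesis by (auto simp: tilings_def)
qed

lemma tilings_Suc_0: "tilings (Suc 0) = {[False]}"
proof -
  have "tsize t = Suc 0 \<longleftrightarrow> t = [False]" for t
  proof (cases t)
    case (Cons d u) then show ?thesis using tilings_0 by (cases d) (auto simp: tilings_def)
  qed auto
  then show ?thesis by (auto simp: tilings_def)
qed

lemma tilings_Suc_Suc:
  "tilings (Suc (Suc k)) = Cons False ` tilings (Suc k) \<union> Cons True ` tilings k"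
proof -
  have "t \<in> tilings (Suc (Suc k)) \<longleftrightarrow> t \<in> Cons False ` tilings (Suc k) \<union> Cons True ` tilings k" for t
  proof (cases t)
    case (Cons d u) then show ?thesis by (cases d) (auto simp: tilings_def)
  qed (auto simp: tilings_def)
  then show ?thesis by blast
qed

lemma finite_tilings: "finite (tilings k)"
  by (induction k rule: induct_nat_012) (auto simp: tilings_0 tilings_Suc_0 tilings_Suc_Suc)

lemma sum_tilings_Suc_Suc:
  fixes f :: "bool list \<Rightarrow> 'a::comm_monoid_add"
  shows "(\<Sum>t\<in>tilings (Suc (Suc k)). f t) = (\<Sum>t\<in>tilings (Suc k). f (False # t)) + (\<Sum>t\<in>tilings k. f (True # t))"
  unfolding tilings_Suc_Suc
  by (subst sum.union_disjoint) (auto simp: finite_tilings sum.reindex)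

text \<open>Either the tiling has a cut after its third cell from the right, or a dimer covers cells
  three and four. Within each group a ground state of the last nine sites is known up to one
  amplitude per remainder \<open>u\<close>.\<close>

lemma sum_tilings_4:
  fixes f :: "bool list \<Rightarrow> 'a::comm_monoid_add"
  shows "(\<Sum>t\<in>tilings (j + 4). f t) =
    (\<Sum>u\<in>tilings (j + 1). f (False # False # False # u) + f (True # False # u) + f (False # True # u))
    + (\<Sum>u\<in>tilings j. f (False # False # True # u) + f (True # True # u))"
proof -
  have n: "j + 4 = Suc (Suc (Suc (Suc j)))" "j + 1 = Suc j" by simp_all
  show ?thesis unfolding n by (simp add: sum_tilings_Suc_Suc sum.distrib ac_simps)
qed

text \<open>The two leftmost of the 3 k sites of a chain stay empty; they separate it from what lies
  further left.\<close>

lemma conf_range: "conf y t \<subseteq> {y - 3 * int (tsize t) + 3..y}"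
proof (induction y t rule: conf.induct)
  case (2 y t) then show ?case by force
next
  case (3 y t) then show ?case by force
qed simp

lemma conf_append: "conf y (t @ u) = conf y t \<union> conf (y - 3 * int (tsize t)) u"
  by (induction y t rule: conf.induct) (auto simp: algebra_simps)

lemma tsize_append: "tsize (t @ u) = tsize t + tsize u"
  by (induction t) auto

lemma conf_distance_two: "z \<in> conf y t \<Longrightarrow> z + 2 \<notin> conf y t"
proof (induction y t arbitrary: z rule: conf.induct)
  case (2 y t) then show ?case using conf_range[of "y - 3" t] by force
next
  case (3 y t) then show ?case using conf_range[of "y - 6" t] by force
qed simp

lemma ground_conf_move:
  assumes g: "ground lam a b psi" "a \<le> y - 3" "y \<le> b" and A: "A \<inter> {y-3..y} = {}"
  shows "psi (A \<union> conf y (True # t)) = lam * psi (A \<union> conf y (False # False # t))"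
proof -
  let ?T = "A \<union> conf (y - 6) t"
  have T: "?T \<inter> {y-3..y-3+3} = {}" using A conf_range[of "y - 6" t] by force
  have "A \<union> conf y (True # t) = ?T \<union> {y-3+1, y-3+2}" "A \<union> conf y (False # False # t) = ?T \<union> {y-3, y-3+3}"
    by auto
  then show ?thesis using ground_move[OF g(1), of "y-3" ?T] g T by simp
qed

text \<open>Each dimer is two neighbouring monomers moved inwards, so the all-monomer amplitude
  determines those of all tilings of the run.\<close>

lemma ground_chain:
  assumes g: "ground lam a b psi" "a \<le> y - 3 * int (tsize t) + 3" "y \<le> b" "A \<inter> {y - 3 * int (tsize t) + 1..y} = {}"
  shows "psi (A \<union> conf y t) = lam ^ dimers t * psi (A \<union> conf y (replicate (tsize t) False))"
  using assms(2-)
proof (induction y t arbitrary: A rule: conf.induct)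
  case (2 y t)
  have "insert y A \<inter> {y - 3 - 3 * int (tsize t) + 1..y - 3} = {}" using 2 by auto
  then show ?case using "2.IH"[of "insert y A"] "2.prems" by simp
next
  case (3 y t)
  have "(A \<union> {y - 3, y}) \<inter> {y - 6 - 3 * int (tsize t) + 1..y - 6} = {}" using 3 by auto
  then have "psi (A \<union> {y - 3, y} \<union> conf (y - 6) t)
      = lam ^ dimers t * psi (A \<union> {y - 3, y} \<union> conf (y - 6) (replicate (tsize t) False))"
    using "3.IH"[of "A \<union> {y - 3, y}"] "3.prems" by simp
  moreover have "psi (A \<union> conf y (True # t)) = lam * psi (A \<union> conf y (False # False # t))"
    by (rule ground_conf_move[OF g(1)]) (use "3.prems" in auto)
  moreover have "A \<union> conf y (False # False # t) = A \<union> {y - 3, y} \<union> conf (y - 6) t" by auto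
  moreover have "A \<union> conf y (replicate (tsize (True # t)) False) = A \<union> {y - 3, y} \<union> conf (y - 6) (replicate (tsize t) False)"
    by (auto simp: numeral_2_eq_2)
  ultimately show ?case by simp
qed simp

text \<open>The chain ground state as a function of the configuration rather than of the tiling, so
  that it can be glued to other amplitudes and tested against moves at arbitrary places.\<close>

definition chain_wt :: "complex \<Rightarrow> nat \<Rightarrow> int \<Rightarrow> int set \<Rightarrow> complex" where
  "chain_wt lam k y c = (\<Sum>t\<in>tilings k. if conf y t = c then lam ^ dimers t else 0)"

lemma chain_wt_support:
  assumes "chain_wt lam k y c \<noteq> 0"
  obtains t where "t \<in> tilings k" "conf y t = c"
proof -
  have "\<exists>t\<in>tilings k. conf y t = c"
  proof (rule ccontr)
    assume "\<not> (\<exists>t\<in>tilings k. conf y t = c)"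
    then have "chain_wt lam k y c = 0" unfolding chain_wt_def by (intro sum.neutral) auto
    then show False using assms by simp
  qed
  then show ?thesis using that by blast
qed

lemma chain_wt_eq_0: "z \<in> c \<Longrightarrow> z > y \<Longrightarrow> chain_wt lam k y c = 0"
proof (rule ccontr)
  assume "z \<in> c" "z > y" "chain_wt lam k y c \<noteq> 0"
  then obtain t where "conf y t = c" using chain_wt_support by metis
  then show False using conf_range[of y t] \<open>z \<in> c\<close> \<open>z > y\<close> by auto
qed

lemma chain_wt_0: "chain_wt lam 0 y c = (if c = {} then 1 else 0)"
  by (auto simp: chain_wt_def tilings_0)

lemma chain_wt_1: "chain_wt lam (Suc 0) y c = (if c = {y} then 1 else 0)"
  by (auto simp: chain_wt_def tilings_Suc_0)

lemma chain_wt_Suc_Suc: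
  "chain_wt lam (Suc (Suc k)) y c = (if y \<in> c then chain_wt lam (Suc k) (y - 3) (c - {y}) else 0)
    + (if y - 2 \<in> c \<and> y - 1 \<in> c then lam * chain_wt lam k (y - 6) (c - {y - 2, y - 1}) else 0)"
proof -
  have 1: "conf y (False # t) = c \<longleftrightarrow> y \<in> c \<and> conf (y - 3) t = c - {y}" for t
    using conf_range[of "y - 3" t] by auto
  have 2: "conf y (True # t) = c \<longleftrightarrow> (y - 2 \<in> c \<and> y - 1 \<in> c) \<and> conf (y - 6) t = c - {y - 2, y - 1}" for t
  proof -
    have "y - 2 \<notin> conf (y - 6) t" "y - 1 \<notin> conf (y - 6) t" using conf_range[of "y - 6" t] by auto
    then show ?thesis by auto
  qed
  show ?thesis
    unfolding chain_wt_def sum_tilings_Suc_Suc 1 2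
    by (auto simp: sum_distrib_left if_distrib[of "\<lambda>u. lam * u"] cong: if_cong)
qed

lemma chain_wt_insert: "y \<notin> T \<Longrightarrow> chain_wt lam (Suc k) y (insert y T) = chain_wt lam k (y - 3) T"
proof (cases k)
  case 0
  assume "y \<notin> T"
  then show ?thesis by (auto simp: 0 chain_wt_0 chain_wt_1)
next
  case (Suc k')
  assume y: "y \<notin> T"
  have "chain_wt lam k' (y - 6) (insert y T - {y - 2, y - 1}) = 0" by (rule chain_wt_eq_0[of y]) auto
  then show ?thesis using y by (simp add: Suc chain_wt_Suc_Suc)
qed

text \<open>The relation is asked at every \<open>x\<close>, also across the ends of the chain,
  which is what makes gluing possible. Induction on the number of cells peels off the rightmost one;
  away from the right end the move commutes with this, and near it at most one position gives
  nonzero amplitudes.\<close>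

lemma chain_wt_move:
  "T \<inter> {x..x+3} = {} \<Longrightarrow> chain_wt lam k y (T \<union> {x+1, x+2}) = lam * chain_wt lam k y (T \<union> {x, x+3})"
proof (induction k arbitrary: T y rule: induct_nat_012)
  case 0 then show ?case by (simp add: chain_wt_0)
next
  case 1
  have "T \<union> {u, v} \<noteq> {y}" if "u \<noteq> v" for u v :: int
  proof
    assume "T \<union> {u, v} = {y}"
    then have "u \<in> {y}" "v \<in> {y}" by blast+
    then show False using that by simp
  qed
  then have "T \<union> {x+1, x+2} \<noteq> {y}" "T \<union> {x, x+3} \<noteq> {y}" by simp_all
  then show ?case by (simp only: chain_wt_1 if_False mult_zero_right)
next
  case (ge2 k)
  let ?U = "T \<union> {x+1, x+2}" and ?V = "T \<union> {x, x+3}"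
  have T: "x \<notin> T" "x+1 \<notin> T" "x+2 \<notin> T" "x+3 \<notin> T" using ge2.prems by auto
  consider "x + 3 < y - 2" | "x = y - 5" | "x = y - 4" | "x = y - 3" | "x = y - 2" | "x + 2 > y" by linarith
  then show ?case
  proof cases
    case 1
    have "?U - {y} = (T - {y}) \<union> {x+1, x+2}" "?V - {y} = (T - {y}) \<union> {x, x+3}"
      "?U - {y - 2, y - 1} = (T - {y - 2, y - 1}) \<union> {x+1, x+2}" "?V - {y - 2, y - 1} = (T - {y - 2, y - 1}) \<union> {x, x+3}"
      using 1 by auto
    moreover have "chain_wt lam (Suc k) (y - 3) ((T - {y}) \<union> {x+1, x+2}) = lam * chain_wt lam (Suc k) (y - 3) ((T - {y}) \<union> {x, x+3})"
      "chain_wt lam k (y - 6) ((T - {y - 2, y - 1}) \<union> {x+1, x+2}) = lam * chain_wt lam k (y - 6) ((T - {y - 2, y - 1}) \<union> {x, x+3})"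
      using ge2.prems by (intro ge2.IH; blast)+
    moreover have "y \<in> ?U \<longleftrightarrow> y \<in> T" "y \<in> ?V \<longleftrightarrow> y \<in> T" "y - 2 \<in> ?U \<longleftrightarrow> y - 2 \<in> T" "y - 2 \<in> ?V \<longleftrightarrow> y - 2 \<in> T"
      "y - 1 \<in> ?U \<longleftrightarrow> y - 1 \<in> T" "y - 1 \<in> ?V \<longleftrightarrow> y - 1 \<in> T" using 1 by auto
    ultimately show ?thesis unfolding chain_wt_Suc_Suc by (simp add: algebra_simps)
  next
    case 2
    have "chain_wt lam (Suc k) (y - 3) (?U - {y}) = 0"
    proof -
      have e: "?U - {y} = insert (y - 3) ((T - {y}) \<union> {y - 4})" using 2 by auto
      have "chain_wt lam k (y - 3 - 3) ((T - {y}) \<union> {y - 4}) = 0" by (rule chain_wt_eq_0[of "y - 4"]) auto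
      moreover have "y - 3 \<notin> (T - {y}) \<union> {y - 4}" using T 2 by auto
      ultimately show ?thesis
        unfolding e using chain_wt_insert[of "y - 3" "(T - {y}) \<union> {y - 4}" lam k] by simp
    qed
    moreover have "y - 2 \<notin> ?U" using T 2 by auto
    moreover have "chain_wt lam (Suc k) (y - 3) (?V - {y}) = 0" by (rule chain_wt_eq_0[of "y - 2"]) (use 2 in auto)
    moreover have "chain_wt lam k (y - 6) (?V - {y - 2, y - 1}) = 0" by (rule chain_wt_eq_0[of "y - 5"]) (use 2 in auto)
    ultimately show ?thesis unfolding chain_wt_Suc_Suc
      by (simp only: simp_thms if_cancel if_False mult_zero_right add_0_right)
  next
    case 3
    have "chain_wt lam (Suc k) (y - 3) (?U - {y}) = 0" by (rule chain_wt_eq_0[of "y - 2"]) (use 3 in auto)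
    moreover have "chain_wt lam (Suc k) (y - 3) (?V - {y}) = 0" by (rule chain_wt_eq_0[of "y - 1"]) (use 3 in auto)
    moreover have "y - 1 \<notin> ?U" "y - 2 \<notin> ?V" using T 3 by auto
    ultimately show ?thesis unfolding chain_wt_Suc_Suc
      by (simp only: simp_thms if_cancel if_False mult_zero_right add_0_right)
  next
    \<comment> \<open>The only genuine exchange at the right end: the last two monomers against the
      last dimer.\<close>
    case 4
    have "y \<notin> ?U" "y - 2 \<notin> ?V" using T 4 by auto
    moreover have "?U - {y - 2, y - 1} = T" "?V - {y} = insert (y - 3) T" using T 4 by auto
    moreover have "y - 3 \<notin> T" using T 4 by auto
    ultimately show ?thesis unfolding chain_wt_Suc_Suc using 4 by (simp add: chain_wt_insert)
  next
    case 5
    have "chain_wt lam (Suc (Suc k)) y ?V = 0" by (rule chain_wt_eq_0[of "y + 1"]) (use 5 in auto)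
    moreover have "chain_wt lam (Suc k) (y - 3) (?U - {y}) = 0" by (rule chain_wt_eq_0[of "y - 1"]) (use 5 in auto)
    moreover have "y - 2 \<notin> ?U" using T 5 by auto
    ultimately show ?thesis unfolding chain_wt_Suc_Suc[of lam k y ?U]
      by (simp only: simp_thms if_cancel if_False mult_zero_right add_0_right)
  next
    case 6
    have "chain_wt lam (Suc (Suc k)) y ?V = 0" by (rule chain_wt_eq_0[of "x + 3"]) (use 6 in auto)
    moreover have "chain_wt lam (Suc (Suc k)) y ?U = 0" by (rule chain_wt_eq_0[of "x + 2"]) (use 6 in auto)
    ultimately show ?thesis by simp
  qed
qed

lemma sum_chain_wt:
  assumes "finite I" "{y - 3 * int k + 3..y} \<subseteq> I"
  shows "(\<Sum>c\<in>Pow I. cnj (chain_wt lam k y c) * f c) = (\<Sum>t\<in>tilings k. cnj (lam ^ dimers t) * f (conf y t))"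
proof -
  have "(\<Sum>c\<in>Pow I. cnj (chain_wt lam k y c) * f c)
      = (\<Sum>c\<in>Pow I. \<Sum>t\<in>tilings k. if c = conf y t then cnj (lam ^ dimers t) * f (conf y t) else 0)"
    unfolding chain_wt_def cnj_sum sum_distrib_right by (intro sum.cong refl) auto
  also have "\<dots> = (\<Sum>t\<in>tilings k. \<Sum>c\<in>Pow I. if c = conf y t then cnj (lam ^ dimers t) * f (conf y t) else 0)"
    by (rule sum.swap)
  also have "\<dots> = (\<Sum>t\<in>tilings k. cnj (lam ^ dimers t) * f (conf y t))"
  proof (rule sum.cong[OF refl])
    fix t assume "t \<in> tilings k"
    then have "conf y t \<in> Pow I" using conf_range[of y t] assms(2) by (auto simp: tilings_def)
    then show "(\<Sum>c\<in>Pow I. if c = conf y t then cnj (lam ^ dimers t) * f (conf y t) else 0) = cnj (lam ^ dimers t) * f (conf y t)"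
      using assms(1) by simp
  qed
  finally show ?thesis .
qed

section \<open>Decomposition of configurations into chains\<close>

text \<open>Left backgrounds onto which a chain starting at \<open>p + 3\<close> cannot be extended. For \<open>p = 3\<close> the pair
  on the sites 1 and 2 is frozen by the left boundary, so it is not excluded.\<close>

definition backgrounds :: "int \<Rightarrow> int set set" where
  "backgrounds p = {A. A \<subseteq> {1..p-1} \<and> \<not> (p \<ge> 4 \<and> p - 2 \<in> A \<and> p - 1 \<in> A)}"

lemma finite_backgrounds: "finite (backgrounds p)"
  by (rule finite_subset[of _ "Pow {1..p-1}"]) (auto simp: backgrounds_def)

lemma Un_left_cancel_disjoint: "P \<union> X = P \<union> Y \<Longrightarrow> P \<inter> X = {} \<Longrightarrow> P \<inter> Y = {} \<Longrightarrow> X = Y"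
  by blast

text \<open>Reading from the right, a particle at the current end means a monomer, and a pair just
  before it a dimer; a background offers neither, so the reading stops at the same place for both.
  The bound -2 is where the last cells can lead: a monomer has its end at 1 or later, a dimer at 4
  or later.\<close>

lemma chain_parse_unique:
  assumes "A \<union> conf y t = A' \<union> conf y t'"
    "A \<in> backgrounds (y - 3 * int (tsize t))" "A' \<in> backgrounds (y - 3 * int (tsize t'))"
    "y - 3 * int (tsize t) \<ge> -2" "y - 3 * int (tsize t') \<ge> -2"
  shows "A = A' \<and> t = t'"
  using assms
proof (induction y t arbitrary: t' rule: conf.induct)
  case (1 y)
  have A: "A \<subseteq> {1..y-1}" "\<not> (y \<ge> 4 \<and> y - 2 \<in> A \<and> y - 1 \<in> A)" using 1 by (auto simp: backgrounds_def)
  show ?case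
  proof (cases t')
    case Nil then show ?thesis using 1 by simp
  next
    case (Cons d u)
    show ?thesis
    proof (cases d)
      case True
      then have "y - 2 \<in> A" "y - 1 \<in> A" "y \<ge> 4" using 1 Cons by auto
      then show ?thesis using A by blast
    next
      case False
      then have "y \<in> A" using 1 Cons by auto
      then show ?thesis using A by auto
    qed
  qed
next
  case (2 y t)
  have A: "A \<subseteq> {1..y-3*int (tsize t)-4}" using 2 by (auto simp: backgrounds_def)
  have yS: "y \<in> A' \<union> conf y t'" using "2.prems"(1) by auto
  show ?case
  proof (cases t')
    case Nil then show ?thesis using yS "2.prems" by (auto simp: backgrounds_def)
  next
    case (Cons d u)
    have A': "A' \<subseteq> {1..y-3*int (tsize t')-1}" using "2.prems" by (auto simp: backgrounds_def)
    then have yA': "y \<notin> A'" "y \<notin> A" using A by auto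
    show ?thesis
    proof (cases d)
      case True
      then show ?thesis using yS yA' Cons conf_range[of "y - 6" u] by auto
    next
      case False
      have "y \<notin> conf (y - 3) t" "y \<notin> conf (y - 3) u" using conf_range[of "y - 3"] by force+
      moreover have "insert y (A \<union> conf (y - 3) t) = insert y (A' \<union> conf (y - 3) u)"
        using "2.prems"(1) Cons False by auto
      ultimately have "A \<union> conf (y - 3) t = A' \<union> conf (y - 3) u" using yA' by (metis Un_iff insert_ident)
      then show ?thesis using "2.IH"[of u] "2.prems" Cons False by (simp add: algebra_simps)
    qed
  qed
next
  case (3 y t)
  have A: "A \<subseteq> {1..y-3*int (tsize t)-7}" using 3 by (auto simp: backgrounds_def)
  have yS: "y - 2 \<in> A' \<union> conf y t'" "y - 1 \<in> A' \<union> conf y t'" using "3.prems"(1) by auto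
  have y4: "y \<ge> 4" using "3.prems" by auto
  have ynot: "y \<notin> A \<union> conf y (True # t)" using A conf_range[of "y - 6" t] by auto
  show ?case
  proof (cases t')
    case Nil then show ?thesis using yS y4 "3.prems" by (auto simp: backgrounds_def)
  next
    case (Cons d u)
    have A': "A' \<subseteq> {1..y-3*int (tsize t')-1}" using "3.prems" by (auto simp: backgrounds_def)
    show ?thesis
    proof (cases d)
      case False
      then have "y \<in> A' \<union> conf y t'" using Cons by simp
      then show ?thesis using ynot "3.prems"(1) by blast
    next
      case True
      have "y - 2 \<notin> conf (y - 6) t" "y - 2 \<notin> conf (y - 6) u" "y - 1 \<notin> conf (y - 6) t" "y - 1 \<notin> conf (y - 6) u"
        using conf_range[of "y - 6"] by force+
      moreover have "y - 2 \<notin> A" "y - 1 \<notin> A" "y - 2 \<notin> A'" "y - 1 \<notin> A'" using A A' Cons True by auto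
      moreover have "{y - 2, y - 1} \<union> (A \<union> conf (y - 6) t) = {y - 2, y - 1} \<union> (A' \<union> conf (y - 6) u)"
        using "3.prems"(1) Cons True by auto
      ultimately have "A \<union> conf (y - 6) t = A' \<union> conf (y - 6) u"
        by - (rule Un_left_cancel_disjoint[of "{y - 2, y - 1}"], assumption, simp_all)
      then show ?thesis using "3.IH"[of u] "3.prems" Cons True by (simp add: algebra_simps)
    qed
  qed
qed

definition chain_block :: "int \<Rightarrow> nat \<Rightarrow> int set \<Rightarrow> int set set" where
  "chain_block y k A = (\<lambda>t. A \<union> conf y t) ` tilings k"

text \<open>\<open>phi\<close> is a ground state of the chain without its last three sites,
  orthogonal to the ground states of the full chain; \<open>chi\<close> is a ground state of the
  last nine sites. Their overlap is the quantity needed by the martingale method.\<close>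

locale chain_overlap =
  fixes lam :: complex and L :: int and phi chi :: fstate
  assumes lam: "lam \<noteq> 0" and L: "L \<ge> 11"
    and phi: "phi \<in> fock {1..L}" "ground lam 1 (L - 3) phi"
    and orth: "\<And>theta. theta \<in> fock {1..L} \<Longrightarrow> ground lam 1 L theta \<Longrightarrow> finner {1..L} theta phi = 0"
    and chi: "ground lam (L - 8) L chi"
begin

text \<open>Gluing a ground state on the right of \<open>p\<close> to the background amplitudes of \<open>phi\<close> gives a
  ground state of the whole chain, hence \<open>phi\<close> is orthogonal to it fibrewise.\<close>

lemma glued_orthogonal:
  assumes p: "-2 \<le> p" "p \<le> L - 2"
    and supp: "\<And>c. g c \<noteq> 0 \<Longrightarrow> c \<subseteq> {p+3..L}"
    and two: "\<And>c z. g c \<noteq> 0 \<Longrightarrow> z \<in> c \<Longrightarrow> z + 2 \<notin> c"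
    and move: "\<And>x T. p + 1 \<le> x \<Longrightarrow> x + 3 \<le> L \<Longrightarrow> T \<inter> {x..x+3} = {} \<Longrightarrow> g (T \<union> {x+1, x+2}) = lam * g (T \<union> {x, x+3})"
    and A: "A \<in> backgrounds p"
  shows "(\<Sum>c\<in>Pow {p+3..L}. cnj (g c) * phi (A \<union> c)) = 0"
proof -
  \<comment> \<open>The background amplitudes are chosen as the fibre overlaps themselves, so that
    orthogonality of \<open>phi\<close> to the glued state says that a sum of squares is
    zero.\<close>
  define h where "h A = (if A \<in> backgrounds p then \<Sum>c\<in>Pow {p+3..L}. cnj (g c) * phi (A \<union> c) else 0)" for A
  define theta where "theta S = h (S \<inter> {..p}) * g (S \<inter> {p<..})" for S
  have hbg: "A \<in> backgrounds p" if "h A \<noteq> 0" for A using that by (auto simp: h_def split: if_splits)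
  have nz: "S \<inter> {..p} \<subseteq> {1..p-1}" "S \<inter> {p<..} \<subseteq> {p+3..L}" "h (S \<inter> {..p}) \<noteq> 0" "g (S \<inter> {p<..}) \<noteq> 0"
    if "theta S \<noteq> 0" for S
    using that hbg[of "S \<inter> {..p}"] supp[of "S \<inter> {p<..}"] by (auto simp: theta_def backgrounds_def)
  have tf: "theta \<in> fock {1..L}"
  proof -
    have "S \<subseteq> {1..L}" if "theta S \<noteq> 0" for S
    proof
      fix z assume "z \<in> S"
      then show "z \<in> {1..L}" using nz(1,2)[OF that] p by (cases "z \<le> p") force+
    qed
    then show ?thesis by (auto simp: fock_def)
  qed
  have h_two: "h A = 0" if "x \<in> A" "x + 2 \<in> A" "1 \<le> x" for A x
  proof (cases "A \<in> backgrounds p")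
    case True
    have "x + 2 \<le> L - 3" using True that p by (auto simp: backgrounds_def)
    then have "phi (A \<union> c) = 0" for c
      using that by (intro ground_distance_two[OF phi(2), of x _ "x+2"]) auto
    then show ?thesis by (simp add: h_def)
  qed (simp add: h_def)
  have h_move: "h (B \<union> {x+1, x+2}) = lam * h (B \<union> {x, x+3})"
    if B: "B \<inter> {x..x+3} = {}" "1 \<le> x" "x + 3 \<le> p - 1" for B x
  \<comment> \<open>The one case in which the move changes membership in
    \<open>backgrounds p\<close>: the outer particle lands at p - 2 beside one at p - 1. Then both
    amplitudes vanish.\<close>
  proof (cases "p - 1 = x + 4 \<and> x + 4 \<in> B")
    case True
    then have "p = x + 5" by simp
    have "h (B \<union> {x+1, x+2}) = 0" by (rule h_two[of "x+2"]) (use True B in \<open>auto simp: add.commute\<close>)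
    moreover have "B \<union> {x, x+3} \<notin> backgrounds p"
      using True B \<open>p = x + 5\<close> by (auto simp: backgrounds_def add.commute)
    ultimately show ?thesis by (simp add: h_def)
  next
    case False
    have "B \<union> {x+1, x+2} \<in> backgrounds p \<longleftrightarrow> B \<union> {x, x+3} \<in> backgrounds p"
    proof -
      have n: "x \<notin> B" "x+1 \<notin> B" "x+2 \<notin> B" "x+3 \<notin> B" using B by auto
      have "B \<union> {x+1, x+2} \<subseteq> {1..p-1} \<longleftrightarrow> B \<union> {x, x+3} \<subseteq> {1..p-1}" using B by auto
      moreover have "p - 2 \<in> B \<union> {x+1, x+2} \<and> p - 1 \<in> B \<union> {x+1, x+2} \<longleftrightarrow> p - 2 \<in> B \<union> {x, x+3} \<and> p - 1 \<in> B \<union> {x, x+3}"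
      proof -
        consider "p - 1 = x + 3" "p - 2 = x + 2" | "p - 1 = x + 4" | "x + 3 < p - 2" using B by linarith
        then show ?thesis
        proof cases
          case 1
          show ?thesis unfolding 1 using n by auto
        next
          case 2
          show ?thesis unfolding 2 using False 2 by auto
        next
          case 3 then show ?thesis by auto
        qed
      qed
      ultimately show ?thesis unfolding backgrounds_def by blast
    qed
    moreover have "phi (B \<union> {x+1, x+2} \<union> c) = lam * phi (B \<union> {x, x+3} \<union> c)" if "c \<in> Pow {p+3..L}" for c
    proof -
      have "(B \<union> c) \<inter> {x..x+3} = {}" using B that by force
      then have "phi ((B \<union> c) \<union> {x+1, x+2}) = lam * phi ((B \<union> c) \<union> {x, x+3})"
        using B p by (intro ground_move[OF phi(2)]) auto
      then show ?thesis by (simp add: Un_ac)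
    qed
    ultimately show ?thesis by (auto simp: h_def sum_distrib_left algebra_simps intro!: sum.cong)
  qed
  have gtheta: "ground lam 1 L theta" unfolding ground_def
  proof (intro conjI allI impI; elim conjE)
    fix x S assume x: "1 \<le> x" "x + 2 \<le> L" "x \<in> S" "x + 2 \<in> S"
    show "theta S = 0"
    proof (rule ccontr)
      assume t: "theta S \<noteq> 0"
      consider "x + 2 \<le> p" | "x > p" | "x \<le> p" "p < x + 2" by linarith
      then show False
      proof cases
        case 1 then show False using h_two[of x "S \<inter> {..p}"] x nz(3)[OF t] by auto
      next
        case 2 then show False using two[OF nz(4)[OF t], of x] x by auto
      next
        case 3
        then have "x \<in> {1..p-1}" "x + 2 \<in> {p+3..L}" using nz(1,2)[OF t] x by blast+
        then show False by auto
      qed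
    qed
  next
    fix x T assume x: "1 \<le> x" "x + 3 \<le> L" "T \<inter> {x..x+3} = {}"
    let ?U = "T \<union> {x+1, x+2}" and ?V = "T \<union> {x, x+3}"
    consider "x + 3 \<le> p - 1" | "x + 3 = p" | "x = p - 2" | "x = p - 1" | "x = p" | "p + 1 \<le> x" by linarith
    then show "theta ?U = lam * theta ?V"
    proof cases
      case 1
      have e: "?U \<inter> {..p} = (T \<inter> {..p}) \<union> {x+1, x+2}" "?V \<inter> {..p} = (T \<inter> {..p}) \<union> {x, x+3}"
        "?U \<inter> {p<..} = T \<inter> {p<..}" "?V \<inter> {p<..} = T \<inter> {p<..}" using 1 by auto
      have "(T \<inter> {..p}) \<inter> {x..x+3} = {}" using x by blast
      then show ?thesis unfolding theta_def e using h_move[of "T \<inter> {..p}" x] x 1 by simp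
    next
      \<comment> \<open>Here the seam matters: the inner pair would sit on p - 2 and p - 1, which
        backgrounds exclude, and the outer one would occupy p. As \<open>x \<ge> 1\<close>, this
        happens only for p \<ge> 4, the range in which the exclusion is imposed.\<close>
      case 2
      have "theta ?U = 0"
      proof -
        have "?U \<inter> {..p} \<notin> backgrounds p" using 2 x by (auto simp: backgrounds_def)
        then show ?thesis by (simp add: theta_def h_def)
      qed
      moreover have "theta ?V = 0"
      proof (rule ccontr)
        assume "theta ?V \<noteq> 0"
        from subsetD[OF nz(1)[OF this], of "x + 3"] have "x + 3 \<in> {1..p-1}" using 2 by simp
        then show False using 2 by auto
      qed
      ultimately show ?thesis by simp
    next
      case 3
      have "theta ?U = 0"
      proof (rule ccontr)
        assume "theta ?U \<noteq> 0"
        from subsetD[OF nz(1)[OF this], of "x + 2"] have "x + 2 \<in> {1..p-1}" using 3 by simp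
        then show False using 3 by auto
      qed
      moreover have "theta ?V = 0"
      proof (rule ccontr)
        assume "theta ?V \<noteq> 0"
        from subsetD[OF nz(2)[OF this], of "x + 3"] have "x + 3 \<in> {p+3..L}" using 3 by simp
        then show False using 3 by auto
      qed
      ultimately show ?thesis by simp
    next
      case 4
      have "theta ?U = 0"
      proof (rule ccontr)
        assume "theta ?U \<noteq> 0"
        from subsetD[OF nz(1)[OF this], of "x + 1"] have "x + 1 \<in> {1..p-1}" using 4 by simp
        then show False using 4 by auto
      qed
      moreover have "theta ?V = 0"
      proof (rule ccontr)
        assume "theta ?V \<noteq> 0"
        from subsetD[OF nz(2)[OF this], of "x + 3"] have "x + 3 \<in> {p+3..L}" using 4 by simp
        then show False using 4 by auto
      qed
      ultimately show ?thesis by simp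
    next
      case 5
      have "theta ?U = 0"
      proof (rule ccontr)
        assume "theta ?U \<noteq> 0"
        from subsetD[OF nz(2)[OF this], of "x + 1"] have "x + 1 \<in> {p+3..L}" using 5 by simp
        then show False using 5 by auto
      qed
      moreover have "theta ?V = 0"
      proof (rule ccontr)
        assume "theta ?V \<noteq> 0"
        from subsetD[OF nz(1)[OF this], of "x"] have "x \<in> {1..p-1}" using 5 by simp
        then show False using 5 by auto
      qed
      ultimately show ?thesis by simp
    next
      case 6
      have e: "?U \<inter> {p<..} = (T \<inter> {p<..}) \<union> {x+1, x+2}" "?V \<inter> {p<..} = (T \<inter> {p<..}) \<union> {x, x+3}"
        "?U \<inter> {..p} = T \<inter> {..p}" "?V \<inter> {..p} = T \<inter> {..p}" using 6 by auto
      have "(T \<inter> {p<..}) \<inter> {x..x+3} = {}" using x by blast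
      then show ?thesis unfolding theta_def e using move[of x "T \<inter> {p<..}"] x 6 by simp
    qed
  qed
  let ?P = "backgrounds p \<times> Pow {p+3..L}"
  let ?u = "\<lambda>(A, c). A \<union> c"
  have cut: "(A \<union> c) \<inter> {..p} = A" "(A \<union> c) \<inter> {p<..} = c" if "A \<in> backgrounds p" "c \<in> Pow {p+3..L}" for A c
    using that by (auto simp: backgrounds_def)
  have inj: "inj_on ?u ?P"
  proof (rule inj_onI)
    fix q q' assume q: "q \<in> ?P" "q' \<in> ?P" "?u q = ?u q'"
    obtain A c A' c' where qq: "q = (A, c)" "q' = (A', c')" by (cases q, cases q')
    then have "A \<union> c = A' \<union> c'" using q(3) by simp
    then show "q = q'" using cut[of A c] cut[of A' c'] q qq by auto
  qed
  have "0 = (\<Sum>S\<in>Pow {1..L}. cnj (theta S) * phi S)" using orth[OF tf gtheta] by (simp add: finner_def)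
  also have "\<dots> = (\<Sum>S\<in>?u ` ?P. cnj (theta S) * phi S)"
  proof (rule sum.mono_neutral_right)
    show "?u ` ?P \<subseteq> Pow {1..L}" using p by (auto simp: backgrounds_def)
    show "\<forall>S\<in>Pow {1..L} - ?u ` ?P. cnj (theta S) * phi S = 0"
    proof
      fix S assume S: "S \<in> Pow {1..L} - ?u ` ?P"
      have "theta S = 0"
      proof (rule ccontr)
        assume t: "theta S \<noteq> 0"
        have "(S \<inter> {..p}, S \<inter> {p<..}) \<in> ?P" using hbg[OF nz(3)[OF t]] nz(2)[OF t] by simp
        moreover have "S = ?u (S \<inter> {..p}, S \<inter> {p<..})" by auto
        ultimately show False using S by blast
      qed
      then show "cnj (theta S) * phi S = 0" by simp
    qed
  qed simp
  also have "\<dots> = (\<Sum>(A, c)\<in>?P. cnj (theta (A \<union> c)) * phi (A \<union> c))"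
    by (subst sum.reindex[OF inj]) (simp add: case_prod_unfold)
  also have "\<dots> = (\<Sum>A\<in>backgrounds p. \<Sum>c\<in>Pow {p+3..L}. cnj (theta (A \<union> c)) * phi (A \<union> c))"
    by (rule sum.cartesian_product[symmetric])
  also have "\<dots> = (\<Sum>A\<in>backgrounds p. cnj (h A) * h A)"
  proof (rule sum.cong[OF refl])
    fix A assume A: "A \<in> backgrounds p"
    have "(\<Sum>c\<in>Pow {p+3..L}. cnj (theta (A \<union> c)) * phi (A \<union> c)) = (\<Sum>c\<in>Pow {p+3..L}. cnj (h A) * (cnj (g c) * phi (A \<union> c)))"
      by (intro sum.cong refl) (simp only: theta_def cut[OF A] complex_cnj_mult mult.assoc)
    also have "\<dots> = cnj (h A) * h A" using A by (simp add: h_def sum_distrib_left)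
    finally show "(\<Sum>c\<in>Pow {p+3..L}. cnj (theta (A \<union> c)) * phi (A \<union> c)) = cnj (h A) * h A" .
  qed
  also have "\<dots> = complex_of_real (\<Sum>A\<in>backgrounds p. (cmod (h A))\<^sup>2)"
    unfolding of_real_sum by (intro sum.cong refl) (metis complex_norm_square mult.commute)
  finally have "(\<Sum>A\<in>backgrounds p. (cmod (h A))\<^sup>2) = 0" by (metis of_real_eq_0_iff)
  then have "(cmod (h A))\<^sup>2 = 0"
    using A finite_backgrounds by (subst (asm) sum_nonneg_eq_0_iff) auto
  then show ?thesis using A by (simp add: h_def)
qed

text \<open>The gluing argument with the empty chain: nothing stands on the last three sites and
  nothing can be moved onto them.\<close>

lemma phi_zero_background: "S \<in> backgrounds (L - 2) \<Longrightarrow> phi S = 0"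
proof -
  assume S: "S \<in> backgrounds (L - 2)"
  have "(\<Sum>c\<in>Pow {L-2+3..L}. cnj (if c = {} then 1 else 0) * phi (S \<union> c)) = 0"
    by (rule glued_orthogonal[OF _ _ _ _ _ S]) (use L in \<open>auto split: if_splits\<close>)
  then show ?thesis by simp
qed

lemma chain_orthogonal:
  assumes y: "y \<le> L" "k \<ge> 1" "y - 3 * int k \<ge> -2" and A: "A \<in> backgrounds (y - 3 * int k)"
  shows "(\<Sum>t\<in>tilings k. cnj (lam ^ dimers t) * phi (A \<union> conf y t)) = 0"
proof -
  let ?p = "y - 3 * int k"
  have "(\<Sum>c\<in>Pow {?p+3..L}. cnj (chain_wt lam k y c) * phi (A \<union> c)) = 0"
  proof (rule glued_orthogonal[OF _ _ _ _ _ A])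
    fix c assume c: "chain_wt lam k y c \<noteq> 0"
    obtain t where t: "t \<in> tilings k" "conf y t = c" using chain_wt_support[OF c] .
    show "c \<subseteq> {?p+3..L}" using conf_range[of y t] t y by (auto simp: tilings_def)
    show "z + 2 \<notin> c" if "z \<in> c" for z using conf_distance_two[of z y t] t that by simp
  next
    show "chain_wt lam k y (T \<union> {x + 1, x + 2}) = lam * chain_wt lam k y (T \<union> {x, x + 3})"
      if "T \<inter> {x..x + 3} = {}" for x T using that by (rule chain_wt_move)
  qed (use y in auto)
  then show ?thesis using sum_chain_wt[of "{?p+3..L}" y k lam "\<lambda>c. phi (A \<union> c)"] y by simp
qed

section \<open>Partition of the relevant configurations into chain blocks\<close>

lemma distance_two_zero:
  assumes "S \<subseteq> {1..L}" "chi S \<noteq> 0" "phi S \<noteq> 0" "x \<in> S" "y = x + 2"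
  shows "y \<notin> S"
proof
  assume y: "y \<in> S"
  show False
  proof (cases "y \<le> L - 3")
    case True
    then show False using ground_distance_two[OF phi(2) assms(4) y] assms by auto
  next
    case False
    then show False using ground_distance_two[OF chi assms(4) y] assms y by auto
  qed
qed

text \<open>As long as the left part is not a background, it ends in a monomer or a dimer that can
  be split off. The sites this cell claims are empty by the exclusion rules, taken from
  \<open>phi\<close> away from the right end and from \<open>chi\<close> near it.\<close>

lemma chain_parse_exists:
  assumes S: "S \<subseteq> {1..L}" "chi S \<noteq> 0" "phi S \<noteq> 0" and y: "L - 2 \<le> y" "y \<le> L"
    and first: "\<not> (y - 1 \<in> S \<and> y \<in> S)"
    and dec: "S = A \<union> conf y t" "A \<subseteq> {1..y - 3 * int (tsize t)}" "y - 3 * int (tsize t) \<ge> -2"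
  shows "\<exists>t' A'. S = A' \<union> conf y t' \<and> A' \<in> backgrounds (y - 3 * int (tsize t')) \<and> y - 3 * int (tsize t') \<ge> -2"
  using dec
proof (induction "nat (y - 3 * int (tsize t) + 3)" arbitrary: A t rule: less_induct)
  case less
  define p where "p = y - 3 * int (tsize t)"
  note d2 = distance_two_zero[OF S]
  have Ap: "A \<subseteq> {1..p}" "p \<ge> -2" "A \<subseteq> S" using less.prems by (auto simp: p_def)
  show ?case
  proof (cases "A \<in> backgrounds p")
    case True
    then show ?thesis using less.prems(1,3) unfolding p_def by blast
  next
    case nb: False
    show ?thesis
    proof (cases "p \<in> A")
      case True
      have p1: "p \<ge> 1" "p \<in> S" using True Ap by auto
      have "p - 1 \<notin> S"
      proof (cases t rule: rev_cases)
        case Nil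
        then show ?thesis using first p1 by (simp add: p_def)
      next
        case (snoc u d)
        show ?thesis
        proof
          assume pm: "p - 1 \<in> S"
          then have p2: "p - 1 \<ge> 1" using S by auto
          show False
          proof (cases d)
            case False
            have "y - 3 * int (tsize u) = p + 3" using snoc False by (simp add: p_def tsize_append)
            then have "p + 3 \<in> S" using less.prems(1) snoc False by (simp add: conf_append)
            then have sub: "{p - 1, p - 1 + 1, p - 1 + 4} \<subseteq> S" "p + 3 \<le> L" using pm p1 S by (auto simp: add.commute)
            show False
            proof (cases "p + 3 \<le> L - 3")
              case True
              then show False using ground_11001[OF lam phi(2), of "p - 1" S] sub p2 S by simp
            next
              case False
              then show False using ground_11001[OF lam chi, of "p - 1" S] sub S by simp
            qed
          next
            case True
            have y6: "y - 3 * int (tsize u) = p + 6" using snoc True by (simp add: p_def tsize_append)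
            then have "p + 4 \<in> S" "p + 5 \<in> S" using less.prems(1) snoc True by (auto simp: conf_append)
            then have sub: "{p - 1, p - 1 + 1, p - 1 + 5, p - 1 + 6} \<subseteq> S" using pm p1 by (auto simp: add.commute)
            have "p + 6 \<le> y" using y6 by linarith
            \<comment> \<open>Spreading the right pair fits into the range of \<open>phi\<close> or
              into the nine sites of \<open>chi\<close>, except at p + 6 = L - 2. There the left
              pair is spread instead, which reaches down to L - 10: the origin of
              \<open>L \<ge> 11\<close>.\<close>
            then consider "p + 6 \<le> L - 3" | "p + 6 = L - 2" | "p + 6 \<ge> L - 1" "p + 6 \<le> L" using y by linarith
            then show False
            proof cases
              case 1
              then show False using ground_two_pairs_right[OF lam phi(2), of "p - 1" S] sub p2 S by simp
            next
              case 2
              then show False using ground_two_pairs_left[OF lam phi(2), of "p - 1" S] sub L S by simp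
            next
              case 3
              then show False using ground_two_pairs_right[OF lam chi, of "p - 1" S] sub S by simp
            qed
          qed
        qed
      qed
      moreover have "p - 2 \<notin> S" using d2[of "p - 2" p] p1 by auto
      ultimately have A': "A - {p} \<subseteq> {1..p - 3}"
      proof -
        have "z \<in> {1..p - 3}" if "z \<in> A - {p}" for z
        proof -
          have "z \<noteq> p - 1" "z \<noteq> p - 2" using that Ap \<open>p - 1 \<notin> S\<close> \<open>p - 2 \<notin> S\<close> by auto
          then show ?thesis using that Ap by auto
        qed
        then show ?thesis by blast
      qed
      have t': "y - 3 * int (tsize (t @ [False])) = p - 3" by (simp add: p_def tsize_append)
      show ?thesis
      proof (rule less.hyps)
        show "nat (y - 3 * int (tsize (t @ [False])) + 3) < nat (y - 3 * int (tsize t) + 3)"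
          unfolding t' using p1 by (simp add: p_def)
        show "S = (A - {p}) \<union> conf y (t @ [False])" using less.prems(1) True by (auto simp: conf_append p_def)
        show "A - {p} \<subseteq> {1..y - 3 * int (tsize (t @ [False]))}" "-2 \<le> y - 3 * int (tsize (t @ [False]))"
          unfolding t' using A' p1 by auto
      qed
    next
      case False
      then have sub1: "A \<subseteq> {1..p - 1}" using Ap by (auto simp: order_less_le)
      then have pair: "p \<ge> 4" "p - 2 \<in> A" "p - 1 \<in> A" using nb by (auto simp: backgrounds_def)
      have n: "p - 3 \<notin> S" "p - 4 \<notin> S"
        using d2[of "p - 3" "p - 1"] d2[of "p - 4" "p - 2"] pair Ap by auto
      have "p - 5 \<notin> S"
      proof
        assume p5: "p - 5 \<in> S"
        then have "p - 5 \<ge> 1" using S by auto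
        have sub: "{p - 5, p - 5 + 3, p - 5 + 4} \<subseteq> S" using p5 pair Ap by auto
        have "p \<le> y" by (simp add: p_def)
        show False
        proof (cases "p - 1 \<le> L - 3")
          case True
          then show False using ground_10011[OF lam phi(2), of "p - 5" S] sub \<open>p - 5 \<ge> 1\<close> S by simp
        next
          case False
          then show False using ground_10011[OF lam chi, of "p - 5" S] sub \<open>p \<le> y\<close> y S by simp
        qed
      qed
      have A': "A - {p - 2, p - 1} \<subseteq> {1..p - 6}"
      proof -
        have "z \<in> {1..p - 6}" if "z \<in> A - {p - 2, p - 1}" for z
        proof -
          have "z \<noteq> p - 3" "z \<noteq> p - 4" "z \<noteq> p - 5" using that Ap n \<open>p - 5 \<notin> S\<close> by auto
          then show ?thesis using that sub1 by auto
        qed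
        then show ?thesis by blast
      qed
      have t': "y - 3 * int (tsize (t @ [True])) = p - 6" by (simp add: p_def tsize_append)
      show ?thesis
      proof (rule less.hyps)
        show "nat (y - 3 * int (tsize (t @ [True])) + 3) < nat (y - 3 * int (tsize t) + 3)"
          unfolding t' using pair by (simp add: p_def)
        show "S = (A - {p - 2, p - 1}) \<union> conf y (t @ [True])"
          using less.prems(1) pair by (auto simp: conf_append p_def)
        show "A - {p - 2, p - 1} \<subseteq> {1..y - 3 * int (tsize (t @ [True]))}" "-2 \<le> y - 3 * int (tsize (t @ [True]))"
          unfolding t' using A' pair by auto
      qed
    qed
  qed
qed

definition blocks :: "(int \<times> nat \<times> int set) set" where
  "blocks = {(y, k, A). L - 2 \<le> y \<and> y \<le> L \<and> 1 \<le> k \<and> y - 3 * int k \<ge> -2 \<and> A \<in> backgrounds (y - 3 * int k)}"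

abbreviation "block b \<equiv> (case b of (y, k, A) \<Rightarrow> chain_block y k A)"

text \<open>The last four sites determine the end \<open>y\<close> and the type of the last cell.
  Patterns that fit no chain are those on which \<open>phi\<close> vanishes.\<close>

lemma block_cover:
  assumes S: "S \<subseteq> {1..L}" "chi S \<noteq> 0" "phi S \<noteq> 0"
  shows "\<exists>b\<in>blocks. S \<in> block b"
proof -
  note d2 = distance_two_zero[OF S]
  have *: "\<exists>b\<in>blocks. S \<in> block b"
    if y: "L - 2 \<le> y" "y \<le> L" and Sy: "S \<subseteq> {1..y}" and f: "\<not> (y - 1 \<in> S \<and> y \<in> S)" and nb: "S \<notin> backgrounds y" for y
  proof -
    obtain t A where tA: "S = A \<union> conf y t" "A \<in> backgrounds (y - 3 * int (tsize t))" "y - 3 * int (tsize t) \<ge> -2"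
      using chain_parse_exists[OF S y f, of S "[]"] Sy y L by auto
    have "t \<noteq> []" using nb tA by auto
    then have "tsize t \<ge> 1" by (cases t) auto
    then have "(y, tsize t, A) \<in> blocks" using tA y by (simp add: blocks_def)
    moreover have "S \<in> chain_block y (tsize t) A" using tA(1) by (auto simp: chain_block_def tilings_def)
    ultimately show ?thesis by force
  qed
  have below: "S \<subseteq> {1..u}" if "\<And>z. z \<in> S \<Longrightarrow> z \<le> u" for u using S(1) that by auto
  have mx: "z \<le> L" if "z \<in> S" for z using S(1) that by auto
  consider (R) "L \<in> S" "L - 1 \<in> S" | (M0) "L \<in> S" "L - 1 \<notin> S" | (D0) "L \<notin> S" "L - 1 \<in> S" "L - 2 \<in> S"
    | (M1) "L \<notin> S" "L - 1 \<in> S" "L - 2 \<notin> S" | (D1) "L \<notin> S" "L - 1 \<notin> S" "L - 2 \<in> S" "L - 3 \<in> S"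
    | (M2) "L \<notin> S" "L - 1 \<notin> S" "L - 2 \<in> S" "L - 3 \<notin> S" | (N) "L \<notin> S" "L - 1 \<notin> S" "L - 2 \<notin> S" by blast
  then show ?thesis
  proof cases
    \<comment> \<open>A pair on the last two sites would be a dimer with right end L + 1, which the
      boundary freezes. The gluing argument with this rigid pair in place of a chain gives
      \<open>phi S = 0\<close>.\<close>
    case R
    have n: "L - 2 \<notin> S" "L - 3 \<notin> S" using d2[of "L - 2" L] d2[of "L - 3" "L - 1"] R by auto
    have n4: "L - 4 \<notin> S"
    proof
      assume "L - 4 \<in> S"
      then show False using ground_10011[OF lam chi, of "L - 4" S] R S by simp
    qed
    have n5: "\<not> (L - 6 \<in> S \<and> L - 5 \<in> S)"
    proof
      assume "L - 6 \<in> S \<and> L - 5 \<in> S"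
      then show False using ground_two_pairs_left[OF lam chi, of "L - 6" S] R S by simp
    qed
    define A where "A = S - {L - 1, L}"
    have "A \<subseteq> {1..L - 4 - 1}"
    proof
      fix z assume z: "z \<in> A"
      then have "z \<noteq> L" "z \<noteq> L - 1" "z \<noteq> L - 2" "z \<noteq> L - 3" "z \<noteq> L - 4" "1 \<le> z" "z \<le> L" using n n4 S by (auto simp: A_def)
      then show "z \<in> {1..L - 4 - 1}" by auto
    qed
    then have A: "A \<in> backgrounds (L - 4)" using n5 by (auto simp: backgrounds_def A_def)
    have "(\<Sum>c\<in>Pow {L-4+3..L}. cnj (if c = {L - 1, L} then 1 else 0) * phi (A \<union> c)) = 0"
    proof (rule glued_orthogonal[OF _ _ _ _ _ A])
      fix x T assume x: "L - 4 + 1 \<le> x" "x + 3 \<le> L" "T \<inter> {x..x + 3} = {}"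
      then have "x = L - 3" by simp
      then have "L - 2 \<in> T \<union> {x + 1, x + 2}" "L - 3 \<in> T \<union> {x, x + 3}" by auto
      then have "T \<union> {x + 1, x + 2} \<noteq> {L - 1, L}" "T \<union> {x, x + 3} \<noteq> {L - 1, L}" by force+
      then show "(if T \<union> {x + 1, x + 2} = {L - 1, L} then 1 else 0) = lam * (if T \<union> {x, x + 3} = {L - 1, L} then 1 else 0)"
        by (simp only: if_False mult_zero_right)
    qed (use L in \<open>auto split: if_splits\<close>)
    moreover have "(\<Sum>c\<in>Pow {L-4+3..L}. cnj (if c = {L - 1, L} then 1 else 0) * phi (A \<union> c)) = (\<Sum>c\<in>Pow {L-4+3..L}. if c = {L - 1, L} then phi S else 0)"
    proof (intro sum.cong refl)
      have "A \<union> {L - 1, L} = S" using R by (auto simp: A_def)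
      then show "cnj (if c = {L - 1, L} then 1 else 0) * phi (A \<union> c) = (if c = {L - 1, L} then phi S else 0)" for c by simp
    qed
    moreover have "{L - 1, L} \<in> Pow {L-4+3..L}" by auto
    ultimately have "phi S = 0" by simp
    then show ?thesis using S by simp
  next
    case M0
    show ?thesis by (rule *[of L]) (use M0 S in \<open>auto simp: backgrounds_def\<close>)
  next
    case D0
    show ?thesis by (rule *[of L]) (use D0 S L in \<open>auto simp: backgrounds_def\<close>)
  next
    case M1
    have "z \<le> L - 1" if "z \<in> S" for z using mx[OF that] M1 that by (cases "z = L") auto
    then show ?thesis by (intro *[of "L - 1"] below) (use M1 in \<open>auto simp: backgrounds_def\<close>)
  next
    case D1
    have "z \<le> L - 1" if "z \<in> S" for z using mx[OF that] D1 that by (cases "z = L") auto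
    then show ?thesis by (intro *[of "L - 1"] below) (use D1 L in \<open>auto simp: backgrounds_def\<close>)
  next
    case M2
    have "z \<le> L - 2" if "z \<in> S" for z using mx[OF that] M2 that by (cases "z = L \<or> z = L - 1") auto
    then show ?thesis by (intro *[of "L - 2"] below) (use M2 in \<open>auto simp: backgrounds_def\<close>)
  next
    \<comment> \<open>By \<open>phi_zero_background\<close> the configuration must end in a pair on
      L - 4 and L - 3, a dimer with right end L - 2.\<close>
    case N
    have "z \<le> L - 2" if "z \<in> S" for z using mx[OF that] N that by (cases "z = L \<or> z = L - 1") auto
    then show ?thesis by (intro *[of "L - 2"] below) (use N phi_zero_background S in auto)
  qed
qed

lemma block_last:
  assumes "(y, k, A) \<in> blocks" "S \<in> chain_block y k A"
  shows "S \<subseteq> {1..y}" "y \<in> S \<and> y - 1 \<notin> S \<or> y \<notin> S \<and> y - 2 \<in> S \<and> y - 1 \<in> S"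
proof -
  obtain t where t: "tsize t = k" "S = A \<union> conf y t" using assms(2) by (auto simp: chain_block_def tilings_def)
  have b: "1 \<le> k" "y - 3 * int k \<ge> -2" "A \<subseteq> {1..y - 3 * int k - 1}" using assms(1) by (auto simp: blocks_def backgrounds_def)
  have c: "conf y t \<subseteq> {1..y}" using conf_range[of y t] t b by auto
  show "S \<subseteq> {1..y}" using c b t by force
  obtain d u where du: "t = d # u" using t b by (cases t) auto
  have nA: "y \<notin> A" "y - 1 \<notin> A" using b by auto
  show "y \<in> S \<and> y - 1 \<notin> S \<or> y \<notin> S \<and> y - 2 \<in> S \<and> y - 1 \<in> S"
  proof (cases d)
    case True
    have "y \<notin> conf (y - 6) u" using conf_range[of "y - 6" u] by auto
    then show ?thesis using True du t nA by auto
  next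
    case False
    have "y - 1 \<notin> conf (y - 3) u" using conf_range[of "y - 3" u] by auto
    then show ?thesis using False du t nA by auto
  qed
qed

text \<open>The right end can be read off: if two ends differed, the larger chain would end in a
  dimer whose right particle is the smaller end, with its left neighbour occupied, against
  \<open>block_last\<close>. For equal ends the parse is unique.\<close>

lemma block_disjoint:
  assumes b: "b \<in> blocks" "b' \<in> blocks" "b \<noteq> b'"
  shows "block b \<inter> block b' = {}"
proof (rule ccontr)
  assume "block b \<inter> block b' \<noteq> {}"
  then obtain S where S: "S \<in> block b" "S \<in> block b'" by blast
  obtain y k A y' k' A' where bb: "b = (y, k, A)" "b' = (y', k', A')" by (cases b, cases b')
  note l = block_last[OF b(1)[unfolded bb] S(1)[unfolded bb prod.case]] block_last[OF b(2)[unfolded bb] S(2)[unfolded bb prod.case]]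
  have le: "z \<le> y" "z \<le> y'" if "z \<in> S" for z using that l by auto
  have "y = y'"
  proof (rule ccontr)
    assume "y \<noteq> y'"
    then consider "y < y'" | "y' < y" by linarith
    then show False
    proof cases
      case 1
      then have "y' \<notin> S" using le by force
      then have "y' - 2 \<in> S" "y' - 1 \<in> S" using l by auto
      then have "y' - 1 = y" using le 1 by force
      then have "y \<in> S" "y - 1 \<in> S" using \<open>y' - 2 \<in> S\<close> \<open>y' - 1 \<in> S\<close> by auto
      then show False using l by auto
    next
      case 2
      then have "y \<notin> S" using le by force
      then have "y - 2 \<in> S" "y - 1 \<in> S" using l by auto
      then have "y - 1 = y'" using le 2 by force
      then have "y' \<in> S" "y' - 1 \<in> S" using \<open>y - 2 \<in> S\<close> \<open>y - 1 \<in> S\<close> by auto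
      then show False using l by auto
    qed
  qed
  moreover obtain t t' where "tsize t = k" "S = A \<union> conf y t" "tsize t' = k'" "S = A' \<union> conf y' t'"
    using S by (auto simp: bb chain_block_def tilings_def)
  ultimately have "A = A' \<and> t = t'"
    using chain_parse_unique[of A y t A' t'] b by (auto simp: bb blocks_def)
  then show False using \<open>y = y'\<close> b \<open>tsize t = k\<close> \<open>tsize t' = k'\<close> by (simp add: bb)
qed

lemma finite_blocks: "finite blocks"
proof (rule finite_subset)
  show "blocks \<subseteq> {L-2..L} \<times> {..nat L} \<times> Pow {1..L}"
    by (auto simp: blocks_def backgrounds_def)
qed simp

lemma sum_chain_block:
  fixes f :: "int set \<Rightarrow> 'b::comm_monoid_add"
  assumes "(y, k, A) \<in> blocks"
  shows "(\<Sum>S\<in>chain_block y k A. f S) = (\<Sum>t\<in>tilings k. f (A \<union> conf y t))"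
  unfolding chain_block_def
proof (subst sum.reindex)
  show "inj_on (\<lambda>t. A \<union> conf y t) (tilings k)"
  proof (rule inj_onI)
    fix t t' assume "t \<in> tilings k" "t' \<in> tilings k" "A \<union> conf y t = A \<union> conf y t'"
    then show "t = t'" using chain_parse_unique[of A y t A t'] assms by (auto simp: blocks_def tilings_def)
  qed
qed simp

end

section \<open>The overlap of neighbouring windows\<close>

fun chain_norm :: "real \<Rightarrow> nat \<Rightarrow> real" where
  "chain_norm r 0 = 1" | "chain_norm r (Suc 0) = 1"
| "chain_norm r (Suc (Suc k)) = chain_norm r (Suc k) + r * chain_norm r k"

lemma chain_norm_pos: "r \<ge> 0 \<Longrightarrow> chain_norm r k > 0"
  by (induction r k rule: chain_norm.induct) (auto intro: add_pos_nonneg)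

lemma sum_tilings_weight: "(\<Sum>t\<in>tilings k. (cmod (lam ^ dimers t))\<^sup>2) = chain_norm ((cmod lam)\<^sup>2) k"
proof (induction "(cmod lam)\<^sup>2" k rule: chain_norm.induct)
  case 1 show ?case by (simp add: tilings_0)
next
  case 2 show ?case by (simp add: tilings_Suc_0)
next
  case (3 k)
  have "(\<Sum>t\<in>tilings k. (cmod (lam ^ dimers (True # t)))\<^sup>2) = (cmod lam)\<^sup>2 * (\<Sum>t\<in>tilings k. (cmod (lam ^ dimers t))\<^sup>2)"
    by (simp add: sum_distrib_left norm_mult power_mult_distrib)
  then show ?case using 3 by (simp add: sum_tilings_Suc_Suc)
qed

text \<open>Binet's formula: \<open>mu_p r\<close> and \<open>mu_m r\<close> are the roots of t * t
  = t + r, the characteristic equation of the recursion.\<close>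

lemma chain_norm_closed:
  assumes "r \<ge> 0"
  shows "(mu_p r - mu_m r) * chain_norm r k = mu_p r ^ Suc k - mu_m r ^ Suc k"
proof -
  have sq: "sqrt (1 + 4*r) * sqrt (1 + 4*r) = 1 + 4*r" using assms by simp
  have p: "mu_p r * mu_p r = mu_p r + r" using sq by (simp add: mu_p_def field_simps)
  have m: "mu_m r * mu_m r = mu_m r + r" using sq by (simp add: mu_m_def field_simps)
  have s: "mu_p r + mu_m r = 1" by (simp add: mu_p_def mu_m_def field_simps)
  show ?thesis
  proof (induction k rule: induct_nat_012)
    case 0 show ?case by simp
  next
    case 1
    have "mu_p r ^ 2 - mu_m r ^ 2 = (mu_p r - mu_m r) * (mu_p r + mu_m r)" by (simp add: power2_eq_square algebra_simps)
    then show ?case using s by (simp add: power2_eq_square)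
  next
    case (ge2 k)
    have "mu_p r ^ Suc (Suc (Suc k)) = (mu_p r * mu_p r) * mu_p r ^ Suc k"
      "mu_m r ^ Suc (Suc (Suc k)) = (mu_m r * mu_m r) * mu_m r ^ Suc k" by simp_all
    then have "mu_p r ^ Suc (Suc (Suc k)) - mu_m r ^ Suc (Suc (Suc k)) =
        (mu_p r ^ Suc (Suc k) - mu_m r ^ Suc (Suc k)) + r * (mu_p r ^ Suc k - mu_m r ^ Suc k)"
      unfolding p m by (simp add: algebra_simps)
    also have "\<dots> = (mu_p r - mu_m r) * (chain_norm r (Suc k) + r * chain_norm r k)"
      unfolding ge2[symmetric] by (simp add: algebra_simps)
    finally show ?case by simp
  qed
qed

lemma alpha_eq:
  assumes "r \<ge> 0"
  shows "alpha r (Suc k) = chain_norm r k / chain_norm r (Suc k)"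
proof -
  let ?P = "mu_p r" and ?m = "mu_m r" and ?D = "mu_p r - mu_m r"
  have P: "?P > 0" "?D > 0" using assms by (auto simp: mu_p_def mu_m_def add_pos_nonneg field_simps)
  have e: "1 - (?m / ?P) ^ n = (?P ^ n - ?m ^ n) / ?P ^ n" for n
    using P by (simp add: power_divide diff_divide_distrib)
  have "alpha r (Suc k) = 1 / ?P * ((?D * chain_norm r k / ?P ^ Suc k) / (?D * chain_norm r (Suc k) / ?P ^ Suc (Suc k)))"
    unfolding alpha_def e chain_norm_closed[OF assms] by simp
  also have "\<dots> = chain_norm r k / chain_norm r (Suc k)"
    using P chain_norm_pos[OF assms, of k] chain_norm_pos[OF assms, of "Suc k"] by (simp add: field_simps del: chain_norm.simps)
  finally show ?thesis .
qed

lemma f_n_eq: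
  fixes r :: real and j :: nat
  assumes r: "r \<ge> 0"
  defines "c \<equiv> \<lambda>i. chain_norm r (j + i)"
  shows "f_n (j + 4) r = r * (c 3 / c 4) * (c 1 / c 2) *
     ((1 - c 2 / c 3 * (1 + r))\<^sup>2 / (1 + 2*r) + c 0 / c 1 * (r * (1 - c 2 / c 3)\<^sup>2 / (1 + r)))"
proof -
  have "alpha r (j + 4) = c 3 / c 4" "alpha r (j + 4 - 1) = c 2 / c 3" "alpha r (j + 4 - 2) = c 1 / c 2" "alpha r (j + 4 - 3) = c 0 / c 1"
    using alpha_eq[OF r, of "j + 3"] alpha_eq[OF r, of "j + 2"] alpha_eq[OF r, of "j + 1"] alpha_eq[OF r, of j]
    by (simp_all add: c_def eval_nat_numeral)
  then show ?thesis by (simp only: f_n_def)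
qed

lemma f_n_nonneg:
  assumes "r \<ge> 0" "n \<ge> 4"
  shows "f_n n r \<ge> 0"
proof -
  obtain j where n: "n = j + 4" using assms(2) by (metis add.commute le_Suc_ex)
  have "chain_norm r i \<ge> 0" for i using chain_norm_pos[OF assms(1), of i] by simp
  then show ?thesis unfolding n f_n_eq[OF assms(1)] using assms(1)
    by (intro mult_nonneg_nonneg add_nonneg_nonneg divide_nonneg_nonneg) auto
qed

text \<open>The algebra that identifies the bound with \<open>f_n\<close>. The left side is what
  Cauchy-Schwarz leaves for a block, with \<open>x\<close> the squared all-monomer amplitude; the
  last factor on the right is the squared norm of \<open>phi\<close> on the block, and
  \<open>c3 + r * c2\<close> is the next chain norm.\<close>

lemma overlap_scalar_identity:
  fixes r x c0 c1 c2 c3 :: real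
  assumes "r > 0" "c1 > 0" "c2 > 0" "c3 > 0"
  defines "q \<equiv> c3 / c2"
  shows "(1 + r - q)\<^sup>2 * x * c1 / (1 + 2*r) + r * (1 - q)\<^sup>2 * x * c0 / (1 + r) =
    r * (c3 / (c3 + r * c2)) * (c1 / c2) * ((1 - c2 / c3 * (1 + r))\<^sup>2 / (1 + 2*r) + c0 / c1 * (r * (1 - c2 / c3)\<^sup>2 / (1 + r)))
      * (c3 * x + c2 * (q\<^sup>2 * x / r))"
proof -
  have c4: "c3 + r * c2 > 0" using assms by (simp add: add_pos_pos)
  have n: "c3 * x + c2 * (q\<^sup>2 * x / r) = x * c3 * (c3 + r * c2) / (r * c2)"
    using assms by (simp add: q_def power2_eq_square field_simps)
  have 1: "1 - c2 / c3 * (1 + r) = - (1 + r - q) / q" using assms by (simp add: q_def field_simps)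
  have 2: "1 - c2 / c3 = - (1 - q) / q" using assms by (simp add: q_def field_simps)
  have q: "q > 0" "c3 = q * c2" using assms by (simp_all add: q_def)
  let ?u = "(1 + r - q)\<^sup>2 / (1 + 2*r)" and ?v = "r * (1 - q)\<^sup>2 / (1 + r)"
  have "r * (c3 / (c3 + r * c2)) * (c1 / c2) * ((- (1 + r - q) / q)\<^sup>2 / (1 + 2*r) + c0 / c1 * (r * (- (1 - q) / q)\<^sup>2 / (1 + r)))
      * (x * c3 * (c3 + r * c2) / (r * c2))
    = r * (c3 / (c3 + r * c2)) * (c1 / c2) * ((?u + c0 / c1 * ?v) / q\<^sup>2) * (x * c3 * (c3 + r * c2) / (r * c2))"
    by (simp add: power_divide add_divide_distrib power2_commute algebra_simps)
  also have "\<dots> = (c3 / c2)\<^sup>2 / q\<^sup>2 * x * (c1 * ?u + c0 * ?v)"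
  proof -
    have "r * (c3 / (c3 + r * c2)) * (c1 / c2) * (w / q\<^sup>2) * (x * c3 * (c3 + r * c2) / (r * c2)) = (c3 / c2)\<^sup>2 / q\<^sup>2 * x * (c1 * w)" for w
    proof -
      have "r * (c3 / (c3 + r * c2)) * (c1 / c2) * (w / q\<^sup>2) * (x * c3 * (c3 + r * c2) / (r * c2))
        = (r / r) * ((c3 + r * c2) / (c3 + r * c2)) * ((c3 / c2)\<^sup>2 / q\<^sup>2 * x * (c1 * w))"
        by (simp add: power2_eq_square mult_ac)
      then show ?thesis using assms(1) c4 by simp
    qed
    moreover have "c1 * (u + c0 / c1 * v) = c1 * u + c0 * v" for u v using assms(2) by (simp add: distrib_left)
    ultimately show ?thesis by (simp only:)
  qed
  also have "(c3 / c2)\<^sup>2 / q\<^sup>2 = 1" using q(1) by (simp only: q_def[symmetric]) simp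
  finally show ?thesis unfolding n 1 2 by (simp add: algebra_simps)
qed

lemma cauchy_schwarz_two:
  fixes u1 v1 u2 v2 :: real
  shows "(u1 * v1 + u2 * v2)\<^sup>2 \<le> (u1\<^sup>2 + u2\<^sup>2) * (v1\<^sup>2 + v2\<^sup>2)"
proof -
  have "(u1\<^sup>2 + u2\<^sup>2) * (v1\<^sup>2 + v2\<^sup>2) - (u1 * v1 + u2 * v2)\<^sup>2 = (u1 * v2 - u2 * v1)\<^sup>2"
    by (simp add: power2_eq_square algebra_simps)
  then show ?thesis using zero_le_power2[of "u1 * v2 - u2 * v1"] by linarith
qed

lemma cmod_sum_cauchy_schwarz:
  "cmod (\<Sum>i\<in>I. cnj (f i) * g i) \<le> sqrt (\<Sum>i\<in>I. (cmod (f i))\<^sup>2) * sqrt (\<Sum>i\<in>I. (cmod (g i))\<^sup>2)"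
proof -
  have "cmod (\<Sum>i\<in>I. cnj (f i) * g i) \<le> (\<Sum>i\<in>I. \<bar>cmod (f i)\<bar> * \<bar>cmod (g i)\<bar>)"
    by (rule sum_norm_le) (simp add: norm_mult)
  also have "\<dots> \<le> L2_set (\<lambda>i. cmod (f i)) I * L2_set (\<lambda>i. cmod (g i)) I" by (rule L2_set_mult_ineq)
  finally show ?thesis by (simp add: L2_set_def)
qed

section \<open>The overlap on one block and on all blocks\<close>

context chain_overlap
begin

text \<open>Up to three cells fit into the last nine sites, so on this block \<open>chi\<close> is a
  multiple of the chain state, to which \<open>phi\<close> is orthogonal.\<close>

lemma short_block_zero:
  assumes b: "(y, k, A) \<in> blocks" and k: "k \<le> 3"
  shows "(\<Sum>S\<in>chain_block y k A. cnj (chi S) * phi S) = 0"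
proof -
  have bb: "L - 2 \<le> y" "y \<le> L" "1 \<le> k" "-2 \<le> y - 3 * int k" "A \<in> backgrounds (y - 3 * int k)"
    using b by (auto simp: blocks_def)
  have A: "A \<subseteq> {1..y - 3 * int k - 1}" using bb(5) by (auto simp: backgrounds_def)
  let ?d = "chi (A \<union> conf y (replicate k False))"
  have "chi (A \<union> conf y t) = lam ^ dimers t * ?d" if "t \<in> tilings k" for t
  proof -
    have t: "tsize t = k" using that by (simp add: tilings_def)
    have "A \<inter> {y - 3 * int (tsize t) + 1..y} = {}" using A unfolding t by force
    from ground_chain[OF chi _ _ this] show ?thesis using bb k by (simp add: t)
  qed
  then have "(\<Sum>S\<in>chain_block y k A. cnj (chi S) * phi S)
      = (\<Sum>t\<in>tilings k. cnj ?d * (cnj (lam ^ dimers t) * phi (A \<union> conf y t)))"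
    unfolding sum_chain_block[OF b] by (intro sum.cong refl) (simp add: mult_ac)
  also have "\<dots> = cnj ?d * (\<Sum>t\<in>tilings k. cnj (lam ^ dimers t) * phi (A \<union> conf y t))"
    by (simp only: sum_distrib_left)
  also have "\<dots> = 0" using chain_orthogonal[of y k A] bb by simp
  finally show ?thesis .
qed

text \<open>Without its last cell the run lies in the range of \<open>phi\<close>, so
  \<open>phi\<close> is fixed on the block by two amplitudes \<open>a\<close> and \<open>b'\<close>,
  and orthogonality to the chain state ties these together. \<open>chi\<close> only relates
  retilings of the last three cells and is free in the remainder, with amplitudes \<open>d u\<close>
  and \<open>e u\<close>; Cauchy-Schwarz over the remainders optimises over them.\<close>

lemma long_block_bound:
  assumes b: "(y, j + 4, A) \<in> blocks"
  shows "(cmod (\<Sum>S\<in>chain_block y (j + 4) A. cnj (chi S) * phi S))\<^sup>2 \<le> f_n (j + 4) ((cmod lam)\<^sup>2) *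
    (\<Sum>S\<in>chain_block y (j + 4) A. (cmod (chi S))\<^sup>2) * (\<Sum>S\<in>chain_block y (j + 4) A. (cmod (phi S))\<^sup>2)"
proof -
  define r where "r = (cmod lam)\<^sup>2"
  have r: "r > 0" using lam by (simp add: r_def)
  have lc: "cnj lam * lam = of_real r" unfolding r_def by (metis complex_norm_square mult.commute)
  define c where "c i = chain_norm r (j + i)" for i
  have c: "c i > 0" for i using chain_norm_pos[of r] r by (simp add: c_def)
  have c4: "c 4 = c 3 + r * c 2" by (simp add: c_def eval_nat_numeral)
  have bb: "L - 2 \<le> y" "y \<le> L" "-2 \<le> y - 3 * int (j + 4)" "A \<in> backgrounds (y - 3 * int (j + 4))"
    using b by (auto simp: blocks_def)
  have A: "A \<subseteq> {1..y - 3 * int (j + 4) - 1}" using bb(4) by (auto simp: backgrounds_def)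
  have Adis: "A \<inter> {y - 12..} = {}" using A by force
  define a where "a = phi (insert y A \<union> conf (y - 3) (replicate (j + 3) False))"
  define b' where "b' = phi (A \<union> {y - 2, y - 1} \<union> conf (y - 6) (replicate (j + 2) False))"
  define d where "d u = chi (A \<union> conf y (False # False # False # u))" for u
  define e where "e u = chi (A \<union> conf y (False # False # True # u))" for u
  have chi1: "chi (A \<union> conf y (True # v)) = lam * chi (A \<union> conf y (False # False # v))" for v
    by (rule ground_conf_move[OF chi]) (use bb Adis in auto)
  have chi2: "chi (A \<union> conf y (False # True # u)) = lam * d u" for u
  proof -
    have "chi (insert y A \<union> conf (y - 3) (True # u)) = lam * chi (insert y A \<union> conf (y - 3) (False # False # u))"
      by (rule ground_conf_move[OF chi]) (use bb Adis in auto)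
    moreover have "A \<union> conf y (False # v) = insert y A \<union> conf (y - 3) v" for v by auto
    ultimately show ?thesis by (simp only: d_def)
  qed
  have phiF: "phi (A \<union> conf y (False # u)) = lam ^ dimers u * a" if "tsize u = j + 3" for u
  proof -
    have dis: "insert y A \<inter> {y - 3 - 3 * int (tsize u) + 1..y - 3} = {}" unfolding that using A by force
    have "phi (insert y A \<union> conf (y - 3) u) = lam ^ dimers u * phi (insert y A \<union> conf (y - 3) (replicate (tsize u) False))"
      by (rule ground_chain[OF phi(2) _ _ dis]) (use bb that in auto)
    then show ?thesis using that by (simp add: a_def)
  qed
  have phiT: "phi (A \<union> conf y (True # u)) = lam ^ dimers u * b'" if "tsize u = j + 2" for u
  proof -
    have dis: "(A \<union> {y - 2, y - 1}) \<inter> {y - 6 - 3 * int (tsize u) + 1..y - 6} = {}" unfolding that using A by force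
    have "phi (A \<union> {y - 2, y - 1} \<union> conf (y - 6) u) = lam ^ dimers u * phi (A \<union> {y - 2, y - 1} \<union> conf (y - 6) (replicate (tsize u) False))"
      by (rule ground_chain[OF phi(2) _ _ dis]) (use bb that in auto)
    moreover have "A \<union> conf y (True # u) = A \<union> {y - 2, y - 1} \<union> conf (y - 6) u" by auto
    ultimately show ?thesis using that by (simp add: b'_def)
  qed
  have split: "(\<Sum>t\<in>tilings (j + 4). h t) = (\<Sum>u\<in>tilings (j + 3). h (False # u)) + (\<Sum>u\<in>tilings (j + 2). h (True # u))"
    for h :: "bool list \<Rightarrow> 'b::comm_monoid_add"
  proof -
    have "j + 4 = Suc (Suc (j + 2))" "j + 3 = Suc (j + 2)" by simp_all
    then show ?thesis by (simp only: sum_tilings_Suc_Suc)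
  qed
  have ww: "cnj (lam ^ n) * lam ^ n = of_real ((cmod (lam ^ n))\<^sup>2)" for n
    by (metis complex_norm_square mult.commute)
  have rel: "of_real (c 3) * a + cnj lam * of_real (c 2) * b' = 0"
  proof -
    have "0 = (\<Sum>t\<in>tilings (j + 4). cnj (lam ^ dimers t) * phi (A \<union> conf y t))"
      using chain_orthogonal[of y "j + 4" A] bb by simp
    also have "\<dots> = (\<Sum>u\<in>tilings (j + 3). cnj (lam ^ dimers u) * phi (A \<union> conf y (False # u)))
        + (\<Sum>u\<in>tilings (j + 2). cnj (lam * lam ^ dimers u) * phi (A \<union> conf y (True # u)))"
      unfolding split by simp
    also have "(\<Sum>u\<in>tilings (j + 3). cnj (lam ^ dimers u) * phi (A \<union> conf y (False # u))) = (\<Sum>u\<in>tilings (j + 3). of_real ((cmod (lam ^ dimers u))\<^sup>2) * a)"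
      by (intro sum.cong refl) (simp only: tilings_def mem_Collect_eq phiF mult.assoc[symmetric] ww)
    also have "\<dots> = of_real (c 3) * a"
      by (simp only: sum_distrib_right[symmetric] of_real_sum[symmetric] sum_tilings_weight c_def r_def)
    also have "(\<Sum>u\<in>tilings (j + 2). cnj (lam * lam ^ dimers u) * phi (A \<union> conf y (True # u))) = (\<Sum>u\<in>tilings (j + 2). of_real ((cmod (lam ^ dimers u))\<^sup>2) * (cnj lam * b'))"
    proof (intro sum.cong refl)
      fix u assume "u \<in> tilings (j + 2)"
      then have "phi (A \<union> conf y (True # u)) = lam ^ dimers u * b'" by (simp only: tilings_def mem_Collect_eq phiT)
      then have "cnj (lam * lam ^ dimers u) * phi (A \<union> conf y (True # u)) = (cnj (lam ^ dimers u) * lam ^ dimers u) * (cnj lam * b')"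
        by (simp only: complex_cnj_mult mult_ac)
      then show "cnj (lam * lam ^ dimers u) * phi (A \<union> conf y (True # u)) = of_real ((cmod (lam ^ dimers u))\<^sup>2) * (cnj lam * b')"
        by (simp only: ww)
    qed
    also have "\<dots> = of_real (c 2) * (cnj lam * b')"
      by (simp only: sum_distrib_right[symmetric] of_real_sum[symmetric] sum_tilings_weight c_def r_def)
    finally show ?thesis by (simp add: mult_ac)
  qed
  define q where "q = c 3 / c 2"
  have lb: "cnj lam * b' = - of_real q * a"
  proof -
    have "of_real (c 2) * (cnj lam * b') = - (of_real (c 3) * a)" using rel by (simp add: add_eq_0_iff mult_ac)
    then show ?thesis using c[of 2] by (simp add: q_def field_simps)
  qed
  have bn: "(cmod b')\<^sup>2 = q\<^sup>2 * (cmod a)\<^sup>2 / r"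
  proof -
    have "cmod lam * cmod b' = \<bar>q\<bar> * cmod a" using arg_cong[OF lb, of cmod] by (simp add: norm_mult)
    then have "(cmod lam * cmod b')\<^sup>2 = (\<bar>q\<bar> * cmod a)\<^sup>2" by simp
    then show ?thesis using r by (simp add: power_mult_distrib r_def field_simps)
  qed
  have phin: "(\<Sum>S\<in>chain_block y (j + 4) A. (cmod (phi S))\<^sup>2) = c 3 * (cmod a)\<^sup>2 + c 2 * (cmod b')\<^sup>2"
  proof -
    have "(\<Sum>S\<in>chain_block y (j + 4) A. (cmod (phi S))\<^sup>2) = (\<Sum>u\<in>tilings (j + 3). (cmod (phi (A \<union> conf y (False # u))))\<^sup>2)
       + (\<Sum>u\<in>tilings (j + 2). (cmod (phi (A \<union> conf y (True # u))))\<^sup>2)"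
      unfolding sum_chain_block[OF b] split ..
    also have "\<dots> = (\<Sum>u\<in>tilings (j + 3). (cmod (lam ^ dimers u))\<^sup>2 * (cmod a)\<^sup>2) + (\<Sum>u\<in>tilings (j + 2). (cmod (lam ^ dimers u))\<^sup>2 * (cmod b')\<^sup>2)"
      by (intro arg_cong2[of _ _ _ _ "(+)"] sum.cong refl)
         (simp_all only: tilings_def mem_Collect_eq phiF phiT norm_mult power_mult_distrib)
    also have "\<dots> = c 3 * (cmod a)\<^sup>2 + c 2 * (cmod b')\<^sup>2"
      by (simp only: sum_distrib_right[symmetric] sum_tilings_weight c_def r_def)
    finally show ?thesis .
  qed
  define DD EE where "DD = (\<Sum>u\<in>tilings (j + 1). (cmod (d u))\<^sup>2)" and "EE = (\<Sum>u\<in>tilings j. (cmod (e u))\<^sup>2)"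
  have DE: "DD \<ge> 0" "EE \<ge> 0" by (auto simp: DD_def EE_def sum_nonneg)
  have chin: "(\<Sum>S\<in>chain_block y (j + 4) A. (cmod (chi S))\<^sup>2) = (1 + 2 * r) * DD + (1 + r) * EE"
    unfolding sum_chain_block[OF b] sum_tilings_4 chi2 chi1 d_def[symmetric] e_def[symmetric]
    by (simp add: norm_mult power_mult_distrib r_def[symmetric] DD_def EE_def sum_distrib_left sum_distrib_right algebra_simps sum.distrib)
  \<comment> \<open>The contributions of the three tilings of three cells, a + cnj lam b' + r a, and
    of the two tilings with a dimer over cells three and four, after \<open>b'\<close> is eliminated
    by \<open>lb\<close>.\<close>
  define P Q where "P = of_real (1 + r - q) * a" and "Q = lam * of_real (1 - q) * a"
  have mainsum: "(\<Sum>S\<in>chain_block y (j + 4) A. cnj (chi S) * phi S) =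
     (\<Sum>u\<in>tilings (j + 1). cnj (d u) * lam ^ dimers u) * P + (\<Sum>u\<in>tilings j. cnj (e u) * lam ^ dimers u) * Q"
  proof -
    have 1: "cnj (d u) * phi (A \<union> conf y (False # False # False # u)) + cnj (lam * d u) * phi (A \<union> conf y (True # False # u))
        + cnj (lam * d u) * phi (A \<union> conf y (False # True # u)) = cnj (d u) * lam ^ dimers u * P" if "tsize u = j + 1" for u
    proof -
      have "phi (A \<union> conf y (False # False # False # u)) = lam ^ dimers u * a"
        "phi (A \<union> conf y (True # False # u)) = lam ^ dimers u * b'"
        "phi (A \<union> conf y (False # True # u)) = lam * lam ^ dimers u * a"
        using that by (subst phiF phiT; simp)+
      then have "cnj (d u) * phi (A \<union> conf y (False # False # False # u)) + cnj (lam * d u) * phi (A \<union> conf y (True # False # u))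
        + cnj (lam * d u) * phi (A \<union> conf y (False # True # u))
        = cnj (d u) * lam ^ dimers u * (a + cnj lam * b' + (cnj lam * lam) * a)"
        by (simp only: complex_cnj_mult) (simp add: algebra_simps)
      also have "a + cnj lam * b' + (cnj lam * lam) * a = P" unfolding lb lc P_def by (simp add: algebra_simps)
      finally show ?thesis .
    qed
    have 2: "cnj (e u) * phi (A \<union> conf y (False # False # True # u)) + cnj (lam * e u) * phi (A \<union> conf y (True # True # u))
        = cnj (e u) * lam ^ dimers u * Q" if "tsize u = j" for u
    proof -
      have "phi (A \<union> conf y (False # False # True # u)) = lam * lam ^ dimers u * a"
        "phi (A \<union> conf y (True # True # u)) = lam * lam ^ dimers u * b'"
        using that by (subst phiF phiT; simp)+
      then have "cnj (e u) * phi (A \<union> conf y (False # False # True # u)) + cnj (lam * e u) * phi (A \<union> conf y (True # True # u))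
        = cnj (e u) * lam ^ dimers u * (lam * (a + cnj lam * b'))"
        by (simp only: complex_cnj_mult) (simp add: algebra_simps)
      also have "lam * (a + cnj lam * b') = Q" unfolding lb Q_def by (simp add: algebra_simps)
      finally show ?thesis .
    qed
    show ?thesis
      unfolding sum_chain_block[OF b] sum_tilings_4 chi2 chi1 d_def[symmetric] e_def[symmetric] sum_distrib_right
      by (intro arg_cong2[of _ _ _ _ "(+)"] sum.cong refl) (simp_all only: tilings_def mem_Collect_eq 1 2)
  qed
  \<comment> \<open>The factors 1 + 2 r and 1 + r are inserted so that the first factor in the next
    Cauchy-Schwarz step is exactly the norm of \<open>chi\<close> on the block.\<close>
  have "cmod (\<Sum>S\<in>chain_block y (j + 4) A. cnj (chi S) * phi S) \<le>
     sqrt ((1 + 2 * r) * DD) * (sqrt (c 1 / (1 + 2 * r)) * cmod P) + sqrt ((1 + r) * EE) * (sqrt (c 0 / (1 + r)) * cmod Q)"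
  proof -
    have "cmod (\<Sum>u\<in>tilings (j + 1). cnj (d u) * lam ^ dimers u) \<le> sqrt DD * sqrt (c 1)"
      using cmod_sum_cauchy_schwarz[of d "\<lambda>u. lam ^ dimers u" "tilings (j + 1)"]
      unfolding DD_def c_def r_def sum_tilings_weight .
    moreover have "cmod (\<Sum>u\<in>tilings j. cnj (e u) * lam ^ dimers u) \<le> sqrt EE * sqrt (c 0)"
      using cmod_sum_cauchy_schwarz[of e "\<lambda>u. lam ^ dimers u" "tilings j"]
      unfolding EE_def c_def r_def sum_tilings_weight by simp
    ultimately have "cmod ((\<Sum>u\<in>tilings (j + 1). cnj (d u) * lam ^ dimers u) * P + (\<Sum>u\<in>tilings j. cnj (e u) * lam ^ dimers u) * Q)
        \<le> sqrt DD * sqrt (c 1) * cmod P + sqrt EE * sqrt (c 0) * cmod Q"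
      by (intro order_trans[OF norm_triangle_ineq] add_mono) (simp_all add: norm_mult mult_right_mono)
    moreover have "sqrt ((1 + 2 * r) * DD) * (sqrt (c 1 / (1 + 2 * r)) * cmod P) = sqrt DD * sqrt (c 1) * cmod P"
      using r by (simp add: real_sqrt_mult real_sqrt_divide)
    moreover have "sqrt ((1 + r) * EE) * (sqrt (c 0 / (1 + r)) * cmod Q) = sqrt EE * sqrt (c 0) * cmod Q"
      using r by (simp add: real_sqrt_mult real_sqrt_divide)
    ultimately show ?thesis unfolding mainsum by (simp only:)
  qed
  then have "(cmod (\<Sum>S\<in>chain_block y (j + 4) A. cnj (chi S) * phi S))\<^sup>2 \<le>
     (sqrt ((1 + 2 * r) * DD) * (sqrt (c 1 / (1 + 2 * r)) * cmod P) + sqrt ((1 + r) * EE) * (sqrt (c 0 / (1 + r)) * cmod Q))\<^sup>2"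
    by (rule power_mono) simp
  also have "\<dots> \<le> ((sqrt ((1 + 2 * r) * DD))\<^sup>2 + (sqrt ((1 + r) * EE))\<^sup>2) * ((sqrt (c 1 / (1 + 2 * r)) * cmod P)\<^sup>2 + (sqrt (c 0 / (1 + r)) * cmod Q)\<^sup>2)"
    by (rule cauchy_schwarz_two)
  also have "(sqrt ((1 + 2 * r) * DD))\<^sup>2 + (sqrt ((1 + r) * EE))\<^sup>2 = (1 + 2 * r) * DD + (1 + r) * EE"
    using r DE by simp
  also have "(sqrt (c 1 / (1 + 2 * r)) * cmod P)\<^sup>2 + (sqrt (c 0 / (1 + r)) * cmod Q)\<^sup>2
      = (1 + r - q)\<^sup>2 * (cmod a)\<^sup>2 * c 1 / (1 + 2*r) + r * (1 - q)\<^sup>2 * (cmod a)\<^sup>2 * c 0 / (1 + r)"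
  proof -
    have "(cmod P)\<^sup>2 = (1 + r - q)\<^sup>2 * (cmod a)\<^sup>2" "(cmod Q)\<^sup>2 = r * (1 - q)\<^sup>2 * (cmod a)\<^sup>2"
      by (simp_all only: P_def Q_def norm_mult norm_of_real power_mult_distrib power2_abs r_def)
    then show ?thesis using r c[of 1] c[of 0] by (simp add: power_mult_distrib mult_ac)
  qed
  also have "\<dots> = f_n (j + 4) r * (c 3 * (cmod a)\<^sup>2 + c 2 * (cmod b')\<^sup>2)"
    using overlap_scalar_identity[of r "c 1" "c 2" "c 3" "(cmod a)\<^sup>2" "c 0"] f_n_eq[of r j] r c
    by (simp only: bn q_def c4[symmetric] c_def[symmetric] order_less_imp_le)
  finally show ?thesis unfolding chin phin r_def[symmetric] by (simp only: mult_ac)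
qed

text \<open>The blocks are disjoint and carry the whole inner product, so blockwise bounds with a
  common constant add up by Cauchy-Schwarz.\<close>

lemma overlap_bound:
  assumes f: "f \<ge> 0" "\<And>n. n \<ge> 4 \<Longrightarrow> f_n n ((cmod lam)\<^sup>2) \<le> f"
  shows "cmod (finner {1..L} chi phi) \<le> sqrt f * fnorm {1..L} chi * fnorm {1..L} phi"
proof -
  let ?F = "\<lambda>S. cnj (chi S) * phi S"
  define X Z where "X b = sqrt (\<Sum>S\<in>block b. (cmod (chi S))\<^sup>2)" and "Z b = sqrt (\<Sum>S\<in>block b. (cmod (phi S))\<^sup>2)" for b
  have fin: "finite (block b)" for b by (cases b) (simp add: chain_block_def finite_tilings)
  have U: "(\<Union>b\<in>blocks. block b) \<subseteq> Pow {1..L}"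
  proof
    fix S assume "S \<in> (\<Union>b\<in>blocks. block b)"
    then obtain y k A where yk: "(y, k, A) \<in> blocks" "S \<in> chain_block y k A" by auto
    have "S \<subseteq> {1..y}" by (rule block_last(1)[OF yk])
    moreover have "y \<le> L" using yk(1) by (simp add: blocks_def)
    ultimately show "S \<in> Pow {1..L}" by force
  qed
  have dis: "\<forall>i\<in>blocks. \<forall>j\<in>blocks. i \<noteq> j \<longrightarrow> block i \<inter> block j = {}" using block_disjoint by blast
  have "finner {1..L} chi phi = (\<Sum>S\<in>(\<Union>b\<in>blocks. block b). ?F S)"
    unfolding finner_def
  proof (rule sum.mono_neutral_right[OF _ U])
    show "\<forall>S\<in>Pow {1..L} - (\<Union>b\<in>blocks. block b). cnj (chi S) * phi S = 0"
    proof
      fix S assume S: "S \<in> Pow {1..L} - (\<Union>b\<in>blocks. block b)"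
      then have "chi S = 0 \<or> phi S = 0" using block_cover[of S] by auto
      then show "cnj (chi S) * phi S = 0" by auto
    qed
  qed simp
  also have "\<dots> = (\<Sum>b\<in>blocks. \<Sum>S\<in>block b. ?F S)"
    by (rule sum.UNION_disjoint[OF finite_blocks _ dis]) (simp add: fin)
  finally have "cmod (finner {1..L} chi phi) \<le> (\<Sum>b\<in>blocks. cmod (\<Sum>S\<in>block b. ?F S))" by (simp add: norm_sum)
  also have "\<dots> \<le> (\<Sum>b\<in>blocks. sqrt f * (\<bar>X b\<bar> * \<bar>Z b\<bar>))"
  proof (rule sum_mono)
    fix b assume b: "b \<in> blocks"
    obtain y k A where bb: "b = (y, k, A)" by (cases b)
    have XZ: "X b \<ge> 0" "Z b \<ge> 0" "(X b)\<^sup>2 = (\<Sum>S\<in>block b. (cmod (chi S))\<^sup>2)" "(Z b)\<^sup>2 = (\<Sum>S\<in>block b. (cmod (phi S))\<^sup>2)"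
      by (auto simp: X_def Z_def sum_nonneg)
    show "cmod (\<Sum>S\<in>block b. ?F S) \<le> sqrt f * (\<bar>X b\<bar> * \<bar>Z b\<bar>)"
    proof (cases "k \<le> 3")
      case True
      have "(\<Sum>S\<in>chain_block y k A. ?F S) = 0" using short_block_zero[of y k A] b True bb by simp
      then show ?thesis using f XZ by (simp add: bb)
    next
      case False
      then obtain j where k: "k = j + 4" by (metis add.commute le_Suc_ex not_less_eq_eq numeral_3_eq_3 numeral_eq_Suc pred_numeral_simps(2) semiring_norm(26) semiring_norm(27) semiring_norm(28))
      have "(cmod (\<Sum>S\<in>block b. ?F S))\<^sup>2 \<le> f_n k ((cmod lam)\<^sup>2) * (X b)\<^sup>2 * (Z b)\<^sup>2"
        using long_block_bound[of y j A] b unfolding XZ(3,4) unfolding bb k by simp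
      also have "\<dots> \<le> f * (X b)\<^sup>2 * (Z b)\<^sup>2" using f(2)[of k] k by (intro mult_right_mono) auto
      also have "\<dots> = (sqrt f * (\<bar>X b\<bar> * \<bar>Z b\<bar>))\<^sup>2" using f(1) by (simp add: power_mult_distrib)
      finally show ?thesis by (rule power2_le_imp_le) (use f in simp)
    qed
  qed
  also have "\<dots> = sqrt f * (\<Sum>b\<in>blocks. \<bar>X b\<bar> * \<bar>Z b\<bar>)" by (simp add: sum_distrib_left)
  also have "\<dots> \<le> sqrt f * (L2_set X blocks * L2_set Z blocks)"
    using f by (intro mult_left_mono L2_set_mult_ineq) auto
  also have "\<dots> \<le> sqrt f * (fnorm {1..L} chi * fnorm {1..L} phi)"
  proof -
    have *: "(\<Sum>b\<in>blocks. (sqrt (\<Sum>S\<in>block b. (cmod (psi S))\<^sup>2))\<^sup>2) \<le> sqn {1..L} psi" for psi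
    proof -
      have "(\<Sum>b\<in>blocks. (sqrt (\<Sum>S\<in>block b. (cmod (psi S))\<^sup>2))\<^sup>2) = (\<Sum>b\<in>blocks. \<Sum>S\<in>block b. (cmod (psi S))\<^sup>2)"
        by (simp add: sum_nonneg)
      also have "\<dots> = (\<Sum>S\<in>(\<Union>b\<in>blocks. block b). (cmod (psi S))\<^sup>2)"
        by (rule sum.UNION_disjoint[OF finite_blocks _ dis, symmetric]) (simp add: fin)
      also have "\<dots> \<le> sqn {1..L} psi" unfolding sqn_def using U by (intro sum_mono2) auto
      finally show ?thesis .
    qed
    have "L2_set X blocks \<le> fnorm {1..L} chi" "L2_set Z blocks \<le> fnorm {1..L} phi"
      unfolding L2_set_def fnorm_eq X_def Z_def using * by (auto intro!: real_sqrt_le_mono)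
    then show ?thesis using f by (intro mult_left_mono mult_mono) (auto simp: fnorm_eq sqn_nonneg)
  qed
  finally show ?thesis by (simp add: mult.assoc)
qed

end

text \<open>At \<open>lam = 0\<close> every ground state condition forbids single configurations.
  \<open>chi\<close> vanishes on those forbidden in the last nine sites. \<open>phi\<close> with
  them removed is a ground state of the full chain to which \<open>phi\<close> is orthogonal, hence
  zero: \<open>chi\<close> and \<open>phi\<close> have disjoint supports.\<close>

lemma overlap_zero:
  assumes L: "L \<ge> 11" and phi: "phi \<in> fock {1..L}" "ground 0 1 (L - 3) phi"
    and orth: "\<And>theta. theta \<in> fock {1..L} \<Longrightarrow> ground 0 1 L theta \<Longrightarrow> finner {1..L} theta phi = 0"
    and chi: "ground 0 (L - 8) L chi"
  shows "finner {1..L} chi phi = 0"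
proof -
  define bad where "bad S \<longleftrightarrow> (\<exists>x. L - 8 \<le> x \<and> x + 2 \<le> L \<and> x \<in> S \<and> x + 2 \<in> S) \<or>
    (\<exists>x. L - 8 \<le> x \<and> x + 3 \<le> L \<and> x + 1 \<in> S \<and> x + 2 \<in> S \<and> x \<notin> S \<and> x + 3 \<notin> S)" for S
  have chi0: "chi S = 0" if "bad S" for S
    using that unfolding bad_def
  proof (elim disjE exE conjE)
    fix x assume "L - 8 \<le> x" "x + 2 \<le> L" "x \<in> S" "x + 2 \<in> S"
    then show ?thesis using ground_distance_two[OF chi, of x S "x + 2"] by simp
  next
    fix x assume x: "L - 8 \<le> x" "x + 3 \<le> L" "x + 1 \<in> S" "x + 2 \<in> S" "x \<notin> S" "x + 3 \<notin> S"
    let ?T = "S - {x + 1, x + 2}"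
    have T: "?T \<inter> {x..x+3} = {}"
    proof -
      have "u = x \<or> u = x + 1 \<or> u = x + 2 \<or> u = x + 3" if "u \<in> {x..x+3}" for u using that by auto
      then show ?thesis using x by blast
    qed
    have "?T \<union> {x + 1, x + 2} = S" using x by auto
    then show ?thesis using ground_move[OF chi x(1,2) T] by simp
  qed
  define theta where "theta S = (if bad S then 0 else phi S)" for S
  have "theta \<in> fock {1..L}" using phi(1) by (simp add: theta_def fock_def)
  moreover have "ground 0 1 L theta" unfolding ground_def
  proof (intro conjI allI impI; elim conjE)
    fix x S assume x: "1 \<le> x" "x + 2 \<le> L" "x \<in> S" "x + 2 \<in> S"
    show "theta S = 0"
    proof (cases "x + 2 \<le> L - 3")
      case True
      then show ?thesis using ground_distance_two[OF phi(2) x(3,4)] x by (simp add: theta_def)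
    next
      case False
      then have "bad S" unfolding bad_def using x by (intro disjI1 exI[of _ x]) auto
      then show ?thesis by (simp add: theta_def)
    qed
  next
    fix x T assume x: "1 \<le> x" "x + 3 \<le> L" "T \<inter> {x..x+3} = {}"
    show "theta (T \<union> {x + 1, x + 2}) = 0 * theta (T \<union> {x, x + 3})"
    proof (cases "x + 3 \<le> L - 3")
      case True
      then show ?thesis using ground_move[OF phi(2) x(1) _ x(3)] by (simp add: theta_def)
    next
      case False
      then have "bad (T \<union> {x + 1, x + 2})" unfolding bad_def using x by (intro disjI2 exI[of _ x]) auto
      then show ?thesis by (simp add: theta_def)
    qed
  qed
  ultimately have "(\<Sum>S\<in>Pow {1..L}. cnj (theta S) * phi S) = 0" using orth by (simp add: finner_def)
  moreover have "(\<Sum>S\<in>Pow {1..L}. cnj (theta S) * phi S) = complex_of_real (\<Sum>S\<in>Pow {1..L}. (cmod (theta S))\<^sup>2)"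
    unfolding of_real_sum
  proof (intro sum.cong refl)
    fix S
    have "cnj (theta S) * phi S = cnj (theta S) * theta S" by (simp add: theta_def)
    then show "cnj (theta S) * phi S = complex_of_real ((cmod (theta S))\<^sup>2)"
      by (metis complex_norm_square mult.commute)
  qed
  ultimately have "(\<Sum>S\<in>Pow {1..L}. (cmod (theta S))\<^sup>2) = 0" by (metis of_real_eq_0_iff)
  then have "\<forall>S\<in>Pow {1..L}. theta S = 0" by (subst (asm) sum_nonneg_eq_0_iff) auto
  then have theta0: "theta S = 0" if "S \<in> Pow {1..L}" for S using that by blast
  have "cnj (chi S) * phi S = 0" if "S \<in> Pow {1..L}" for S
  proof (cases "bad S")
    case True
    then show ?thesis using chi0 by simp
  next
    case False
    then show ?thesis using theta0[OF that] by (simp add: theta_def)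
  qed
  then show ?thesis unfolding finner_def by (intro sum.neutral) auto
qed

section \<open>Uniform gap of the open chain\<close>

lemma window_prefix:
  assumes "0 \<le> L1" "L1 \<le> L"
  obtains rho where "window {1..L} id L1 rho"
proof -
  have "\<exists>rho. window {1..L} (\<lambda>x. id (0 + x)) L1 rho"
    by (rule window_shift_exists) (use assms in auto)
  moreover have "(\<lambda>x. id (0 + x)) = (id :: int \<Rightarrow> int)" by auto
  ultimately show ?thesis using that by auto
qed

lemma ker_iff_ground:
  assumes "kap > 0" "0 \<le> a" "b \<le> L" "psi \<in> fock {1..L}"
  shows "psi \<in> ker_op {1..L} (H_terms kap lam id {a+1..b-2} {a+1..b-3}) \<longleftrightarrow> ground lam (a + 1) b psi"
proof -
  have ts: "term_sites id {a+1..b-2} {a+1..b-3} \<subseteq> {1..L}" using assms by (auto simp: term_sites_def)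
  show ?thesis
    using H_terms_eq_0_iff[OF _ assms(1) _ _ ts assms(4), of lam] kernel_iff_ground[OF assms(4), of "a + 1" b lam] assms(4)
    by (simp add: ker_op_def)
qed

text \<open>The sites beyond \<open>L1\<close> are spectators: over each of their configurations the
  fibres satisfy the hypotheses of the chain overlap, and Cauchy-Schwarz over the fibres recombines
  the bounds.\<close>

lemma segment_overlap:
  assumes kap: "kap > 0" and L1: "L1 \<ge> 11" "L1 \<le> L"
    and f: "f \<ge> 0" "\<And>n. n \<ge> 4 \<Longrightarrow> f_n n ((cmod lam)\<^sup>2) \<le> f"
    and y: "y \<in> KV {1..L} (H_seg kap lam id 0 (L1 - 3))"
    and orth: "\<And>v. v \<in> KV {1..L} (H_seg kap lam id 0 L1) \<Longrightarrow> inner y v = 0"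
    and z: "z \<in> KV {1..L} (H_seg kap lam id (L1 - 9) L1)"
  shows "inner z y \<le> sqrt f * norm z * norm y"
proof -
  obtain rho where "window {1..L} id L1 rho" using window_prefix[of L1 L] L1 by auto
  then interpret window "{1..L}" id L1 rho .
  have zF: "z \<in> FV {1..L}" and yF: "y \<in> FV {1..L}" using y z by (auto simp: KV_def)
  let ?F = "\<lambda>T. fib T (amp z)" and ?G = "\<lambda>T. fib T (amp y)"
  have b: "cmod (finner {1..L1} (?F T) (?G T)) \<le> sqrt f * fnorm {1..L1} (?F T) * fnorm {1..L1} (?G T)" if T: "T \<in> outs" for T
  proof -
    have g1: "ground lam 1 (L1 - 3) (?G T)"
    proof -
      have "amp y \<in> ker_op {1..L} (H_terms kap lam id {0+1..L1-3-2} {0+1..L1-3-3})"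
        using y by (simp add: KV_eq_ker H_seg_def)
      then have "?G T \<in> ker_op {1..L1} (H_terms kap lam id {0+1..L1-3-2} {0+1..L1-3-3})"
        by (intro fib_kernel[OF T]) auto
      then show ?thesis using ker_iff_ground[OF kap, of 0 "L1 - 3" L1 "?G T" lam] fib_fock by simp
    qed
    have g2: "ground lam (L1 - 8) L1 (?F T)"
    proof -
      have "amp z \<in> ker_op {1..L} (H_terms kap lam id {L1-9+1..L1-2} {L1-9+1..L1-3})"
        using z by (simp add: KV_eq_ker H_seg_def)
      then have "?F T \<in> ker_op {1..L1} (H_terms kap lam id {L1-9+1..L1-2} {L1-9+1..L1-3})"
        by (intro fib_kernel[OF T]) (use L1 in auto)
      then show ?thesis using ker_iff_ground[OF kap, of "L1 - 9" L1 L1 "?F T" lam] fib_fock L1 by simp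
    qed
    have o: "finner {1..L1} theta (?G T) = 0" if theta: "theta \<in> fock {1..L1}" "ground lam 1 L1 theta" for theta
    proof (rule fib_orth[OF T])
      show "theta \<in> ker_op {1..L1} (H_terms kap lam id {1..L1-2} {1..L1-3})"
        using ker_iff_ground[OF kap, of 0 L1 L1 theta lam] theta by simp
      show "finner {1..L} phi (amp y) = 0" if "phi \<in> ker_op {1..L} (H_terms kap lam id {1..L1-2} {1..L1-3})" for phi
        by (rule finner_kernel_eq_0[OF _ flinear_H_terms yF _ that]) (use orth in \<open>simp_all add: H_seg_def\<close>)
    qed auto
    show ?thesis
    proof (cases "lam = 0")
      case True
      have "finner {1..L1} (?F T) (?G T) = 0"
        by (rule overlap_zero) (use L1 fib_fock g1 g2 o True in auto)
      then show ?thesis using f by (simp add: fnorm_eq sqn_nonneg)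
    next
      case False
      then have "chain_overlap lam L1 (?G T) (?F T)" by unfold_locales (use L1 fib_fock g1 g2 o in auto)
      from chain_overlap.overlap_bound[OF this f] show ?thesis by simp
    qed
  qed
  have "inner z y = (\<Sum>T\<in>outs. Re (finner {1..L1} (?F T) (?G T)))"
    using inner_eq_finner[OF _ zF, of y] finner_fib[of "amp z" "amp y"] by simp
  also have "\<dots> \<le> (\<Sum>T\<in>outs. sqrt f * (\<bar>fnorm {1..L1} (?F T)\<bar> * \<bar>fnorm {1..L1} (?G T)\<bar>))"
  proof (rule sum_mono)
    fix T assume "T \<in> outs"
    from b[OF this] show "Re (finner {1..L1} (?F T) (?G T)) \<le> sqrt f * (\<bar>fnorm {1..L1} (?F T)\<bar> * \<bar>fnorm {1..L1} (?G T)\<bar>)"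
      using complex_Re_le_cmod[of "finner {1..L1} (?F T) (?G T)"] by (simp add: fnorm_eq sqn_nonneg mult.assoc)
  qed
  also have "\<dots> \<le> sqrt f * (L2_set (\<lambda>T. fnorm {1..L1} (?F T)) outs * L2_set (\<lambda>T. fnorm {1..L1} (?G T)) outs)"
    unfolding sum_distrib_left[symmetric] using f by (intro mult_left_mono L2_set_mult_ineq) auto
  also have "L2_set (\<lambda>T. fnorm {1..L1} (?F T)) outs = norm z"
    using sqn_fib[of "amp z"] sqn_amp[OF _ zF] by (simp add: L2_set_def fnorm_eq sqn_nonneg norm_eq_sqrt_inner)
  also have "L2_set (\<lambda>T. fnorm {1..L1} (?G T)) outs = norm y"
    using sqn_fib[of "amp y"] sqn_amp[OF _ yF] by (simp add: L2_set_def fnorm_eq sqn_nonneg norm_eq_sqrt_inner)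
  finally show ?thesis by (simp add: mult.assoc)
qed

text \<open>The indices of the intervals containing a given point span at most three consecutive
  values, starting from the smallest one.\<close>

lemma sum_cover_le:
  fixes t :: "int \<Rightarrow> real" and I :: "nat \<Rightarrow> int set"
  assumes t: "\<And>x. t x \<ge> 0" and J: "finite J" "\<And>j. j \<le> m \<Longrightarrow> I j \<subseteq> J"
    and close: "\<And>x j j'. j < j' \<Longrightarrow> j' \<le> m \<Longrightarrow> x \<in> I j \<Longrightarrow> x \<in> I j' \<Longrightarrow> j' \<le> j + 2"
  shows "(\<Sum>j\<le>m. \<Sum>x\<in>I j. t x) \<le> 3 * (\<Sum>x\<in>J. t x)"
proof -
  have c3: "card {j. j \<le> m \<and> x \<in> I j} \<le> 3" for x
  proof (cases "{j. j \<le> m \<and> x \<in> I j} = {}")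
    case False
    let ?C = "{j. j \<le> m \<and> x \<in> I j}"
    have fC: "finite ?C" by (rule finite_subset[of _ "{..m}"]) auto
    define k where "k = Min ?C"
    have k: "k \<in> ?C" using Min_in[OF fC False] by (simp add: k_def)
    have "?C \<subseteq> {k..k+2}"
    proof
      fix j assume j: "j \<in> ?C"
      have "k \<le> j" using Min_le[OF fC j] by (simp add: k_def)
      then show "j \<in> {k..k+2}" using close[of k j x] j k by (cases "k = j") auto
    qed
    then have "card ?C \<le> card {k..k+2}" by (intro card_mono) auto
    then show ?thesis by simp
  qed (simp only: card.empty)
  have "(\<Sum>j\<le>m. \<Sum>x\<in>I j. t x) = (\<Sum>j\<le>m. \<Sum>x\<in>J. if x \<in> I j then t x else 0)"
  proof (rule sum.cong[OF refl])
    fix j assume "j \<in> {..m}"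
    then have "{x \<in> J. x \<in> I j} = I j" using J by auto
    then show "(\<Sum>x\<in>I j. t x) = (\<Sum>x\<in>J. if x \<in> I j then t x else 0)"
      using sum.inter_filter[OF J(1), of t "\<lambda>x. x \<in> I j"] by simp
  qed
  also have "\<dots> = (\<Sum>x\<in>J. \<Sum>j\<le>m. if x \<in> I j then t x else 0)" by (rule sum.swap)
  also have "\<dots> \<le> (\<Sum>x\<in>J. 3 * t x)"
  proof (rule sum_mono)
    fix x
    have "(\<Sum>j\<le>m. if x \<in> I j then t x else 0) = (\<Sum>j\<in>{j\<in>{..m}. x \<in> I j}. t x)"
      by (rule sum.inter_filter[symmetric]) simp
    also have "\<dots> = card {j. j \<le> m \<and> x \<in> I j} * t x" by simp
    also have "\<dots> \<le> 3 * t x" using c3[of x] t[of x] by (intro mult_right_mono) auto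
    finally show "(\<Sum>j\<le>m. if x \<in> I j then t x else 0) \<le> 3 * t x" .
  qed
  finally show ?thesis by (simp add: sum_distrib_left)
qed

text \<open>The chain grows from \<open>m0\<close> sites by three at a time, each stage after the
  first being tested on its last nine sites. Starting from at least eight sites makes the first
  extended chain have the eleven sites required by the overlap bound; 8, 9 and 10 cover the residues
  modulo 3.\<close>

lemma open_gap_bound:
  assumes kap: "kap > 0" and m0: "m0 \<in> {8, 9, 10}"
    and f: "f \<ge> 0" "\<And>n. n \<ge> 4 \<Longrightarrow> f_n n ((cmod lam)\<^sup>2) \<le> f" "f < 1/3"
    and g: "g \<le> gap_open kap lam 9" "g \<le> gap_open kap lam m0" "g \<ge> 0"
  shows "g / 3 * (1 - sqrt (3 * f))\<^sup>2 \<le> gap_open kap lam (m0 + 3 * int m)"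
proof -
  define L where "L = m0 + 3 * int m"
  define e where "e j = m0 + 3 * int (min j m)" for j
  define a where "a j = (if 1 \<le> j \<and> j \<le> m then e j - 9 else 0)" for j
  define G where "G j = KV {1..L} (H_seg kap lam id 0 (e j))" for j
  define W where "W j = KV {1..L} (H_seg kap lam id (a j) (e j))" for j
  have e: "8 \<le> e j" "e j \<le> L" for j using m0 by (auto simp: e_def L_def)
  have a: "0 \<le> a j" for j
  proof -
    have "1 \<le> j \<and> j \<le> m \<Longrightarrow> e j \<ge> 11" using m0 by (auto simp: e_def)
    then show ?thesis by (auto simp: a_def)
  qed
  have inj: "inj_on id X" for X :: "int set" by simp
  have img: "id ` {u+1..v} \<subseteq> {1..L}" if "0 \<le> u" "v \<le> L" for u v using that by auto
  have mono: "KV {1..L} (H_seg kap lam id u v) \<subseteq> KV {1..L} (H_seg kap lam id u' v')"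
    if "0 \<le> u" "u \<le> u'" "v' \<le> v" "v \<le> L" for u v u' v'
  proof
    fix x assume "x \<in> KV {1..L} (H_seg kap lam id u v)"
    moreover have "{u'+1..v'-2} \<subseteq> {u+1..v-2}" "{u'+1..v'-3} \<subseteq> {u+1..v-3}" using that by auto
    moreover have u': "0 \<le> u'" "v' \<le> L" using that by auto
    ultimately show "x \<in> KV {1..L} (H_seg kap lam id u' v')"
      unfolding KV_seg_iff[OF kap inj img[OF u']] KV_seg_iff[OF kap inj img[OF that(1,4)]] by blast
  qed
  have Gd: "fdim_subspace (G j)" for j unfolding G_def by (rule fdim_KV_seg[OF kap inj img]) (use e in auto)
  have Wd: "fdim_subspace (W j)" for j unfolding W_def by (rule fdim_KV_seg[OF kap inj img]) (use e a in auto)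
  have Gdec: "G j \<subseteq> G i" if "i \<le> j" for i j
  proof -
    have "e i \<le> e j" using that by (auto simp: e_def)
    then show ?thesis unfolding G_def using e by (intro mono) auto
  qed
  have GW: "G j \<subseteq> W j" for j
    unfolding G_def W_def using e a by (intro mono) auto
  have ts: "term_sites id {u+1..v-2} {u+1..v-3} \<subseteq> {u+1..v}" for u v
    using term_sites_interval[of id u v] by simp
  have comm: "oproj (W j) (oproj (G i) y) = oproj (G i) (oproj (W j) y)"
    if "i + 3 \<le> j" "j \<le> m" "y \<in> FV {1..L}" for i j y
  proof -
    have "a j \<ge> e i" using that by (simp add: a_def e_def)
    then have "{a j+1..e j} \<inter> {0+1..e i} = {}" by auto
    then have "term_sites id {a j+1..e j-2} {a j+1..e j-3} \<inter> term_sites id {0+1..e i-2} {0+1..e i-3} = {}"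
      using ts[of "a j" "e j"] ts[of 0 "e i"] by blast
    moreover have "{a j+1..e j} \<subseteq> {1..L}" "{0+1..e i} \<subseteq> {1..L}" using a[of j] e[of i] e[of j] by auto
    then have "term_sites id {a j+1..e j-2} {a j+1..e j-3} \<subseteq> {1..L}" "term_sites id {0+1..e i-2} {0+1..e i-3} \<subseteq> {1..L}"
      using ts[of "a j" "e j"] ts[of 0 "e i"] by blast+
    ultimately show ?thesis
      unfolding W_def G_def H_seg_def using that by (intro H_terms_projections_commute) auto
  qed
  have sf: "sqrt 3 * sqrt f \<le> 1"
  proof -
    have "sqrt (3 * f) \<le> sqrt 1" using f by (intro real_sqrt_le_mono) simp
    then show ?thesis by (simp add: real_sqrt_mult)
  qed
  have gW: "g * inner (x - oproj (W j) x) (x - oproj (W j) x) \<le> E_seg {1..L} kap lam id (a j) (e j) (amp x)"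
    if x: "x \<in> FV {1..L}" and jm: "j \<le> m" for x j
  proof -
    have "g \<le> gap_open kap lam (e j - a j)"
      using g jm by (cases j) (auto simp: a_def e_def)
    then have "g * inner (x - oproj (W j) x) (x - oproj (W j) x) \<le> gap_open kap lam (e j - a j) * inner (x - oproj (W j) x) (x - oproj (W j) x)"
      by (intro mult_right_mono) auto
    also have "\<dots> \<le> E_seg {1..L} kap lam id (a j) (e j) (amp x)"
      by (rule seg_gap_proj[OF kap inj img x]) (use a e in \<open>auto simp: W_def\<close>)
    finally show ?thesis .
  qed
  have cover: "(\<Sum>j\<le>m. E_seg {1..L} kap lam id (a j) (e j) psi) \<le> 3 * energy {1..L} kap lam id {1..L-2} {1..L-3} psi" for psi
  proof -
    define t1 t2 where "t1 y = sqn {1..L} (nn_term id y psi)" and "t2 y = sqn {1..L} (qop lam id y psi)" for y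
    have close: "j' \<le> j + 2" if "j < j'" "j' \<le> m" "x \<in> {a j+1..e j-c}" "x \<in> {a j'+1..e j'-c}" "c \<in> {2,3}" for x c j j'
      using that by (auto simp: a_def e_def split: if_splits)
    have "(\<Sum>j\<le>m. \<Sum>y\<in>{a j+1..e j-2}. t1 y) \<le> 3 * (\<Sum>y\<in>{1..L-2}. t1 y)"
    proof (rule sum_cover_le)
      show "{a j+1..e j-2} \<subseteq> {1..L-2}" for j using a[of j] e[of j] by auto
      show "j' \<le> j + 2" if "j < j'" "j' \<le> m" "x \<in> {a j+1..e j-2}" "x \<in> {a j'+1..e j'-2}" for x j j'
        using close[OF that] by simp
    qed (auto simp: t1_def sqn_nonneg)
    moreover have "(\<Sum>j\<le>m. \<Sum>y\<in>{a j+1..e j-3}. t2 y) \<le> 3 * (\<Sum>y\<in>{1..L-3}. t2 y)"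
    proof (rule sum_cover_le)
      show "{a j+1..e j-3} \<subseteq> {1..L-3}" for j using a[of j] e[of j] by auto
      show "j' \<le> j + 2" if "j < j'" "j' \<le> m" "x \<in> {a j+1..e j-3}" "x \<in> {a j'+1..e j'-3}" for x j j'
        using close[OF that] by simp
    qed (auto simp: t2_def sqn_nonneg)
    then have "kap * (\<Sum>j\<le>m. \<Sum>y\<in>{a j+1..e j-3}. t2 y) \<le> kap * (3 * (\<Sum>y\<in>{1..L-3}. t2 y))"
      using kap by (intro mult_left_mono) auto
    ultimately show ?thesis
      by (simp add: E_seg_def energy_def t1_def t2_def sum.distrib sum_distrib_left[symmetric] algebra_simps)
  qed
  have Gm: "G m = KV {1..L} (H_terms kap lam id {1..L-2} {1..L-3})"
    by (simp add: G_def e_def L_def H_seg_def)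
  have "g / 3 * (1 - sqrt 3 * sqrt f)\<^sup>2 \<le> op_gap {1..L} (H_terms kap lam id {1..L-2} {1..L-3})"
  proof (rule op_gap_greatest_H_terms[OF kap])
    show "term_sites id {1..L-2} {1..L-3} \<subseteq> {1..L}" using ts[of 0 L] by simp
    show "1 \<in> {1..L-2}" "3 \<le> L" using m0 by (auto simp: L_def)
    fix x assume x: "x \<in> FV {1..L}" and orth: "\<And>y. y \<in> KV {1..L} (H_terms kap lam id {1..L-2} {1..L-3}) \<Longrightarrow> inner x y = 0"
    have "(1 - sqrt 3 * sqrt f)\<^sup>2 * inner x x \<le> (\<Sum>j\<le>m. inner (x - oproj (W j) x) (x - oproj (W j) x))"
    proof (rule martingale_bound[OF Gd Wd Gdec GW _ comm _ sf _ x])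
      show "W 0 = G 0" by (simp add: W_def G_def a_def)
      show "0 \<le> sqrt f" using f by simp
      show "inner x v = 0" if "v \<in> G m" for v using orth that by (simp add: Gm)
      fix j y z assume jm: "Suc j \<le> m" and y: "y \<in> G j" and yo: "\<And>v. v \<in> G (Suc j) \<Longrightarrow> inner y v = 0" and z: "z \<in> W (Suc j)"
      have ee: "e j = e (Suc j) - 3" "a (Suc j) = e (Suc j) - 9" "e (Suc j) \<ge> 11"
        using jm m0 by (auto simp: e_def a_def)
      show "inner z y \<le> sqrt f * norm z * norm y"
        by (rule segment_overlap[OF kap ee(3) e(2) f(1,2)]) (use y yo z ee in \<open>auto simp: G_def W_def\<close>)
    qed
    then have "g * ((1 - sqrt 3 * sqrt f)\<^sup>2 * inner x x) \<le> g * (\<Sum>j\<le>m. inner (x - oproj (W j) x) (x - oproj (W j) x))"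
      using g by (intro mult_left_mono) auto
    also have "\<dots> = (\<Sum>j\<le>m. g * inner (x - oproj (W j) x) (x - oproj (W j) x))" by (simp add: sum_distrib_left)
    also have "\<dots> \<le> (\<Sum>j\<le>m. E_seg {1..L} kap lam id (a j) (e j) (amp x))"
      using gW[OF x] by (intro sum_mono) auto
    also have "\<dots> \<le> 3 * energy {1..L} kap lam id {1..L-2} {1..L-3} (amp x)" by (rule cover)
    finally show "g / 3 * (1 - sqrt 3 * sqrt f)\<^sup>2 * inner x x \<le> energy {1..L} kap lam id {1..L-2} {1..L-3} (amp x)" by simp
  qed auto
  then show ?thesis by (simp add: gap_open_def H_open_eq L_def real_sqrt_mult)
qed

lemma gap_per_nonneg:
  assumes kap: "kap > 0" and L: "L \<ge> 3"
  shows "gap_per kap lam L \<ge> 0"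
  unfolding gap_per_def H_per_eq
proof (rule op_gap_greatest_H_terms[OF kap])
  show "term_sites (wrap 1 L) {1..L} {1..L} \<subseteq> {1..L}"
    using wrap_range[of L] L unfolding term_sites_def by auto
  show "wrap 1 L 3 = 3" using L by (simp add: wrap_def)
qed (use kap L energy_nonneg in \<open>auto simp: wrap_def\<close>)

theorem theorem1p2:
  fixes kap :: real and lam :: complex
  assumes "kap > 0"
  shows "let gam = min (gap_open kap lam 6) (gap_open kap lam 7);
             Gam = max (norm_open kap lam 6) (norm_open kap lam 7)
         in (\<forall>n::nat. n \<ge> 2 \<longrightarrow>
               (let g = Min ((\<lambda>r. gap_open kap lam (3 * (int n + 1) + r)) ` {0..5})
                in g > Gam / real n \<longrightarrow>
                   (\<forall>N::nat. \<forall>r::int. n < N \<and> 0 \<le> r \<and> r \<le> 5 \<longrightarrow>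
                      gap_per kap lam (6 * int N + r)
                        \<ge> gam * real n / (2 * Gam * (real n - 1)) * (g - Gam / real n))))
          \<and> (f_sup ((cmod lam)\<^sup>2) < 1/3 \<longrightarrow>
               Liminf sequentially (\<lambda>L::nat. ereal (gap_per kap lam (int L)))
                 \<ge> ereal (gam / (6 * Gam) * Min (gap_open kap lam ` {8, 9, 10})
                          * (1 - sqrt (3 * real_of_ereal (f_sup ((cmod lam)\<^sup>2))))\<^sup>2))"
proof -
  define gam where "gam = min (gap_open kap lam 6) (gap_open kap lam 7)"
  define Gam where "Gam = max (norm_open kap lam 6) (norm_open kap lam 7)"
  have gam: "gam \<le> gap_open kap lam 6" "gam \<le> gap_open kap lam 7" "gam \<ge> 0"
    using gap_open_nonneg[OF assms, of 6 lam] gap_open_nonneg[OF assms, of 7 lam] by (auto simp: gam_def)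
  have Gam: "norm_open kap lam 6 \<le> Gam" "norm_open kap lam 7 \<le> Gam" by (auto simp: Gam_def)
  have Gpos: "Gam > 0" using norm_open_pos[OF assms, of 6 lam] Gam by simp
  have ring: "gam * real n / (2 * Gam * (real n - 1)) * (g - Gam / real n) \<le> gap_per kap lam (6 * int N + r)"
    if "n \<ge> 2" "n < N" "0 \<le> r" "r \<le> 5" "g > Gam / real n"
      "\<And>r. 0 \<le> r \<Longrightarrow> r \<le> 5 \<Longrightarrow> g \<le> gap_open kap lam (3 * (int n + 1) + r)" for n N r g
    by (rule ring_gap_all[OF assms that(1-4) gam Gam that(6,5)])
  have part1: "gam * real n / (2 * Gam * (real n - 1)) * (g - Gam / real n) \<le> gap_per kap lam (6 * int N + r)"
    if "n \<ge> 2" "g = Min ((\<lambda>r. gap_open kap lam (3 * (int n + 1) + r)) ` {0..5})" "g > Gam / real n"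
      "n < N \<and> 0 \<le> r \<and> r \<le> 5" for n N r g
    using that by (intro ring) auto
  have part2: "Liminf sequentially (\<lambda>L::nat. ereal (gap_per kap lam (int L)))
     \<ge> ereal (gam / (6 * Gam) * Min (gap_open kap lam ` {8, 9, 10}) * (1 - sqrt (3 * real_of_ereal (f_sup ((cmod lam)\<^sup>2))))\<^sup>2)"
    if fs: "f_sup ((cmod lam)\<^sup>2) < 1/3"
  proof -
    define r where "r = (cmod lam)\<^sup>2"
    define f where "f = real_of_ereal (f_sup r)"
    define g where "g = Min (gap_open kap lam ` {8, 9, 10})"
    define c where "c = g / 3 * (1 - sqrt (3 * f))\<^sup>2"
    have up: "ereal (f_n n r) \<le> f_sup r" if "n \<ge> 4" for n
      unfolding f_sup_def by (rule SUP_upper) (use that in simp)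
    have f4: "f_n 4 r \<ge> 0" by (rule f_n_nonneg) (auto simp: r_def)
    have fsr: "f_sup r < ereal (1/3)" using fs by (simp add: r_def one_ereal_def)
    have fe: "f_sup r = ereal f"
    proof (cases "f_sup r")
      case MInf
      then show ?thesis using up[of 4] by simp
    qed (use fsr in \<open>auto simp: f_def\<close>)
    have f: "f_n n r \<le> f" if "n \<ge> 4" for n using up[OF that] fe by simp
    have f0: "f \<ge> 0" using f[of 4] f4 by simp
    have f3: "f < 1/3" using fsr fe by simp
    have gle: "g \<le> gap_open kap lam m0" if "m0 \<in> {8, 9, 10}" for m0
      unfolding g_def using that by (intro Min_le) auto
    have g0: "g \<ge> 0" unfolding g_def using gap_open_nonneg[OF assms] by (subst Min_ge_iff) auto
    have open_c: "c \<le> gap_open kap lam K" if K: "K \<ge> 8" for K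
    proof -
      define m where "m = nat ((K - 8) div 3)"
      define m0 where "m0 = 8 + (K - 8) mod 3"
      have "(K - 8) div 3 \<ge> 0" using K by (simp add: pos_imp_zdiv_nonneg_iff)
      then have Km: "K = m0 + 3 * int m" by (simp add: m_def m0_def)
      have "0 \<le> (K - 8) mod 3" "(K - 8) mod 3 < 3" by simp_all
      then have m0: "m0 \<in> {8, 9, 10}" unfolding m0_def by auto
      show ?thesis unfolding c_def Km
        by (rule open_gap_bound[OF assms m0 f0 f[unfolded r_def] f3 _ gle[OF m0] g0]) (use gle[of 9] in auto)
    qed
    have target: "gam / (6 * Gam) * g * (1 - sqrt (3 * f))\<^sup>2 = gam / (2 * Gam) * c" by (simp add: c_def)
    have "ereal (gam / (2 * Gam) * c) \<le> Liminf sequentially (\<lambda>L::nat. ereal (gap_per kap lam (int L)))"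
    proof (cases "c > 0")
      case False
      then have "c = 0" using g0 by (simp add: c_def zero_less_mult_iff not_less)
      have "\<forall>\<^sub>F L in sequentially. ereal 0 \<le> ereal (gap_per kap lam (int L))"
        using eventually_ge_at_top[of 3] by eventually_elim (use gap_per_nonneg[OF assms] in auto)
      then have "ereal 0 \<le> Liminf sequentially (\<lambda>L::nat. ereal (gap_per kap lam (int L)))" by (rule Liminf_bounded)
      then show ?thesis using \<open>c = 0\<close> by simp
    next
      case True
      define h where "h n = gam / (2 * Gam) * (c - Gam / real n)" for n :: nat
      have ev: "\<forall>\<^sub>F n in sequentially. ereal (h n) \<le> Liminf sequentially (\<lambda>L::nat. ereal (gap_per kap lam (int L)))"
      proof -
        have "(\<lambda>n. Gam / real n) \<longlonglongrightarrow> 0" by (rule lim_const_over_n)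
        then have "\<forall>\<^sub>F n in sequentially. Gam / real n < c" using True by (rule order_tendstoD)
        with eventually_ge_at_top[of 2] show ?thesis
        proof eventually_elim
          case (elim n)
          have "h n \<le> gap_per kap lam (int L)" if L: "L \<ge> 6 * (n + 1)" for L
          proof -
            define N where "N = L div 6"
            define s where "s = int (L mod 6)"
            have LN: "int L = 6 * int N + s" unfolding N_def s_def by presburger
            have N: "n < N" using L by (simp add: N_def)
            have s: "0 \<le> s" "s \<le> 5" by (auto simp: s_def)
            have "h n = gam / (2 * Gam) * (c - Gam / real n) * 1" by (simp add: h_def)
            also have "\<dots> \<le> gam / (2 * Gam) * (c - Gam / real n) * (real n / (real n - 1))"
              using elim gam Gpos by (intro mult_left_mono mult_nonneg_nonneg) (auto simp: field_simps)
            also have "\<dots> = gam * real n / (2 * Gam * (real n - 1)) * (c - Gam / real n)" by (simp add: mult_ac)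
            also have "\<dots> \<le> gap_per kap lam (6 * int N + s)"
              by (rule ring[OF _ N s]) (use elim open_c in auto)
            finally show ?thesis by (simp add: LN)
          qed
          then have "\<forall>\<^sub>F L in sequentially. ereal (h n) \<le> ereal (gap_per kap lam (int L))"
            unfolding eventually_sequentially by (intro exI[of _ "6 * (n + 1)"]) simp
          then show ?case by (rule Liminf_bounded)
        qed
      qed
      have "(\<lambda>n. h n) \<longlonglongrightarrow> gam / (2 * Gam) * (c - 0)"
        unfolding h_def by (intro tendsto_intros lim_const_over_n)
      then have "(\<lambda>n. ereal (h n)) \<longlonglongrightarrow> ereal (gam / (2 * Gam) * c)" by simp
      from tendsto_upperbound[OF this ev] show ?thesis by simp
    qed
    then show ?thesis using target by (simp add: g_def f_def r_def)
  qed
  show ?thesis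
    unfolding Let_def gam_def[symmetric] Gam_def[symmetric] using part1 part2 by blast
qed

end
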